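(* Let $N\geq 4$, $K\geq 2$, $1\leq l\leq K-1$, $K+1\leq r\leq N-1$ be integers. For $1\leq k\leq N$ let $G_k:\mathbb{R}\to\mathbb{R}$ with $G_k\in L^1(\mathbb{R})$, let $a_k\geq 0$ be constants, and for $1\leq k\leq K$ let $b_k\in\mathbb{R}$, $b_k\neq 0$. Let $F_k(u,x):\mathbb{R}^N\times\mathbb{R}\to\mathbb{R}$, $1\leq k\leq N$, satisfy the Carath\'eodory condition, and suppose that $$\sqrt{\sum_{k=1}^N F_k^2(u,x)}\leq \mathcal{K}|u|_{\mathbb{R}^N}+h(x)\quad\text{for } u\in\mathbb{R}^N,\ x\in\mathbb{R},$$ with a constant $\mathcal{K}>0$ and a function $h:\mathbb{R}\to\mathbb{R}^+$, $h\in L^2(\mathbb{R})$, and that $$\sqrt{\sum_{k=1}^N \big(F_k(u^{(1)},x)-F_k(u^{(2)},x)\big)^2}\leq L|u^{(1)}-u^{(2)}|_{\mathbb{R}^N}\quad\text{for all } u^{(1)},u^{(2)}\in\mathbb{R}^N,\ x\in\mathbb{R},$$ with a constant $L>0$. Assume: (a) $a_k>0$ for $1\leq k\leq l$; (b) $a_k=0$ for $l+1\leq k\leq K$, and for these $k$ also $xG_k(x)\in L^1(\mathbb{R})$ and $\int_{\mathbb{R}}G_k(x)\,dx=0$; (c) $a_k>0$ for $K+1\leq k\leq r$, and for these $k$ also $xG_k(x)\in L^1(\mathbb{R})$ and $\int_{\mathbb{R}}G_k(x)e^{\mp i\sqrt{a_k}x}\,dx=0$ (both signs); (d) $a_k=0$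 for $r+1\leq k\leq N$, and for these $k$ also $x^2G_k(x)\in L^1(\mathbb{R})$, $\int_{\mathbb{R}}G_k(x)\,dx=0$ and $\int_{\mathbb{R}}xG_k(x)\,dx=0$; and $2\sqrt{\pi}\,Q L<1$, where $Q$ is defined in the context below. For $v=(v_1,\dots,v_N)\in H^2(\mathbb{R},\mathbb{R}^N)$ let $T_{a,b}v=u$ be defined by the system $$-u_k''-b_ku_k'-a_ku_k=\int_{\mathbb{R}}G_k(x-y)F_k(v_1(y),\dots,v_N(y),y)\,dy,\quad 1\leq k\leq K,$$ $$-u_k''-a_ku_k=\int_{\mathbb{R}}G_k(x-y)F_k(v_1(y),\dots,v_N(y),y)\,dy,\quad K+1\leq k\leq N.$$ Then the map $v\mapsto T_{a,b}v=u$ on $H^2(\mathbb{R},\mathbb{R}^N)$ has a unique fixed point $v^{(a,b)}$, which is the only solution in $H^2(\mathbb{R},\mathbb{R}^N)$ of the system $$u_k''+b_ku_k'+a_ku_k+\int_{\mathbb{R}}G_k(x-y)F_k(u_1(y),\dots,u_N(y),y)\,dy=0,\quad 1\leq k\leq K,$$ $$u_k''+a_ku_k+\int_{\mathbb{R}}G_k(x-y)F_k(u_1(y),\dots,u_N(y),y)\,dy=0,\quad K+1\leq k\leq N.$$ The fixed point $v^{(a,b)}$ is nontrivial provided that for some $1\leq k\leq N$ the intersection $\operatorname{supp}\widehat{F_k(0,x)}\cap\operatorname{supp}\widehat{G_k}$ is a set of nonzero Lebesgue measure in $\mathbb{R}$.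
   Context: For $u=(u_1,\dots,u_N)\in\mathbb{R}^N$, $|u|_{\mathbb{R}^N}=\sqrt{\sum_k u_k^2}$. The space $H^2(\mathbb{R},\mathbb{R}^N)$ consists of vector functions with real components in $H^2(\mathbb{R})$, with norm $\|u\|^2_{H^2(\mathbb{R},\mathbb{R}^N)}=\sum_{k=1}^N\big(\|u_k\|^2_{L^2(\mathbb{R})}+\|u_k''\|^2_{L^2(\mathbb{R})}\big)$. The Fourier transform is $\widehat{G}(p)=\frac{1}{\sqrt{2\pi}}\int_{\mathbb{R}}G(x)e^{-ipx}dx$. Define $N_{a,b,k}=\max\Big\{\Big\|\frac{\widehat{G_k}(p)}{p^2-a_k-ib_kp}\Big\|_{L^\infty(\mathbb{R})},\Big\|\frac{p^2\widehat{G_k}(p)}{p^2-a_k-ib_kp}\Big\|_{L^\infty(\mathbb{R})}\Big\}$ for $1\leq k\leq K$, $M_{a,k}=\max\Big\{\Big\|\frac{\widehat{G_k}(p)}{p^2-a_k}\Big\|_{L^\infty(\mathbb{R})},\Big\|\frac{p^2\widehat{G_k}(p)}{p^2-a_k}\Big\|_{L^\infty(\mathbb{R})}\Big\}$ for $K+1\leq k\leq N$, and $Q=\max\{\max_{1\leq k\leq K}N_{a,b,k},\ \max_{K+1\leq k\leq N}M_{a,k}\}$ (finite under the hypotheses).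
   Formalization: The supports of the transforms of F_k(0,x) and G_k are read as the sets where the transforms are nonzero, so both must be nonzero on a common set of positive measure; with closed supports the nontriviality claim is false (fat Cantor sets). *)

theory Defs
  imports "HOL-Analysis.Analysis" "HOL-Probability.Essential_Supremum"
begin

text \<open>Vectors of R^N are represented as functions nat => real, only the
components 1..N being relevant; vector functions as nat => real => real.\<close>

definition vnorm :: "nat \<Rightarrow> (nat \<Rightarrow> real) \<Rightarrow> real" where
  "vnorm N u = sqrt (\<Sum>k=1..N. (u k)\<^sup>2)"

definition sq_integrable :: "(real \<Rightarrow> real) \<Rightarrow> bool" where
  "sq_integrable f \<longleftrightarrow> f \<in> borel_measurable lborel \<and> integrable lborel (\<lambda>x. (f x)\<^sup>2)"

text \<open>f (continuous representative) lies in H^2(R), with classical derivative f'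
(absolutely continuous) and weak second derivative f''.\<close>
definition H2_witness :: "(real \<Rightarrow> real) \<Rightarrow> (real \<Rightarrow> real) \<Rightarrow> (real \<Rightarrow> real) \<Rightarrow> bool" where
  "H2_witness f f' f'' \<longleftrightarrow>
     (\<forall>x. (f has_real_derivative f' x) (at x)) \<and>
     (\<forall>a b. a \<le> b \<longrightarrow> set_integrable lborel {a..b} f'' \<and>
                         f' b - f' a = (LINT t:{a..b}|lborel. f'' t)) \<and>
     sq_integrable f \<and> sq_integrable f' \<and> sq_integrable f''"

definition H2 :: "(real \<Rightarrow> real) \<Rightarrow> bool" where
  "H2 f \<longleftrightarrow> (\<exists>f' f''. H2_witness f f' f'')"

definition H2N :: "nat \<Rightarrow> (nat \<Rightarrow> real \<Rightarrow> real) \<Rightarrow> bool" where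
  "H2N N u \<longleftrightarrow> (\<forall>k\<in>{1..N}. H2 (u k)) \<and> (\<forall>k. k \<notin> {1..N} \<longrightarrow> u k = (\<lambda>x. 0))"

definition conv :: "(real \<Rightarrow> real) \<Rightarrow> (real \<Rightarrow> real) \<Rightarrow> real \<Rightarrow> real" where
  "conv G w x = (LINT y|lborel. G (x - y) * w y)"

definition fourier :: "(real \<Rightarrow> real) \<Rightarrow> real \<Rightarrow> complex" where
  "fourier G p = complex_of_real (1 / sqrt (2 * pi)) *
      (LINT x|lborel. complex_of_real (G x) * exp (- \<i> * complex_of_real (p * x)))"

definition fourier_trunc :: "(real \<Rightarrow> real) \<Rightarrow> real \<Rightarrow> real \<Rightarrow> complex" where
  "fourier_trunc f R p = complex_of_real (1 / sqrt (2 * pi)) *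
      (LINT x:{-R..R}|lborel. complex_of_real (f x) * exp (- \<i> * complex_of_real (p * x)))"

definition is_L2_fourier :: "(real \<Rightarrow> real) \<Rightarrow> (real \<Rightarrow> complex) \<Rightarrow> bool" where
  "is_L2_fourier f \<phi> \<longleftrightarrow> \<phi> \<in> borel_measurable lborel \<and>
     ((\<lambda>R. \<integral>\<^sup>+ p. ennreal ((cmod (\<phi> p - fourier_trunc f R p))\<^sup>2) \<partial>lborel) \<longlongrightarrow> 0) at_top"

definition Linf_norm :: "(real \<Rightarrow> complex) \<Rightarrow> ereal" where
  "Linf_norm f = esssup lborel (\<lambda>p. ereal (cmod (f p)))"

definition Nabk :: "(nat \<Rightarrow> real) \<Rightarrow> (nat \<Rightarrow> real) \<Rightarrow> (nat \<Rightarrow> real \<Rightarrow> real) \<Rightarrow> nat \<Rightarrow> ereal" where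
  "Nabk a b G k = max
     (Linf_norm (\<lambda>p. fourier (G k) p /
        ((complex_of_real p)\<^sup>2 - complex_of_real (a k) - \<i> * complex_of_real (b k * p))))
     (Linf_norm (\<lambda>p. (complex_of_real p)\<^sup>2 * fourier (G k) p /
        ((complex_of_real p)\<^sup>2 - complex_of_real (a k) - \<i> * complex_of_real (b k * p))))"

definition Mak :: "(nat \<Rightarrow> real) \<Rightarrow> (nat \<Rightarrow> real \<Rightarrow> real) \<Rightarrow> nat \<Rightarrow> ereal" where
  "Mak a G k = max
     (Linf_norm (\<lambda>p. fourier (G k) p / complex_of_real (p\<^sup>2 - a k)))
     (Linf_norm (\<lambda>p. (complex_of_real p)\<^sup>2 * fourier (G k) p / complex_of_real (p\<^sup>2 - a k)))"

definition Qconst :: "nat \<Rightarrow> nat \<Rightarrow> (nat \<Rightarrow> real) \<Rightarrow> (nat \<Rightarrow> real) \<Rightarrow> (nat \<Rightarrow> real \<Rightarrow> real) \<Rightarrow> ereal" where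
  "Qconst N K a b G = Max ((Nabk a b G) ` {1..K} \<union> (Mak a G) ` {K+1..N})"

definition caratheodory :: "nat \<Rightarrow> ((nat \<Rightarrow> real) \<Rightarrow> real \<Rightarrow> real) \<Rightarrow> bool" where
  "caratheodory N f \<longleftrightarrow>
     (\<forall>x u. \<forall>e>0. \<exists>d>0. \<forall>u'. vnorm N (\<lambda>j. u' j - u j) < d \<longrightarrow> \<bar>f u' x - f u x\<bar> < e) \<and>
     (\<forall>u. (\<lambda>x. f u x) \<in> borel_measurable lborel)"

definition lin_sys :: "nat \<Rightarrow> nat \<Rightarrow> (nat \<Rightarrow> real) \<Rightarrow> (nat \<Rightarrow> real) \<Rightarrow> (nat \<Rightarrow> real \<Rightarrow> real)
     \<Rightarrow> (nat \<Rightarrow> (nat \<Rightarrow> real) \<Rightarrow> real \<Rightarrow> real) \<Rightarrow> (nat \<Rightarrow> real \<Rightarrow> real) \<Rightarrow> (nat \<Rightarrow> real \<Rightarrow> real) \<Rightarrow> bool" where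
  "lin_sys N K a b G F v u \<longleftrightarrow>
     (\<forall>k\<in>{1..K}. \<exists>u' u''. H2_witness (u k) u' u'' \<and>
        (AE x in lborel. - u'' x - b k * u' x - a k * u k x
                          = conv (G k) (\<lambda>y. F k (\<lambda>j. v j y) y) x)) \<and>
     (\<forall>k\<in>{K+1..N}. \<exists>u' u''. H2_witness (u k) u' u'' \<and>
        (AE x in lborel. - u'' x - a k * u k x
                          = conv (G k) (\<lambda>y. F k (\<lambda>j. v j y) y) x))"

definition Tab :: "nat \<Rightarrow> nat \<Rightarrow> (nat \<Rightarrow> real) \<Rightarrow> (nat \<Rightarrow> real) \<Rightarrow> (nat \<Rightarrow> real \<Rightarrow> real)
     \<Rightarrow> (nat \<Rightarrow> (nat \<Rightarrow> real) \<Rightarrow> real \<Rightarrow> real) \<Rightarrow> (nat \<Rightarrow> real \<Rightarrow> real) \<Rightarrow> (nat \<Rightarrow> real \<Rightarrow> real)" where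
  "Tab N K a b G F v = (THE u. H2N N u \<and> lin_sys N K a b G F v u)"

definition nonlin_sys :: "nat \<Rightarrow> nat \<Rightarrow> (nat \<Rightarrow> real) \<Rightarrow> (nat \<Rightarrow> real) \<Rightarrow> (nat \<Rightarrow> real \<Rightarrow> real)
     \<Rightarrow> (nat \<Rightarrow> (nat \<Rightarrow> real) \<Rightarrow> real \<Rightarrow> real) \<Rightarrow> (nat \<Rightarrow> real \<Rightarrow> real) \<Rightarrow> bool" where
  "nonlin_sys N K a b G F u \<longleftrightarrow>
     (\<forall>k\<in>{1..K}. \<exists>u' u''. H2_witness (u k) u' u'' \<and>
        (AE x in lborel. u'' x + b k * u' x + a k * u k x
                          + conv (G k) (\<lambda>y. F k (\<lambda>j. u j y) y) x = 0)) \<and>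
     (\<forall>k\<in>{K+1..N}. \<exists>u' u''. H2_witness (u k) u' u'' \<and>
        (AE x in lborel. u'' x + a k * u k x
                          + conv (G k) (\<lambda>y. F k (\<lambda>j. u j y) y) x = 0))"

end

theory Submission
  imports Defs "HOL-Probability.Characteristic_Functions"
begin

text \<open>
  Under the moment conditions the operator \<open>- D\<^sup>2 - b D - a\<close> has a kernel: there is \<open>E\<close> with
  \<open>E, E'\<close> integrable and \<open>- E'' - b E' - a E = G\<close>, obtained by solving first order equations
  \<open>E' = lam E + g\<close> with \<open>lam\<close> a characteristic root; at a root on the imaginary axis the vanishing
  moment makes \<open>E\<close> integrable. The convolution \<open>E * w\<close> then solves the linear problem with
  right-hand side \<open>G * w\<close> in \<open>H\<^sup>2\<close>, and it is the only solution because the energy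
  \<open>z'\<^sup>2 + a z\<^sup>2\<close> of a homogeneous solution is monotone and integrable.

  The transform of \<open>E\<close> is that of \<open>G\<close> divided by the symbol, hence bounded by \<open>Q\<close>, and
  \<open>w \<mapsto> E * w\<close> has norm at most \<open>sqrt (2 pi) Q\<close> on \<open>L\<^sup>2\<close>. This half of Plancherel's theorem follows
  from the identity \<open>\<integral> |f^(p)|\<^sup>2 exp (- (d p)\<^sup>2 / 2) dp = \<integral> A (d t) \<phi>(t) dt\<close>, where \<open>A\<close> is the
  autocorrelation of \<open>f\<close> and \<open>\<phi>\<close> the standard normal density: the right-hand side is at most
  \<open>A 0 = \<parallel>f\<parallel>\<^sup>2\<close> and tends to it as \<open>d\<close> tends to \<open>0\<close>. So the solution map is a contraction in the \<open>L\<^sup>2\<close> norm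
  alone; its Picard iterates converge pointwise, since \<open>|E * w| \<le> \<parallel>E\<parallel> \<parallel>w\<parallel>\<close>, and the limit lies
  in \<open>H\<^sup>2\<close> as a convolution with \<open>E\<close>. If the fixed point is \<open>0\<close>, then \<open>E * F(0, \<cdot>) = 0\<close>, so the
  product of the two transforms vanishes almost everywhere.
\<close>

section \<open>Absolutely continuous functions and convolution\<close>

text \<open>Tonelli's criterion, which justifies every exchange of integrals below; the inner
  integral runs over the first variable.\<close>

lemma integrable_pair_lborelI:
  fixes f :: "real \<times> real \<Rightarrow> 'a::{banach, second_countable_topology}"
  assumes [measurable]: "f \<in> borel_measurable (lborel \<Otimes>\<^sub>M lborel)"
    and bound: "\<And>y. (\<integral>\<^sup>+x. norm (f (x, y)) \<partial>lborel) \<le> ennreal (g y)"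
    and g: "integrable lborel g"
  shows "integrable (lborel \<Otimes>\<^sub>M lborel) f"
  unfolding integrable_iff_bounded
proof
  have "(\<integral>\<^sup>+z. norm (f z) \<partial>(lborel \<Otimes>\<^sub>M lborel)) = (\<integral>\<^sup>+y. \<integral>\<^sup>+x. norm (f (x, y)) \<partial>lborel \<partial>lborel)"
    by (rule lborel_pair.nn_integral_snd[symmetric]) simp
  also have "\<dots> \<le> (\<integral>\<^sup>+y. ennreal (norm (g y)) \<partial>lborel)"
    by (intro nn_integral_mono order_trans[OF bound]) (simp add: ennreal_leI)
  also have "\<dots> < \<infinity>" using g by (simp add: integrable_iff_bounded)
  finally show "(\<integral>\<^sup>+z. norm (f z) \<partial>(lborel \<Otimes>\<^sub>M lborel)) < \<infinity>" .
qed simp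

lemma integrable_translate_reflect:
  fixes f :: "real \<Rightarrow> 'a::{banach, second_countable_topology}"
  assumes "integrable lborel f"
  shows "integrable lborel (\<lambda>y. f (x - y))" "integrable lborel (\<lambda>y. f (y - x))"
    "integrable lborel (\<lambda>y. f (- y))"
  using lborel_integrable_real_affine[OF assms, of "-1" x]
    lborel_integrable_real_affine[OF assms, of 1 "-x"]
    lborel_integrable_real_affine[OF assms, of "-1" 0] by simp_all

lemma integral_translate_reflect:
  fixes f :: "real \<Rightarrow> 'a::{banach, second_countable_topology}"
  shows "(LINT y|lborel. f (x - y)) = (LINT y|lborel. f y)"
    "(LINT y|lborel. f (y - x)) = (LINT y|lborel. f y)"
    "(LINT y|lborel. f (y + x)) = (LINT y|lborel. f y)"
    "(LINT y|lborel. f (- y)) = (LINT y|lborel. f y)"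
  using lborel_integral_real_affine[of "-1" f x] lborel_integral_real_affine[of 1 f "-x"]
    lborel_integral_real_affine[of 1 f "x"] lborel_integral_real_affine[of "-1" f 0]
  by (simp_all add: add.commute)

lemma nn_integral_translate:
  fixes f :: "real \<Rightarrow> ennreal"
  assumes "f \<in> borel_measurable borel"
  shows "(\<integral>\<^sup>+x. f (x - y) \<partial>lborel) = (\<integral>\<^sup>+x. f x \<partial>lborel)"
  using nn_integral_real_affine[OF assms, of 1 "-y"] by simp

section \<open>Primitives of locally integrable functions\<close>

text \<open>Local absolute continuity, stated through increments and integrals: reflection and
  convolution then become substitution and Fubini, and \<open>f'\<close> matters only up to null
  sets. The clause on \<open>f''\<close> in \<open>H2_witness\<close> has this form.\<close>

definition ac_deriv ::
    "(real \<Rightarrow> 'a::{banach, second_countable_topology}) \<Rightarrow> (real \<Rightarrow> 'a) \<Rightarrow> bool" where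
  "ac_deriv f f' \<longleftrightarrow> (\<forall>a b. a \<le> b \<longrightarrow> set_integrable lborel {a..b} f' \<and>
                         f b - f a = (LINT t:{a..b}|lborel. f' t))"

lemma ac_derivD:
  assumes "ac_deriv f f'" "a \<le> b"
  shows "set_integrable lborel {a..b} f'" "f b - f a = (LINT t:{a..b}|lborel. f' t)"
  using assms unfolding ac_deriv_def by auto

text \<open>Serves for real parts, negation and multiplication by complex constants.\<close>

lemma ac_deriv_bounded_linear:
  assumes T: "bounded_linear T" and f: "ac_deriv f f'"
  shows "ac_deriv (\<lambda>x. T (f x)) (\<lambda>x. T (f' x))"
  unfolding ac_deriv_def
proof (intro allI impI)
  fix a b :: real assume ab: "a \<le> b"
  interpret bounded_linear T by fact
  have I: "integrable lborel (\<lambda>t. indicator {a..b} t *\<^sub>R f' t)"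
    using ac_derivD(1)[OF f ab] by (simp add: set_integrable_def)
  have "T (f b) - T (f a) = T (LINT t|lborel. indicator {a..b} t *\<^sub>R f' t)"
    using ac_derivD(2)[OF f ab] by (simp add: diff[symmetric] set_lebesgue_integral_def)
  also have "\<dots> = (LINT t|lborel. T (indicator {a..b} t *\<^sub>R f' t))"
    by (rule integral_bounded_linear[OF T I, symmetric])
  finally show "set_integrable lborel {a..b} (\<lambda>x. T (f' x)) \<and>
      T (f b) - T (f a) = (LINT t:{a..b}|lborel. T (f' t))"
    using integrable_bounded_linear[OF T I]
    by (simp add: set_integrable_def set_lebesgue_integral_def scaleR)
qed

lemma ac_deriv_add:
  assumes f: "ac_deriv f f'" and g: "ac_deriv g g'"
  shows "ac_deriv (\<lambda>x. f x + g x) (\<lambda>x. f' x + g' x)"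
  unfolding ac_deriv_def
proof (intro allI impI)
  fix a b :: real assume ab: "a \<le> b"
  note F = ac_derivD[OF f ab] ac_derivD[OF g ab]
  show "set_integrable lborel {a..b} (\<lambda>x. f' x + g' x) \<and>
      f b + g b - (f a + g a) = (LINT t:{a..b}|lborel. f' t + g' t)"
    using F by (auto simp: set_integral_add algebra_simps)
qed

lemma ac_deriv_reflect:
  assumes f: "ac_deriv f f'"
  shows "ac_deriv (\<lambda>x. f (- x)) (\<lambda>x. - f' (- x))"
  unfolding ac_deriv_def
proof (intro allI impI)
  fix a b :: real assume ab: "a \<le> b"
  then have ab': "-b \<le> -a" by simp
  have ind: "indicator {a..b} x = (indicator {-b..-a} (-x) :: real)" for x :: real
    by (auto simp: indicator_def)
  have I: "integrable lborel (\<lambda>t. indicator {-b..-a} t *\<^sub>R f' t)"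
    using ac_derivD(1)[OF f ab'] by (simp add: set_integrable_def)
  have "(LINT t:{a..b}|lborel. - f' (- t)) = - (LINT t:{-b..-a}|lborel. f' t)"
    unfolding set_lebesgue_integral_def
    using integral_translate_reflect(4)[of "\<lambda>t. indicator {-b..-a} t *\<^sub>R f' t"]
    by (simp add: ind)
  then show "set_integrable lborel {a..b} (\<lambda>x. - f' (- x)) \<and>
      f (- b) - f (- a) = (LINT t:{a..b}|lborel. - f' (- t))"
    using integrable_translate_reflect(3)[OF I] ac_derivD(2)[OF f ab']
    by (auto simp: set_integrable_def ind algebra_simps)
qed

text \<open>Every increment is at most the \<open>L^1\<close> norm of \<open>f'\<close>, so all
  values stay within that distance of \<open>f 0\<close>.\<close>

lemma ac_deriv_bounded:
  assumes f: "ac_deriv f f'" and f': "integrable lborel f'"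
  obtains B where "B \<ge> 0" "\<And>x. norm (f x) \<le> B"
proof
  let ?B = "norm (f 0) + (LINT t|lborel. norm (f' t))"
  show "?B \<ge> 0" by simp
  have *: "norm (f b - f a) \<le> (LINT t|lborel. norm (f' t))" if "a \<le> b" for a b
  proof -
    have "norm (f b - f a) \<le> (LINT t|lborel. norm (indicator {a..b} t *\<^sub>R f' t))"
      unfolding ac_derivD(2)[OF f that] set_lebesgue_integral_def
      by (rule integral_norm_bound)
    also have "\<dots> \<le> (LINT t|lborel. norm (f' t))"
      using f' ac_derivD(1)[OF f that] unfolding set_integrable_def
      by (intro integral_mono integrable_norm) (auto simp: indicator_def)
    finally show ?thesis .
  qed
  show "norm (f x) \<le> ?B" for x
    using *[of 0 x] *[of x 0] norm_triangle_ineq2[of "f x" "f 0"] norm_minus_commute[of "f x" "f 0"]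
    by (cases "x \<ge> 0") auto
qed

lemma ac_deriv_isCont:
  fixes f :: "real \<Rightarrow> 'a::euclidean_space"
  assumes f: "ac_deriv f f'"
  shows "isCont f x"
proof -
  have ab: "x - 1 \<le> x + 1" by simp
  have I: "f' integrable_on {x-1..x+1}"
    using set_borel_integral_eq_integral(1)[OF ac_derivD(1)[OF f ab]] .
  have eq: "f t = f (x - 1) + integral {x-1..t} f'" if "t \<in> {x-1..x+1}" for t
    using that ac_derivD[OF f, of "x-1" t] set_borel_integral_eq_integral(2)[of "{x-1..t}" f']
    by (auto simp: algebra_simps)
  have "continuous_on {x-1..x+1} f"
    by (subst continuous_on_cong[OF refl eq]; (intro continuous_intros indefinite_integral_continuous_1[OF I])?)
  then show ?thesis
    by (rule continuous_on_interior) simp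
qed

text \<open>Continuity of \<open>f'\<close> makes the fundamental theorem hold at every point. This
  supplies the classical first derivative demanded by \<open>H2_witness\<close>.\<close>

lemma ac_deriv_has_vector_derivative:
  fixes f :: "real \<Rightarrow> 'a::euclidean_space"
  assumes f: "ac_deriv f f'" and c: "\<And>x. isCont f' x"
  shows "(f has_vector_derivative f' x) (at x)"
proof -
  have eq: "f t = f (x - 1) + integral {x-1..t} f'" if "t \<in> {x-1..x+1}" for t
    using that ac_derivD[OF f, of "x-1" t] set_borel_integral_eq_integral(2)[of "{x-1..t}" f']
    by (auto simp: algebra_simps)
  have "((\<lambda>t. integral {x-1..t} f') has_vector_derivative f' x) (at x within {x-1..x+1})"
    using c by (intro integral_has_vector_derivative continuous_at_imp_continuous_on) auto
  then have "((\<lambda>t. f (x-1) + integral {x-1..t} f') has_vector_derivative f' x) (at x within {x-1..x+1})"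
    by (auto intro!: derivative_eq_intros)
  then have "(f has_vector_derivative f' x) (at x within {x-1..x+1})"
    by (rule has_vector_derivative_transform[rotated 2]) (simp, erule eq)
  then show ?thesis
    using at_within_interior[of x "{x-1..x+1}"] by simp
qed

text \<open>\<open>lborel\<close> is not complete, so measurability of \<open>g\<close> does not
  follow from that of \<open>f'\<close> and is assumed.\<close>

lemma ac_deriv_cong_AE:
  assumes f: "ac_deriv f f'" and g: "g \<in> borel_measurable lborel" and AE: "AE x in lborel. f' x = g x"
  shows "ac_deriv f g"
  unfolding ac_deriv_def
proof (intro allI impI)
  fix a b :: real assume ab: "a \<le> b"
  have m: "(\<lambda>t. indicator {a..b} t *\<^sub>R f' t) \<in> borel_measurable lborel"
    using ac_derivD(1)[OF f ab] by (auto simp: set_integrable_def)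
  have m2: "(\<lambda>t. indicator {a..b} t *\<^sub>R g t) \<in> borel_measurable lborel"
    using g by measurable
  have ae: "AE t in lborel. indicator {a..b} t *\<^sub>R f' t = indicator {a..b} t *\<^sub>R g t"
    using AE by eventually_elim simp
  show "set_integrable lborel {a..b} g \<and> f b - f a = (LINT t:{a..b}|lborel. g t)"
    using ac_derivD[OF f ab] integrable_cong_AE[OF m m2 ae] integral_cong_AE[OF m m2 ae]
    unfolding set_integrable_def set_lebesgue_integral_def by simp
qed

text \<open>A weight in \<open>L\<^sup>\<infinity> + L\<^sup>1\<close> covers both square integrable functions and characters.\<close>

lemma ac_deriv_convolution:
  fixes E E' :: "real \<Rightarrow> real" and w :: "real \<Rightarrow> 'a::{banach, second_countable_topology}"
  assumes E: "ac_deriv E E'" and iE: "integrable lborel E" and iE': "integrable lborel E'"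
    and w: "w \<in> borel_measurable lborel" and v: "integrable lborel v"
    and wv: "\<And>y. norm (w y) \<le> C + v y" and v0: "\<And>y. v y \<ge> 0"
  shows "ac_deriv (\<lambda>x. LINT y|lborel. E (x - y) *\<^sub>R w y) (\<lambda>x. LINT y|lborel. E' (x - y) *\<^sub>R w y)"
proof -
  note [measurable] = w borel_measurable_integrable[OF iE] borel_measurable_integrable[OF iE']
    borel_measurable_integrable[OF v]
  obtain B where B: "B \<ge> 0" "\<And>x. norm (E x) \<le> B" using ac_deriv_bounded[OF E iE'] by blast
  \<comment> \<open>The constant part of the weight is paired with the integrability of
    \<open>E\<close>, the part \<open>v\<close> with the bound \<open>B\<close>.\<close>
  have I: "integrable lborel (\<lambda>y. E (x - y) *\<^sub>R w y)" for x
  proof (rule Bochner_Integration.integrable_bound)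
    show "integrable lborel (\<lambda>y. \<bar>C\<bar> * norm (E (x - y)) + B * v y)"
      by (intro Bochner_Integration.integrable_add integrable_mult_right integrable_norm
          integrable_translate_reflect iE v)
    show "AE y in lborel. norm (E (x - y) *\<^sub>R w y) \<le> norm (\<bar>C\<bar> * norm (E (x - y)) + B * v y)"
    proof (intro AE_I2)
      fix y
      have "norm (E (x - y) *\<^sub>R w y) \<le> norm (E (x - y)) * (\<bar>C\<bar> + v y)"
        using wv[of y] by (auto intro!: mult_left_mono)
      also have "\<dots> \<le> \<bar>C\<bar> * norm (E (x - y)) + B * v y"
        using mult_right_mono[OF B(2)[of "x - y"] v0[of y]] by (simp add: algebra_simps)
      also have "\<dots> \<le> norm \<dots>" by simp
      finally show "norm (E (x - y) *\<^sub>R w y) \<le> norm (\<bar>C\<bar> * norm (E (x - y)) + B * v y)" .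
    qed
  qed measurable
  show ?thesis
    unfolding ac_deriv_def
  proof (intro allI impI)
    fix a b :: real assume ab: "a \<le> b"
    define f where "f = (\<lambda>(x, y). indicator {a..b} x *\<^sub>R (E' (x - y) *\<^sub>R w y))"
    have [measurable]: "f \<in> borel_measurable (lborel \<Otimes>\<^sub>M lborel)"
      unfolding f_def by measurable
    let ?n = "LINT x|lborel. \<bar>E' x\<bar>"
    have abs': "integrable lborel (\<lambda>x. \<bar>E' x\<bar>)" using iE' by simp
    \<comment> \<open>The mass of the shifted \<open>E'\<close> inside \<open>{a..b}\<close>. It is
      bounded by \<open>?n\<close>, which serves the summand \<open>v\<close>, and integrable in
      \<open>y\<close>, which serves the constant \<open>C\<close>.\<close>
    define m where "m = (\<lambda>y. LINT x|lborel. indicator {a..b} x * \<bar>E' (x - y)\<bar>)"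
    have iab: "integrable lborel (\<lambda>x. indicator {a..b} x * \<bar>E' (x - y)\<bar>)" for y
      by (rule Bochner_Integration.integrable_bound[OF integrable_translate_reflect(2)[OF abs', of y]])
         (auto simp: indicator_def)
    have m_le: "m y \<le> ?n" and m_0: "m y \<ge> 0" for y
    proof -
      have "m y \<le> (LINT x|lborel. \<bar>E' (x - y)\<bar>)"
        unfolding m_def by (intro integral_mono iab integrable_translate_reflect(2)[OF abs'])
          (auto simp: indicator_def)
      then show "m y \<le> ?n" using integral_translate_reflect(2)[of "\<lambda>x. \<bar>E' x\<bar>" y] by simp
      show "m y \<ge> 0" unfolding m_def by (intro integral_nonneg_AE) auto
    qed
    have [measurable]: "m \<in> borel_measurable lborel"
      unfolding m_def by measurable
    have im: "integrable lborel m"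
    proof -
      have "integrable (lborel \<Otimes>\<^sub>M lborel) (\<lambda>(y, x). indicator {a..b} x * \<bar>E' (x - y)\<bar>)"
      proof (rule integrable_pair_lborelI)
        show "integrable lborel (\<lambda>x. indicator {a..b} x * ?n)" by (intro integrable_mult_left integrable_real_indicator) (use ab in auto)
        fix x :: real
        have "(\<integral>\<^sup>+ y. ennreal (norm (case (y, x) of (y, x) \<Rightarrow> indicator {a..b} x * \<bar>E' (x - y)\<bar>)) \<partial>lborel)
          = (\<integral>\<^sup>+ y. ennreal (indicator {a..b} x * \<bar>E' (x - y)\<bar>) \<partial>lborel)" by (simp add: abs_mult)
        also have "\<dots> = ennreal (LINT y|lborel. indicator {a..b} x * \<bar>E' (x - y)\<bar>)"
          by (intro nn_integral_eq_integral integrable_mult_right integrable_translate_reflect abs') auto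
        also have "\<dots> = ennreal (indicator {a..b} x * ?n)"
          using integral_translate_reflect(1)[of "\<lambda>x. \<bar>E' x\<bar>" x] by simp
        finally show "(\<integral>\<^sup>+ y. ennreal (norm (case (y, x) of (y, x) \<Rightarrow> indicator {a..b} x * \<bar>E' (x - y)\<bar>)) \<partial>lborel)
          \<le> ennreal (indicator {a..b} x * ?n)" by simp
      qed measurable
      from lborel_pair.integrable_fst'[OF this] show ?thesis by (simp add: m_def)
    qed
    have pf: "integrable (lborel \<Otimes>\<^sub>M lborel) f"
    proof (rule integrable_pair_lborelI)
      show "integrable lborel (\<lambda>y. \<bar>C\<bar> * m y + ?n * v y)"
        by (intro Bochner_Integration.integrable_add integrable_mult_right im v)
      fix y
      have "(\<integral>\<^sup>+ x. ennreal (norm (f (x, y))) \<partial>lborel) = 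
         (\<integral>\<^sup>+ x. ennreal (norm (w y) * (indicator {a..b} x * \<bar>E' (x - y)\<bar>)) \<partial>lborel)"
        by (simp add: f_def abs_mult mult_ac)
      also have "\<dots> = ennreal (norm (w y) * m y)"
        unfolding m_def
        by (subst nn_integral_eq_integral) (auto intro!: integrable_mult_right iab)
      also have "\<dots> \<le> ennreal ((\<bar>C\<bar> + v y) * m y)"
        using wv[of y] m_0[of y] by (intro ennreal_leI mult_right_mono) auto
      also have "\<dots> \<le> ennreal (\<bar>C\<bar> * m y + ?n * v y)"
        using mult_right_mono[OF m_le[of y] v0[of y]]  by (intro ennreal_leI) (auto simp: algebra_simps)
      finally show "(\<integral>\<^sup>+ x. ennreal (norm (f (x, y))) \<partial>lborel) \<le> ennreal (\<bar>C\<bar> * m y + ?n * v y)" .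
    qed measurable
    have fy: "(LINT y|lborel. f (x, y)) = indicator {a..b} x *\<^sub>R (LINT y|lborel. E' (x - y) *\<^sub>R w y)" for x
      unfolding f_def prod.case by (rule integral_scaleR_right)
    have fx: "(LINT x|lborel. f (x, y)) = (E (b - y) - E (a - y)) *\<^sub>R w y" for y
    proof -
      have i2: "integrable lborel (\<lambda>x. indicator {a..b} x *\<^sub>R E' (x - y))"
        using integrable_mult_indicator[OF _ integrable_translate_reflect(2)[OF iE', of y], of "{a..b}"] by simp
      have "(LINT x|lborel. f (x, y)) = (LINT x|lborel. indicator {a..b} x *\<^sub>R E' (x - y)) *\<^sub>R w y"
        using integral_scaleR_left[of "w y", OF i2] unfolding f_def by simp
      also have "(LINT x|lborel. indicator {a..b} x *\<^sub>R E' (x - y)) = (LINT x|lborel. indicator {a-y..b-y} (x - y) *\<^sub>R E' (x - y))"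
        by (intro Bochner_Integration.integral_cong) (auto simp: indicator_def)
      also have "\<dots> = (LINT x|lborel. indicator {a-y..b-y} x *\<^sub>R E' x)"
        using integral_translate_reflect(2)[of "\<lambda>x. indicator {a-y..b-y} x *\<^sub>R E' x" y] by simp
      also have "\<dots> = E (b - y) - E (a - y)"
        using ac_derivD(2)[OF E, of "a-y" "b-y"] ab by (simp add: set_lebesgue_integral_def)
      finally show ?thesis .
    qed
    have "(LINT t:{a..b}|lborel. LINT y|lborel. E' (t - y) *\<^sub>R w y) = (LINT x|lborel. LINT y|lborel. f (x, y))"
      unfolding fy set_lebesgue_integral_def ..
    also have "\<dots> = (LINT y|lborel. LINT x|lborel. f (x, y))"
      by (rule lborel_pair.Fubini_integral[symmetric]) (use pf in simp)
    also have "\<dots> = (LINT y|lborel. E (b - y) *\<^sub>R w y) - (LINT y|lborel. E (a - y) *\<^sub>R w y)"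
      unfolding fx scaleR_left_diff_distrib by (rule Bochner_Integration.integral_diff[OF I I])
    finally show "set_integrable lborel {a..b} (\<lambda>x. LINT y|lborel. E' (x - y) *\<^sub>R w y) \<and>
       (LINT y|lborel. E (b - y) *\<^sub>R w y) - (LINT y|lborel. E (a - y) *\<^sub>R w y) = 
       (LINT t:{a..b}|lborel. LINT y|lborel. E' (t - y) *\<^sub>R w y)"
      using lborel_pair.integrable_fst'[OF pf] unfolding fy set_integrable_def by simp
  qed
qed

section \<open>First order equations\<close>

text \<open>The causal fundamental solution of \<open>D - lam\<close>: an exponential cut off by a
  unit jump at 0.\<close>

definition exp_kernel :: "complex \<Rightarrow> real \<Rightarrow> complex" where
  "exp_kernel lam z = (if z \<ge> 0 then exp (lam * of_real z) else 0)"

lemma exp_kernel_measurable [measurable]: "exp_kernel lam \<in> borel_measurable borel"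
  unfolding exp_kernel_def by measurable

lemma exp_kernel_norm_le:
  assumes "Re lam \<le> 0"
  shows "norm (exp_kernel lam z) \<le> 1"
proof (cases "z \<ge> 0")
  case True
  have "Re lam * z \<le> 0" using mult_nonpos_nonneg[OF assms True] .
  then show ?thesis using True by (simp add: exp_kernel_def norm_exp_eq_Re)
qed (simp add: exp_kernel_def)

text \<open>Apart from its unit jump the kernel solves the homogeneous equation, and the jump
  contributes the indicator term. At \<open>y = a\<close> the value
  \<open>exp_kernel lam 0 = 1\<close> would count the jump twice, hence the exclusion.\<close>

lemma integral_exp_kernel:
  assumes ab: "a \<le> b" and ya: "y \<noteq> a"
  shows "integrable lborel (\<lambda>x. indicator {a..b} x *\<^sub>R (lam * exp_kernel lam (x - y)))"
    "(LINT x|lborel. indicator {a..b} x *\<^sub>R (lam * exp_kernel lam (x - y)))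
      = exp_kernel lam (b - y) - exp_kernel lam (a - y) - indicator {a..b} y"
proof -
  have "has_bochner_integral lborel (\<lambda>x. indicator {a..b} x *\<^sub>R (lam * exp_kernel lam (x - y)))
     (exp_kernel lam (b - y) - exp_kernel lam (a - y) - indicator {a..b} y)"
  proof (cases "y \<le> b")
    case True
    define c where "c = max a y"
    have cb: "c \<le> b" using True ab by (simp add: c_def)
    have "has_bochner_integral lborel (\<lambda>x. indicator {c..b} x *\<^sub>R (lam * exp (lam * of_real (x - y))))
       (exp (lam * of_real (b - y)) - exp (lam * of_real (c - y)))"
    proof (rule has_bochner_integral_FTC_Icc[OF cb])
      show "((\<lambda>x. exp (lam * of_real (x - y))) has_vector_derivative lam * exp (lam * of_real (x - y))) (at x within {c..b})" for x
      proof -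
        have "((\<lambda>z. exp (lam * (z - of_real y))) has_field_derivative exp (lam * (of_real x - of_real y)) * lam) (at (of_real x))"
          by (auto intro!: derivative_eq_intros)
        from has_vector_derivative_real_field[OF this] show ?thesis
          by (auto simp: mult.commute intro: has_vector_derivative_at_within)
      qed
      show "continuous_on {c..b} (\<lambda>x. lam * exp (lam * of_real (x - y)))"
        by (intro continuous_intros)
    qed
    moreover have "(\<lambda>x. indicator {c..b} x *\<^sub>R (lam * exp (lam * of_real (x - y))))
        = (\<lambda>x. indicator {a..b} x *\<^sub>R (lam * exp_kernel lam (x - y)))"
      by (auto simp: fun_eq_iff c_def exp_kernel_def indicator_def)
    moreover have "exp (lam * of_real (b - y)) - exp (lam * of_real (c - y))
       = exp_kernel lam (b - y) - exp_kernel lam (a - y) - indicator {a..b} y"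
      using True ya ab by (auto simp: c_def exp_kernel_def indicator_def max_def)
    ultimately show ?thesis by simp
  next
    case False
    then have "(\<lambda>x. indicator {a..b} x *\<^sub>R (lam * exp_kernel lam (x - y))) = (\<lambda>x. 0)"
      by (auto simp: fun_eq_iff exp_kernel_def indicator_def)
    moreover have "exp_kernel lam (b - y) - exp_kernel lam (a - y) - indicator {a..b} y = 0"
      using False ab by (auto simp: exp_kernel_def indicator_def)
    ultimately show ?thesis by (simp only: has_bochner_integral_zero)
  qed
  then show "integrable lborel (\<lambda>x. indicator {a..b} x *\<^sub>R (lam * exp_kernel lam (x - y)))"
    "(LINT x|lborel. indicator {a..b} x *\<^sub>R (lam * exp_kernel lam (x - y)))
      = exp_kernel lam (b - y) - exp_kernel lam (a - y) - indicator {a..b} y"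
    by (auto simp: has_bochner_integral_iff)
qed

lemma integrable_exp_kernel_mult:
  assumes "Re lam \<le> 0" and g: "integrable lborel g"
  shows "integrable lborel (\<lambda>y. exp_kernel lam (x - y) * g y)"
proof (rule Bochner_Integration.integrable_bound[OF g])
  note [measurable] = borel_measurable_integrable[OF g]
  show "(\<lambda>y. exp_kernel lam (x - y) * g y) \<in> borel_measurable lborel" by measurable
  show "AE y in lborel. norm (exp_kernel lam (x - y) * g y) \<le> norm (g y)"
    using exp_kernel_norm_le[OF assms(1)] by (auto simp: norm_mult intro!: mult_left_le_one_le)
qed

text \<open>Integrating \<open>lam\<close> times the kernel over a strip and exchanging the
  integrals reproduces the increment of \<open>E\<close> minus the integral of \<open>g\<close>. The
  argument rests on boundedness of the kernel and so covers imaginary \<open>lam\<close>, where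
  \<open>E\<close> need not be integrable.\<close>

lemma ac_deriv_exp_kernel:
  assumes lam: "Re lam \<le> 0" and g: "integrable lborel g"
  defines "E \<equiv> \<lambda>x. LINT y|lborel. exp_kernel lam (x - y) * g y"
  shows "ac_deriv E (\<lambda>x. lam * E x + g x)"
  unfolding ac_deriv_def
proof (intro allI impI)
  fix a b :: real assume ab: "a \<le> b"
  note [measurable] = borel_measurable_integrable[OF g]
  note I = integrable_exp_kernel_mult[OF lam g]
  define f where "f = (\<lambda>(x, y). indicator {a..b} x *\<^sub>R (lam * exp_kernel lam (x - y)) * g y)"
  have [measurable]: "f \<in> borel_measurable (lborel \<Otimes>\<^sub>M lborel)" unfolding f_def by measurable
  have pf: "integrable (lborel \<Otimes>\<^sub>M lborel) f"
  proof (rule integrable_pair_lborelI)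
    show "integrable lborel (\<lambda>y. norm lam * (b - a) * norm (g y))"
      by (intro integrable_mult_right integrable_norm g)
    fix y
    have "(\<integral>\<^sup>+x. norm (f (x, y)) \<partial>lborel) \<le> (\<integral>\<^sup>+x. ennreal (norm lam * norm (g y)) * indicator {a..b} x \<partial>lborel)"
    proof (intro nn_integral_mono)
      fix x
      have "norm lam * norm (exp_kernel lam (x - y)) * norm (g y) \<le> norm lam * 1 * norm (g y)"
        by (intro mult_right_mono mult_left_mono exp_kernel_norm_le lam) auto
      then show "ennreal (norm (f (x, y))) \<le> ennreal (norm lam * norm (g y)) * indicator {a..b} x"
        by (auto simp: f_def indicator_def norm_mult intro!: ennreal_leI)
    qed
    also have "\<dots> = ennreal (norm lam * (b - a) * norm (g y))"
      using ab by (subst nn_integral_cmult_indicator) (auto simp: ennreal_mult[symmetric] mult_ac)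
    finally show "(\<integral>\<^sup>+x. norm (f (x, y)) \<partial>lborel) \<le> ennreal (norm lam * (b - a) * norm (g y))" .
  qed measurable
  have fy: "(LINT y|lborel. f (x, y)) = indicator {a..b} x *\<^sub>R (lam * E x)" for x
    unfolding f_def E_def by (simp add: mult.assoc)
  have ig: "integrable lborel (\<lambda>y. indicator {a..b} y *\<^sub>R g y)"
    by (intro integrable_mult_indicator g) auto
  have fx: "(LINT x|lborel. f (x, y)) = exp_kernel lam (b - y) * g y - exp_kernel lam (a - y) * g y
      - indicator {a..b} y *\<^sub>R g y" if "y \<noteq> a" for y
  proof -
    have "(LINT x|lborel. f (x, y)) = (LINT x|lborel. indicator {a..b} x *\<^sub>R (lam * exp_kernel lam (x - y))) * g y"
      unfolding f_def prod.case by (rule integral_mult_left_zero)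
    also have "\<dots> = (exp_kernel lam (b - y) - exp_kernel lam (a - y) - indicator {a..b} y) * g y"
      by (subst integral_exp_kernel(2)[OF ab that]) simp
    finally show ?thesis by (simp add: left_diff_distrib scaleR_conv_of_real indicator_def)
  qed
  have "(LINT x|lborel. indicator {a..b} x *\<^sub>R (lam * E x)) = (LINT x|lborel. LINT y|lborel. f (x, y))"
    unfolding fy ..
  also have "\<dots> = (LINT y|lborel. LINT x|lborel. f (x, y))"
    by (rule lborel_pair.Fubini_integral[symmetric]) (use pf in simp)
  also have "\<dots> = (LINT y|lborel. exp_kernel lam (b - y) * g y - exp_kernel lam (a - y) * g y
      - indicator {a..b} y *\<^sub>R g y)"
  proof (rule integral_cong_AE)
    show "AE y in lborel. (LINT x|lborel. f (x, y)) = exp_kernel lam (b - y) * g y - exp_kernel lam (a - y) * g y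
      - indicator {a..b} y *\<^sub>R g y"
      using AE_lborel_singleton[of a] by eventually_elim (rule fx)
  qed measurable
  also have "\<dots> = E b - E a - (LINT y|lborel. indicator {a..b} y *\<^sub>R g y)"
    unfolding E_def
    by (simp only: Bochner_Integration.integral_diff Bochner_Integration.integrable_diff I ig)
  finally have eq: "(LINT x|lborel. indicator {a..b} x *\<^sub>R (lam * E x)) = E b - E a - (LINT y|lborel. indicator {a..b} y *\<^sub>R g y)" .
  have iE: "integrable lborel (\<lambda>x. indicator {a..b} x *\<^sub>R (lam * E x))"
    using lborel_pair.integrable_fst'[OF pf] unfolding fy .
  show "set_integrable lborel {a..b} (\<lambda>x. lam * E x + g x) \<and>
          E b - E a = (LINT t:{a..b}|lborel. lam * E t + g t)"
    using eq Bochner_Integration.integrable_add[OF iE ig] Bochner_Integration.integral_add[OF iE ig]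
    by (simp add: set_integrable_def set_lebesgue_integral_def scaleR_add_right)
qed

lemma nn_integral_norm_exp_kernel:
  assumes lam: "Re lam < 0"
  shows "(\<integral>\<^sup>+z. norm (exp_kernel lam z) \<partial>lborel) = ennreal (- 1 / Re lam)"
proof -
  have "(\<integral>\<^sup>+z. ennreal (exp (Re lam * z)) * indicator {0..} z \<partial>lborel) = ennreal (0 - exp (Re lam * 0) / Re lam)"
  proof (rule nn_integral_FTC_atLeast)
    show "((\<lambda>z. exp (Re lam * z) / Re lam) has_real_derivative exp (Re lam * z)) (at z)" for z
      using lam by (auto intro!: derivative_eq_intros)
    have "filterlim (\<lambda>z. (- Re lam) * z) at_top at_top"
      using lam by (intro filterlim_tendsto_pos_mult_at_top[OF tendsto_const]) (auto intro: filterlim_ident)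
    then have "filterlim (\<lambda>z. Re lam * z) at_bot at_top"
      by (simp add: filterlim_uminus_at_bot)
    then have "((\<lambda>z. exp (Re lam * z)) \<longlongrightarrow> 0) at_top"
      by (rule filterlim_compose[OF exp_at_bot])
    then show "((\<lambda>z. exp (Re lam * z) / Re lam) \<longlongrightarrow> 0) at_top"
      using tendsto_divide[of "\<lambda>z. exp (Re lam * z)" 0 at_top "\<lambda>_. Re lam" "Re lam"] lam by simp
  qed auto
  moreover have "(\<integral>\<^sup>+z. norm (exp_kernel lam z) \<partial>lborel) = (\<integral>\<^sup>+z. ennreal (exp (Re lam * z)) * indicator {0..} z \<partial>lborel)"
    by (intro nn_integral_cong) (auto simp: exp_kernel_def indicator_def)
  ultimately show ?thesis by simp
qed

text \<open>A negative real part makes the kernel itself integrable, with norm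
  \<open>- 1 / Re lam\<close>, so its convolution with \<open>g\<close> is integrable as
  well.\<close>

lemma first_order_decaying:
  assumes lam: "Re lam < 0" and g: "integrable lborel g"
  obtains E where "integrable lborel E" "ac_deriv E (\<lambda>x. lam * E x + g x)"
proof
  note [measurable] = borel_measurable_integrable[OF g]
  define f where "f = (\<lambda>(x, y). exp_kernel lam (x - y) * g y)"
  have [measurable]: "f \<in> borel_measurable (lborel \<Otimes>\<^sub>M lborel)" unfolding f_def by measurable
  have "integrable (lborel \<Otimes>\<^sub>M lborel) f"
  proof (rule integrable_pair_lborelI)
    show "integrable lborel (\<lambda>y. - 1 / Re lam * norm (g y))"
      by (intro integrable_mult_right integrable_norm g)
    fix y
    have "(\<integral>\<^sup>+x. norm (f (x, y)) \<partial>lborel) = (\<integral>\<^sup>+x. ennreal (norm (exp_kernel lam (x - y))) \<partial>lborel) * ennreal (norm (g y))"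
      by (simp add: f_def norm_mult ennreal_mult nn_integral_multc)
    also have "(\<integral>\<^sup>+x. ennreal (norm (exp_kernel lam (x - y))) \<partial>lborel) = ennreal (- 1 / Re lam)"
      using nn_integral_translate[of "\<lambda>x. ennreal (norm (exp_kernel lam x))" y] nn_integral_norm_exp_kernel[OF lam] by simp
    finally show "(\<integral>\<^sup>+x. norm (f (x, y)) \<partial>lborel) \<le> ennreal (- 1 / Re lam * norm (g y))"
      using lam by (subst ennreal_mult) (auto simp: divide_simps)
  qed measurable
  from lborel_pair.integrable_fst'[OF this]
  show "integrable lborel (\<lambda>x. LINT y|lborel. exp_kernel lam (x - y) * g y)"
    by (simp add: f_def)
qed (rule ac_deriv_exp_kernel, use assms in auto)

text \<open>Reflecting the line changes the sign of \<open>lam\<close> and reduces a positive real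
  part to the decaying case.\<close>

lemma first_order_nonresonant:
  assumes lam: "Re lam \<noteq> 0" and g: "integrable lborel g"
  obtains E where "integrable lborel E" "ac_deriv E (\<lambda>x. lam * E x + g x)"
proof (cases "Re lam < 0")
  case True
  then show ?thesis using first_order_decaying[OF _ g] that by blast
next
  case False
  then have "Re (- lam) < 0" using lam by simp
  then obtain E where E: "integrable lborel E" "ac_deriv E (\<lambda>x. - lam * E x + g (- x))"
    using first_order_decaying[OF _ integrable_translate_reflect(3)[OF g]] by blast
  show ?thesis
  proof
    show "integrable lborel (\<lambda>x. - E (- x))"
      using integrable_translate_reflect(3)[OF E(1)] by simp
    show "ac_deriv (\<lambda>x. - E (- x)) (\<lambda>x. lam * - E (- x) + g x)"
      using ac_deriv_bounded_linear[OF bounded_linear_minus[OF bounded_linear_ident] ac_deriv_reflect[OF E(2)]]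
      by simp
  qed
qed

text \<open>The vanishing moment turns the one-sided kernel into one supported between \<open>0\<close> and \<open>y\<close>.\<close>

lemma first_order_resonant:
  assumes lam: "Re lam = 0" and g: "integrable lborel g"
    and mom: "(LINT y|lborel. exp (- lam * of_real y) * g y) = 0"
  obtains E where "ac_deriv E (\<lambda>x. lam * E x + g x)"
    "\<And>m. integrable lborel (\<lambda>x. (\<bar>x\<bar> ^ Suc m) *\<^sub>R g x) \<Longrightarrow> integrable lborel (\<lambda>x. (\<bar>x\<bar> ^ m) *\<^sub>R E x)"
    "lam = 0 \<Longrightarrow> integrable lborel (\<lambda>x. x *\<^sub>R g x) \<Longrightarrow>
      (LINT x|lborel. E x) = - (LINT x|lborel. x *\<^sub>R g x)"
proof
  note [measurable] = borel_measurable_integrable[OF g]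
  define E where "E = (\<lambda>x. LINT y|lborel. exp_kernel lam (x - y) * g y)"
  \<comment> \<open>For \<open>x > 0\<close> the full integral over \<open>y\<close>, which is 0 by
    \<open>mom\<close>, is subtracted. What remains is weight 1 where \<open>y <= x <= 0\<close> and
    weight -1 where \<open>0 < x < y\<close>.\<close>
  define c where "c = (\<lambda>x y::real. if x \<le> 0 \<and> y \<le> x then 1 else if x > 0 \<and> y > x then -1 else (0::real))"
  have [measurable]: "(\<lambda>(x, y). c x y) \<in> borel_measurable (lborel \<Otimes>\<^sub>M lborel)"
    unfolding c_def by measurable
  have cx[measurable]: "c x \<in> borel_measurable borel" for x
    unfolding c_def by measurable
  have n1: "norm (exp (lam * (of_real x - of_real y))) = 1" for x y
    using lam by simp
  have ie: "integrable lborel (\<lambda>y. exp (lam * (of_real x - of_real y)) * g y)" for x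
    by (rule Bochner_Integration.integrable_bound[OF g]) (auto simp: norm_mult lam)
  have Ec: "E x = (LINT y|lborel. c x y *\<^sub>R (exp (lam * (of_real x - of_real y)) * g y))" for x
  proof (cases "x \<le> 0")
    case True
    then show ?thesis unfolding E_def
      by (intro Bochner_Integration.integral_cong) (auto simp: c_def exp_kernel_def)
  next
    case False
    have "E x = (LINT y|lborel. exp (lam * (of_real x - of_real y)) * g y + c x y *\<^sub>R (exp (lam * (of_real x - of_real y)) * g y))"
      unfolding E_def using False
      by (intro Bochner_Integration.integral_cong) (auto simp: c_def exp_kernel_def)
    also have "\<dots> = (LINT y|lborel. exp (lam * (of_real x - of_real y)) * g y) + 
        (LINT y|lborel. c x y *\<^sub>R (exp (lam * (of_real x - of_real y)) * g y))"
    proof (rule Bochner_Integration.integral_add[OF ie])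
      show "integrable lborel (\<lambda>y. c x y *\<^sub>R (exp (lam * (of_real x - of_real y)) * g y))"
        by (rule Bochner_Integration.integrable_bound[OF g]) (auto simp: norm_mult lam c_def)
    qed
    also have "(LINT y|lborel. exp (lam * (of_real x - of_real y)) * g y) = 
        exp (lam * of_real x) * (LINT y|lborel. exp (- lam * of_real y) * g y)"
      by (simp add: exp_add[symmetric] algebra_simps flip: integral_mult_right_zero)
    finally show ?thesis using mom by simp
  qed
  have cb2: "(\<integral>\<^sup>+x. ennreal \<bar>c x y\<bar> \<partial>lborel) \<le> ennreal \<bar>y\<bar>" for y
  proof -
    have "(\<integral>\<^sup>+x. ennreal \<bar>c x y\<bar> \<partial>lborel) \<le> (\<integral>\<^sup>+x. indicator {min 0 y..max 0 y} x \<partial>lborel)"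
      by (intro nn_integral_mono) (auto simp: c_def indicator_def)
    also have "\<dots> = ennreal \<bar>y\<bar>" by (auto simp: min_def max_def)
    finally show ?thesis .
  qed
  \<comment> \<open>Wherever \<open>c x y\<close> is nonzero, \<open>x\<close> lies between 0 and
    \<open>y\<close>: its power is at most that of \<open>y\<close>, and integrating over
    \<open>x\<close> costs one further factor \<open>|y|\<close>. Thus one moment of
    \<open>g\<close> is spent.\<close>
  define f where "f = (\<lambda>m (x, y). (\<bar>x\<bar> ^ m * c x y) *\<^sub>R (exp (lam * (of_real x - of_real y)) * g y))"
  have [measurable]: "f m \<in> borel_measurable (lborel \<Otimes>\<^sub>M lborel)" for m unfolding f_def by measurable
  have pf: "integrable (lborel \<Otimes>\<^sub>M lborel) (f m)"
    if i: "integrable lborel (\<lambda>x. (\<bar>x\<bar> ^ Suc m) *\<^sub>R g x)" for m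
  proof (rule integrable_pair_lborelI)
    show "integrable lborel (\<lambda>y. norm ((\<bar>y\<bar> ^ Suc m) *\<^sub>R g y))"
      by (rule integrable_norm[OF i])
    fix y
    have "(\<integral>\<^sup>+x. norm (f m (x, y)) \<partial>lborel) \<le> (\<integral>\<^sup>+x. ennreal \<bar>c x y\<bar> * ennreal (\<bar>y\<bar> ^ m * norm (g y)) \<partial>lborel)"
    proof (intro nn_integral_mono)
      fix x
      have "\<bar>x\<bar> ^ m * \<bar>c x y\<bar> \<le> \<bar>y\<bar> ^ m * \<bar>c x y\<bar>"
      proof (cases "c x y = 0")
        case False
        then have "\<bar>x\<bar> \<le> \<bar>y\<bar>" by (auto simp: c_def split: if_splits)
        then show ?thesis by (intro mult_right_mono power_mono) auto
      qed simp
      then have "norm (f m (x, y)) \<le> \<bar>y\<bar> ^ m * \<bar>c x y\<bar> * norm (g y)"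
        unfolding f_def by (simp add: norm_mult n1 abs_mult mult_right_mono lam)
      then show "ennreal (norm (f m (x, y))) \<le> ennreal \<bar>c x y\<bar> * ennreal (\<bar>y\<bar> ^ m * norm (g y))"
        by (simp add: ennreal_mult[symmetric] mult_ac ennreal_leI)
    qed
    also have "\<dots> = (\<integral>\<^sup>+x. ennreal \<bar>c x y\<bar> \<partial>lborel) * ennreal (\<bar>y\<bar> ^ m * norm (g y))"
      by (rule nn_integral_multc) measurable
    also have "\<dots> \<le> ennreal \<bar>y\<bar> * ennreal (\<bar>y\<bar> ^ m * norm (g y))"
      by (intro mult_right_mono cb2) simp
    also have "\<dots> = ennreal (norm ((\<bar>y\<bar> ^ Suc m) *\<^sub>R g y))"
      by (simp add: ennreal_mult[symmetric] mult_ac abs_mult power_abs)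
    finally show "(\<integral>\<^sup>+x. norm (f m (x, y)) \<partial>lborel) \<le> ennreal (norm ((\<bar>y\<bar> ^ Suc m) *\<^sub>R g y))" .
  qed measurable
  have fy: "(LINT y|lborel. f m (x, y)) = (\<bar>x\<bar> ^ m) *\<^sub>R E x" for m x
    unfolding f_def Ec prod.case scaleR_scaleR[symmetric] by (rule integral_scaleR_right)
  show "ac_deriv E (\<lambda>x. lam * E x + g x)"
    unfolding E_def using lam g by (intro ac_deriv_exp_kernel) auto
  show "integrable lborel (\<lambda>x. (\<bar>x\<bar> ^ m) *\<^sub>R E x)"
    if "integrable lborel (\<lambda>x. (\<bar>x\<bar> ^ Suc m) *\<^sub>R g x)" for m
    using lborel_pair.integrable_fst'[OF pf[OF that]] unfolding fy .
  \<comment> \<open>The mean of \<open>E\<close> decides whether a second resonant step at the root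
    0 is possible, as the double root requires.\<close>
  show "(LINT x|lborel. E x) = - (LINT x|lborel. x *\<^sub>R g x)"
    if l0: "lam = 0" and xg: "integrable lborel (\<lambda>x. x *\<^sub>R g x)"
  proof -
    have "integrable lborel (\<lambda>x. (\<bar>x\<bar> ^ Suc 0) *\<^sub>R g x)"
      by (rule Bochner_Integration.integrable_bound[OF xg]) auto
    note p0 = pf[OF this]
    \<comment> \<open>The signed length of the set of admissible \<open>x\<close> is
      \<open>- y\<close>, whatever the sign of \<open>y\<close>.\<close>
    have c1: "has_bochner_integral lborel (\<lambda>x. c x y) (- y)" for y
    proof (cases "y \<le> 0")
      case True
      then have "(\<lambda>x. c x y) = indicator {y..0}" by (auto simp: c_def indicator_def fun_eq_iff)
      then show ?thesis using True has_bochner_integral_real_indicator[of "{y..0}" lborel] by simp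
    next
      case False
      then have "(\<lambda>x. c x y) = (\<lambda>x. - indicator {0<..<y} x)" by (auto simp: c_def indicator_def fun_eq_iff)
      then show ?thesis using False has_bochner_integral_minus[OF has_bochner_integral_real_indicator[of "{0<..<y}" lborel]] by simp
    qed
    have fx: "(LINT x|lborel. f 0 (x, y)) = - (y *\<^sub>R g y)" for y
      using integral_scaleR_left[of "g y" lborel "\<lambda>x. c x y"] c1[of y] 
      unfolding f_def has_bochner_integral_iff l0 by simp
    have "(LINT x|lborel. E x) = (LINT x|lborel. LINT y|lborel. f 0 (x, y))"
      unfolding fy by simp
    also have "\<dots> = (LINT y|lborel. LINT x|lborel. f 0 (x, y))"
      by (rule lborel_pair.Fubini_integral[symmetric]) (use p0 in simp)
    finally show ?thesis unfolding fx by simp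
  qed
qed

section \<open>Kernels of second order operators\<close>

text \<open>The last clause is the equation \<open>- E'' - b E' - a E = G\<close>. Integrability of
  both \<open>E\<close> and \<open>E'\<close> is what later makes \<open>conv E w\<close> and its
  derivatives square integrable.\<close>

definition resolvent_kernel ::
    "real \<Rightarrow> real \<Rightarrow> (real \<Rightarrow> real) \<Rightarrow> (real \<Rightarrow> real) \<Rightarrow> (real \<Rightarrow> real) \<Rightarrow> bool" where
  "resolvent_kernel b a G E E' \<longleftrightarrow> integrable lborel E \<and> integrable lborel E' \<and> ac_deriv E E' \<and>
     ac_deriv E' (\<lambda>x. - b * E' x - a * E x - G x)"

text \<open>The characteristic roots may be complex, but \<open>a\<close>, \<open>b\<close> and
  \<open>G\<close> are real, so the equations pass to real parts.\<close>

lemma resolvent_kernel_Re: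
  assumes iE: "integrable lborel E" and iE': "integrable lborel E'" and E: "ac_deriv E E'"
    and E': "ac_deriv E' (\<lambda>x. - of_real b * E' x - of_real a * E x - of_real (G x))"
  shows "resolvent_kernel b a G (\<lambda>x. Re (E x)) (\<lambda>x. Re (E' x))"
  using ac_deriv_bounded_linear[OF bounded_linear_Re E] ac_deriv_bounded_linear[OF bounded_linear_Re E']
    integrable_Re[OF iE] integrable_Re[OF iE']
  by (simp add: resolvent_kernel_def)

text \<open>With \<open>D\<close> the derivative, \<open>(D - lam2) E = - E1\<close> and \<open>(D - lam1) E1 = g\<close>.\<close>

lemma second_order_factorization:
  fixes E1 E g :: "real \<Rightarrow> complex"
  assumes E1: "ac_deriv E1 (\<lambda>x. lam1 * E1 x + g x)"
    and E: "ac_deriv E (\<lambda>x. lam2 * E x - E1 x)"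
    and b: "lam1 + lam2 = - b" and a: "lam1 * lam2 = a"
  defines "E' \<equiv> \<lambda>x. lam2 * E x - E1 x"
  shows "ac_deriv E' (\<lambda>x. - b * E' x - a * E x - g x)"
proof -
  have b': "b = - (lam1 + lam2)" using b by simp
  have "ac_deriv E' (\<lambda>x. lam2 * (lam2 * E x - E1 x) + - (lam1 * E1 x + g x))"
    using ac_deriv_add[OF ac_deriv_bounded_linear[OF bounded_linear_mult_right E, of lam2]
        ac_deriv_bounded_linear[OF bounded_linear_minus[OF bounded_linear_ident] E1]]
    by (simp add: E'_def)
  moreover have "lam2 * (lam2 * E x - E1 x) + - (lam1 * E1 x + g x) = - b * E' x - a * E x - g x" for x
    unfolding a[symmetric] b' E'_def by (simp add: algebra_simps)
  ultimately show ?thesis by (simp only:)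
qed

text \<open>An imaginary root of \<open>lam^2 + b lam + a\<close> would have imaginary part 0
  because \<open>b\<close> is nonzero, and then \<open>a\<close> would be 0. Two nonresonant first
  order steps therefore suffice.\<close>

lemma resolvent_kernel_damped:
  assumes G: "integrable lborel G" and b: "b \<noteq> 0" and a: "a > 0"
  obtains E E' where "resolvent_kernel b a G E E'"
proof -
  define s where "s = csqrt (of_real (b\<^sup>2 - 4 * a))"
  have s2: "s * s = of_real (b\<^sup>2 - 4 * a)" unfolding s_def by (simp add: power2_eq_square[symmetric])
  \<comment> \<open>The premise is the characteristic equation, written as root times complementary
    root.\<close>
  have nonres: "Re lam \<noteq> 0" if "lam * (- of_real b - lam) = of_real a" for lam
  proof
    assume 0: "Re lam = 0"
    have "Im lam * b = 0" using arg_cong[OF that, of Im] 0 by simp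
    then have "Im lam = 0" using b by simp
    then show False using arg_cong[OF that, of Re] 0 a by simp
  qed
  define lam1 lam2 where "lam1 = (- of_real b + s) / 2" and "lam2 = (- of_real b - s) / 2"
  have sum: "lam1 + lam2 = - of_real b" unfolding lam1_def lam2_def by (simp add: field_simps)
  have prod: "lam1 * lam2 = of_real a"
  proof -
    have "lam1 * lam2 = (of_real b * of_real b - s * s) / 4" unfolding lam1_def lam2_def by (simp add: field_simps)
    then show ?thesis unfolding s2 by (simp add: power2_eq_square)
  qed
  have "- of_real b - lam1 = lam2" "- of_real b - lam2 = lam1" using sum by (auto simp: algebra_simps)
  then have re: "Re lam1 \<noteq> 0" "Re lam2 \<noteq> 0" using nonres[of lam1] nonres[of lam2] prod by (auto simp: mult.commute)
  obtain E1 :: "real \<Rightarrow> complex" where E1: "integrable lborel E1" "ac_deriv E1 (\<lambda>x. lam1 * E1 x + of_real (G x))"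
    using first_order_nonresonant[OF re(1), of "\<lambda>x. of_real (G x)"] G by auto
  obtain E :: "real \<Rightarrow> complex" where E: "integrable lborel E" "ac_deriv E (\<lambda>x. lam2 * E x - E1 x)"
    using first_order_nonresonant[OF re(2), of "\<lambda>x. - E1 x"] E1 by auto
  show ?thesis
    by (rule that, rule resolvent_kernel_Re[OF E(1) _ E(2) second_order_factorization[OF E1(2) E(2) sum prod]])
      (use E1(1) E(1) in auto)
qed

lemma integrable_abs_power_scaleR:
  assumes "G \<in> borel_measurable lborel" "integrable lborel (\<lambda>x. x ^ m * G x)"
  shows "integrable lborel (\<lambda>x. (\<bar>x\<bar> ^ m) *\<^sub>R complex_of_real (G x))"
  by (rule Bochner_Integration.integrable_bound[OF assms(2)])
     (use assms(1) in \<open>auto simp: abs_mult power_abs\<close>)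

text \<open>The roots are 0 and \<open>- b\<close>. The zero mean of \<open>G\<close> settles the
  first at the cost of the moment \<open>x * G x\<close>; the second is nonresonant.\<close>

lemma resolvent_kernel_damped_zero:
  assumes G: "integrable lborel G" and b: "b \<noteq> 0"
    and xG: "integrable lborel (\<lambda>x. x * G x)" and mom: "(LINT x|lborel. G x) = 0"
  obtains E E' where "resolvent_kernel b 0 G E E'"
proof -
  have g: "integrable lborel (\<lambda>x. complex_of_real (G x))" using G by auto
  have xg: "integrable lborel (\<lambda>x. (\<bar>x\<bar> ^ Suc 0) *\<^sub>R complex_of_real (G x))"
    using integrable_abs_power_scaleR[of G 1] G xG by simp
  have m0: "(LINT y|lborel. exp (- 0 * of_real y) * complex_of_real (G y)) = 0" using mom by simp
  obtain E1 :: "real \<Rightarrow> complex" where E1: "ac_deriv E1 (\<lambda>x. 0 * E1 x + of_real (G x))" "integrable lborel (\<lambda>x. (\<bar>x\<bar> ^ 0) *\<^sub>R E1 x)"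
    by (rule first_order_resonant[OF zero_complex.sel(1) g m0]) (rule that, assumption, blast intro: xg)
  then have iE1: "integrable lborel E1" by simp
  have reb: "Re (- complex_of_real b) \<noteq> 0" using b by simp
  obtain E :: "real \<Rightarrow> complex" where E: "integrable lborel E" "ac_deriv E (\<lambda>x. (- of_real b) * E x - E1 x)"
    by (rule first_order_nonresonant[OF reb integrable_minus[OF iE1]])
      (rule that, assumption, simp only: diff_conv_add_uminus)
  show ?thesis
    by (rule that, rule resolvent_kernel_Re[OF E(1) _ E(2) second_order_factorization[OF E1(1) E(2)]])
      (use iE1 E(1) in auto)
qed

lemma abs_le_one_plus_square: "\<bar>x\<bar> \<le> 1 + x\<^sup>2" for x :: real
  using zero_le_power2[of "\<bar>x\<bar> - 1"] by (simp add: power2_diff)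

text \<open>Zero is a double root, so the resonant step is taken twice and spends two moments. The
  mean of \<open>E1\<close> is minus the first moment of \<open>G\<close>, hence 0, as the second
  step requires.\<close>

lemma resolvent_kernel_free:
  assumes G: "integrable lborel G" and x2G: "integrable lborel (\<lambda>x. x\<^sup>2 * G x)"
    and mom: "(LINT x|lborel. G x) = 0" "(LINT x|lborel. x * G x) = 0"
  obtains E E' where "resolvent_kernel 0 0 G E E'"
proof -
  have g: "integrable lborel (\<lambda>x. complex_of_real (G x))" using G by auto
  \<comment> \<open>The first moment is dominated by the moments of orders 0 and 2.\<close>
  have xG: "integrable lborel (\<lambda>x. x * G x)"
  proof (rule Bochner_Integration.integrable_bound)
    show "integrable lborel (\<lambda>x. \<bar>G x\<bar> + \<bar>x\<^sup>2 * G x\<bar>)" using G x2G by auto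
    have "norm (x * G x) \<le> norm (\<bar>G x\<bar> + \<bar>x\<^sup>2 * G x\<bar>)" for x
      using mult_right_mono[OF abs_le_one_plus_square, of "\<bar>G x\<bar>" x] by (simp add: abs_mult algebra_simps)
    then show "AE x in lborel. norm (x * G x) \<le> norm (\<bar>G x\<bar> + \<bar>x\<^sup>2 * G x\<bar>)" by auto
  qed (use G in auto)
  have eq: "x *\<^sub>R complex_of_real (G x) = of_real (x * G x)" for x by (simp add: scaleR_conv_of_real)
  have ic: "(LINT x|lborel. x *\<^sub>R complex_of_real (G x)) = 0"
    "integrable lborel (\<lambda>x. x *\<^sub>R complex_of_real (G x))"
    unfolding eq integral_complex_of_real mom(2) using xG by (auto simp del: of_real_mult)
  have m0: "(LINT y|lborel. exp (- 0 * of_real y) * complex_of_real (G y)) = 0" using mom(1) by simp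
  obtain E1 :: "real \<Rightarrow> complex" where E1: "ac_deriv E1 (\<lambda>x. 0 * E1 x + of_real (G x))" 
    "\<And>m. integrable lborel (\<lambda>x. (\<bar>x\<bar> ^ Suc m) *\<^sub>R complex_of_real (G x)) \<Longrightarrow> integrable lborel (\<lambda>x. (\<bar>x\<bar> ^ m) *\<^sub>R E1 x)"
    "(LINT x|lborel. E1 x) = 0"
    by (rule first_order_resonant[OF zero_complex.sel(1) g m0]) (rule that, assumption, blast, simp add: ic)
  have iE1: "integrable lborel E1" "integrable lborel (\<lambda>x. \<bar>x\<bar> *\<^sub>R E1 x)"
    using E1(2)[of 0] E1(2)[of 1] integrable_abs_power_scaleR[of G 1] integrable_abs_power_scaleR[of G 2] G xG x2G
    by (auto simp: numeral_2_eq_2)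
  have m1: "integrable lborel (\<lambda>x. - E1 x)" "(LINT y|lborel. exp (- 0 * of_real y) * - E1 y) = 0"
    "integrable lborel (\<lambda>x. (\<bar>x\<bar> ^ Suc 0) *\<^sub>R - E1 x)"
    using iE1 E1(3) by simp_all
  obtain E :: "real \<Rightarrow> complex" where E: "ac_deriv E (\<lambda>x. 0 * E x - E1 x)" "integrable lborel (\<lambda>x. (\<bar>x\<bar> ^ 0) *\<^sub>R E x)"
    by (rule first_order_resonant[OF zero_complex.sel(1) m1(1,2)])
      (rule that, simp only: diff_conv_add_uminus, blast intro: m1(3))
  then have iE: "integrable lborel E" by simp
  show ?thesis
    by (rule that, rule resolvent_kernel_Re[OF iE _ E(1) second_order_factorization[OF E1(1) E(1)]])
      (use iE1 iE in auto)
qed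

text \<open>Both roots are imaginary. Solving in succession would spend two moments, while one is
  available, so a partial fraction decomposition applies the resonant step to \<open>G\<close>
  itself, once for each root.\<close>

lemma resolvent_kernel_oscillating:
  assumes G: "integrable lborel G" and a: "a > 0" and xG: "integrable lborel (\<lambda>x. x * G x)"
    and mom: "(LINT x|lborel. complex_of_real (G x) * exp (- \<i> * complex_of_real (sqrt a * x))) = 0"
      "(LINT x|lborel. complex_of_real (G x) * exp (\<i> * complex_of_real (sqrt a * x))) = 0"
  obtains E E' where "resolvent_kernel 0 a G E E'"
proof -
  have g: "integrable lborel (\<lambda>x. complex_of_real (G x))" using G by auto
  have xg: "integrable lborel (\<lambda>x. (\<bar>x\<bar> ^ Suc 0) *\<^sub>R complex_of_real (G x))"
    using integrable_abs_power_scaleR[of G 1] G xG by simp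
  define q where "q = \<i> * of_real (sqrt a)"
  have q2: "q * q = - of_real a" and q0: "q \<noteq> 0" using a
    by (auto simp: q_def algebra_simps simp flip: of_real_mult)
  have Re_q: "Re q = 0" "Re (- q) = 0" by (simp_all add: q_def)
  have m: "(LINT y|lborel. exp (- q * of_real y) * complex_of_real (G y)) = 0"
    "(LINT y|lborel. exp (- (- q) * of_real y) * complex_of_real (G y)) = 0"
    using mom by (simp_all add: q_def mult_ac)
  obtain E1 :: "real \<Rightarrow> complex" where E1: "ac_deriv E1 (\<lambda>x. q * E1 x + of_real (G x))" "integrable lborel (\<lambda>x. (\<bar>x\<bar> ^ 0) *\<^sub>R E1 x)"
    using first_order_resonant[OF Re_q(1) g m(1)] xg by metis
  obtain E2 :: "real \<Rightarrow> complex" where E2: "ac_deriv E2 (\<lambda>x. (- q) * E2 x + of_real (G x))" "integrable lborel (\<lambda>x. (\<bar>x\<bar> ^ 0) *\<^sub>R E2 x)"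
    using first_order_resonant[OF Re_q(2) g m(2)] xg by metis
  have i: "integrable lborel E1" "integrable lborel E2" using E1(2) E2(2) by simp_all
  \<comment> \<open>The coefficient in
    \<open>- 1 / ((D - q) (D + q)) = c / (D - q) - c / (D + q)\<close>.\<close>
  define c where "c = - 1 / (2 * q)"
  define E where "E = (\<lambda>x. c * E1 x + (- c) * E2 x)"
  define E' where "E' = (\<lambda>x. (- 1 / 2) * E1 x + (- 1 / 2) * E2 x)"
  note bl = ac_deriv_bounded_linear[OF bounded_linear_mult_right]
  have "ac_deriv E (\<lambda>x. c * (q * E1 x + of_real (G x)) + (- c) * ((- q) * E2 x + of_real (G x)))"
    unfolding E_def by (intro ac_deriv_add bl E1 E2)
  moreover have "c * (q * E1 x + of_real (G x)) + (- c) * ((- q) * E2 x + of_real (G x)) = E' x" for x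
    using q0 by (simp add: c_def E'_def field_simps)
  ultimately have dE: "ac_deriv E E'" by simp
  have "ac_deriv E' (\<lambda>x. (- 1 / 2) * (q * E1 x + of_real (G x)) + (- 1 / 2) * ((- q) * E2 x + of_real (G x)))"
    unfolding E'_def by (intro ac_deriv_add bl E1 E2)
  moreover have "(- 1 / 2) * (q * E1 x + of_real (G x)) + (- 1 / 2) * ((- q) * E2 x + of_real (G x))
      = - of_real 0 * E' x - of_real a * E x - of_real (G x)" for x
  proof -
    have qa: "of_real a = - (q * q)" unfolding q2 by simp
    show ?thesis unfolding qa using q0 by (simp add: E_def c_def field_simps)
  qed
  ultimately have dE': "ac_deriv E' (\<lambda>x. - of_real 0 * E' x - of_real a * E x - of_real (G x))" by simp
  show ?thesis
    by (rule that, rule resolvent_kernel_Re[OF _ _ dE dE']) (use i in \<open>auto simp: E_def E'_def\<close>)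
qed

section \<open>The linear problem in the Sobolev space\<close>

lemma integrable_mult_of_squares:
  fixes f g :: "'a \<Rightarrow> real"
  assumes [measurable]: "f \<in> borel_measurable M" "g \<in> borel_measurable M"
    and f: "integrable M (\<lambda>x. (f x)\<^sup>2)" and g: "integrable M (\<lambda>x. (g x)\<^sup>2)"
  shows "integrable M (\<lambda>x. f x * g x)"
proof (rule Bochner_Integration.integrable_bound[OF Bochner_Integration.integrable_add[OF f g]])
  have "\<bar>f x * g x\<bar> \<le> (f x)\<^sup>2 + (g x)\<^sup>2" for x
    using zero_le_power2[of "\<bar>f x\<bar> - \<bar>g x\<bar>"] mult_nonneg_nonneg[OF abs_ge_zero abs_ge_zero, of "f x" "g x"]
    unfolding power2_diff abs_mult power2_abs by linarith
  then show "AE x in M. norm (f x * g x) \<le> norm ((f x)\<^sup>2 + (g x)\<^sup>2)" by auto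
qed measurable

lemma Cauchy_Schwarz_integral:
  fixes f g :: "'a \<Rightarrow> real"
  assumes m: "f \<in> borel_measurable M" "g \<in> borel_measurable M"
    and f: "integrable M (\<lambda>x. (f x)\<^sup>2)" and g: "integrable M (\<lambda>x. (g x)\<^sup>2)"
  shows "(\<integral>x. f x * g x \<partial>M)\<^sup>2 \<le> (\<integral>x. (f x)\<^sup>2 \<partial>M) * (\<integral>x. (g x)\<^sup>2 \<partial>M)"
proof -
  define A B C where "A = (\<integral>x. (f x)\<^sup>2 \<partial>M)" and "B = (\<integral>x. (g x)\<^sup>2 \<partial>M)" and "C = (\<integral>x. f x * g x \<partial>M)"
  note fg = integrable_mult_of_squares[OF m f g]
  have key: "0 \<le> s\<^sup>2 * A - 2 * s * t * C + t\<^sup>2 * B" for s t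
  proof -
    have "0 \<le> (\<integral>x. (s * f x - t * g x)\<^sup>2 \<partial>M)" by simp
    also have "\<dots> = (\<integral>x. s\<^sup>2 * (f x)\<^sup>2 - 2 * s * t * (f x * g x) + t\<^sup>2 * (g x)\<^sup>2 \<partial>M)"
      by (intro Bochner_Integration.integral_cong) (auto simp: power2_eq_square algebra_simps)
    also have "\<dots> = s\<^sup>2 * A - 2 * s * t * C + t\<^sup>2 * B"
      unfolding A_def B_def C_def using f g fg by simp
    finally show ?thesis .
  qed
  have A0: "A \<ge> 0" and B0: "B \<ge> 0" unfolding A_def B_def by simp_all
  have "C\<^sup>2 \<le> A * B"
  proof (cases "B = 0")
    case True
    show ?thesis
    proof (cases "C = 0")
      case False
      \<comment> \<open>With \<open>B = 0\<close> the form is affine in \<open>t\<close>, and this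
        choice of \<open>t\<close> gives it the value -1.\<close>
      have "0 \<le> A - 2 * ((A + 1) / (2 * C)) * C" using key[of 1 "(A + 1) / (2 * C)"] True by simp
      then show ?thesis using False by (simp add: field_simps)
    qed (use A0 B0 in simp)
  next
    case False
    then have B: "B > 0" using B0 by simp
    have "0 \<le> B\<^sup>2 * A - 2 * B * C * C + C\<^sup>2 * B" by (rule key)
    also have "\<dots> = B * (A * B - C\<^sup>2)" by (simp add: power2_eq_square algebra_simps)
    finally show ?thesis using B by (simp add: zero_le_mult_iff)
  qed
  then show ?thesis by (simp add: A_def B_def C_def)
qed

lemma sq_integrable_bound:
  assumes "sq_integrable g" "f \<in> borel_measurable lborel" "\<And>x. \<bar>f x\<bar> \<le> \<bar>g x\<bar>"
  shows "sq_integrable f"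
  unfolding sq_integrable_def
proof
  show "integrable lborel (\<lambda>x. (f x)\<^sup>2)"
  proof (rule Bochner_Integration.integrable_bound)
    show "integrable lborel (\<lambda>x. (g x)\<^sup>2)" using assms(1) by (simp add: sq_integrable_def)
    show "AE x in lborel. norm ((f x)\<^sup>2) \<le> norm ((g x)\<^sup>2)"
      using assms(3) by (auto simp: abs_le_square_iff)
  qed (use assms(2) in measurable)
qed fact

lemma sq_integrable_measurable [measurable_dest]:
  "sq_integrable f \<Longrightarrow> f \<in> borel_measurable borel"
  by (simp add: sq_integrable_def)

lemma sq_integrable_scale: "sq_integrable f \<Longrightarrow> sq_integrable (\<lambda>x. c * f x)"
  by (auto simp: sq_integrable_def power_mult_distrib)

lemma sq_integrable_add:
  assumes "sq_integrable f" "sq_integrable g"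
  shows "sq_integrable (\<lambda>x. f x + g x)"
proof -
  have *: "(f x + g x)\<^sup>2 = (f x)\<^sup>2 + 2 * (f x * g x) + (g x)\<^sup>2" for x
    by (simp add: power2_eq_square algebra_simps)
  show ?thesis
    using assms integrable_mult_of_squares[of f lborel g] unfolding sq_integrable_def *
    by (intro conjI Bochner_Integration.integrable_add integrable_mult_right) auto
qed

lemma sq_integrable_diff:
  "sq_integrable f \<Longrightarrow> sq_integrable g \<Longrightarrow> sq_integrable (\<lambda>x. f x - g x)"
  using sq_integrable_add[of f "\<lambda>x. (-1) * g x"] sq_integrable_scale[of g "-1"] by simp

lemma sq_integrable_bounded:
  assumes f: "integrable lborel f" and B: "\<And>x. \<bar>f x\<bar> \<le> B"
  shows "sq_integrable f"
  unfolding sq_integrable_def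
proof
  show "integrable lborel (\<lambda>x. (f x)\<^sup>2)"
  proof (rule Bochner_Integration.integrable_bound)
    show "integrable lborel (\<lambda>x. B * \<bar>f x\<bar>)" using f by simp
    have "(f x)\<^sup>2 \<le> B * \<bar>f x\<bar>" for x
      using mult_right_mono[OF B[of x] abs_ge_zero[of "f x"]] by (simp add: power2_eq_square)
    then show "AE x in lborel. norm ((f x)\<^sup>2) \<le> norm (B * \<bar>f x\<bar>)"
      by (intro AE_I2) (metis abs_ge_self order_trans real_norm_def abs_power2)
  qed (use borel_measurable_integrable[OF f] in measurable)
qed (use f in auto)

lemma conv_measurable [measurable]:
  assumes [measurable]: "G \<in> borel_measurable borel" "w \<in> borel_measurable borel"
  shows "conv G w \<in> borel_measurable borel"
proof -
  have "(\<lambda>x. LINT y|lborel. G (x - y) * w y) \<in> borel_measurable lborel" by measurable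
  then show ?thesis by (simp add: conv_def[abs_def])
qed

text \<open>Young's inequality for \<open>L^1\<close> against \<open>L^2\<close>: \<open>|G|\<close>
  is split into two square roots, one of which stays with \<open>w\<close> in the Cauchy-Schwarz
  inequality. For integrable \<open>G\<close> the defining integral need converge only for almost
  every \<open>x\<close>, hence the form of the first claim.\<close>

lemma conv_sq_integrable:
  assumes G: "integrable lborel G" and w: "sq_integrable w"
  shows conv_AE_integrable: "AE x in lborel. integrable lborel (\<lambda>y. G (x - y) * w y)"
    and sq_integrable_conv: "sq_integrable (conv G w)"
    and integral_conv_sq_le:
      "(LINT x|lborel. (conv G w x)\<^sup>2) \<le> (LINT x|lborel. \<bar>G x\<bar>)\<^sup>2 * (LINT x|lborel. (w x)\<^sup>2)"
proof -
  note [measurable] = borel_measurable_integrable[OF G] sq_integrable_measurable[OF w]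
  have w2: "integrable lborel (\<lambda>y. (w y)\<^sup>2)" using w by (simp add: sq_integrable_def)
  let ?n = "LINT x|lborel. \<bar>G x\<bar>"
  have aG: "integrable lborel (\<lambda>x. \<bar>G x\<bar>)" using G by simp
  have nG: "(LINT y|lborel. \<bar>G (x - y)\<bar>) = ?n" for x
    using integral_translate_reflect(1)[of "\<lambda>x. \<bar>G x\<bar>" x] .
  define f where "f = (\<lambda>(x, y). \<bar>G (x - y)\<bar> * (w y)\<^sup>2)"
  have [measurable]: "f \<in> borel_measurable (lborel \<Otimes>\<^sub>M lborel)" unfolding f_def by measurable
  have fx: "has_bochner_integral lborel (\<lambda>x. f (x, y)) (?n * (w y)\<^sup>2)" for y
    using integral_translate_reflect(2)[of "\<lambda>x. \<bar>G x\<bar>" y] integrable_translate_reflect(2)[OF aG, of y]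
    by (auto simp: has_bochner_integral_iff f_def)
  have pf: "integrable (lborel \<Otimes>\<^sub>M lborel) f"
  proof (rule integrable_pair_lborelI)
    show "integrable lborel (\<lambda>y. ?n * (w y)\<^sup>2)" using w2 by simp
    show "(\<integral>\<^sup>+x. norm (f (x, y)) \<partial>lborel) \<le> ennreal (?n * (w y)\<^sup>2)" for y
    proof -
      have "(\<integral>\<^sup>+x. norm (f (x, y)) \<partial>lborel) = (\<integral>\<^sup>+x. ennreal (f (x, y)) \<partial>lborel)"
        by (simp add: f_def)
      also have "\<dots> = ennreal (?n * (w y)\<^sup>2)"
        using fx[of y] by (subst nn_integral_eq_integral) (auto simp: has_bochner_integral_iff f_def)
      finally show ?thesis by simp
    qed
  qed measurable
  have ae: "AE x in lborel. integrable lborel (\<lambda>y. f (x, y))"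
    by (rule lborel_pair.AE_integrable_fst'[OF pf])
  then have main: "AE x in lborel. integrable lborel (\<lambda>y. G (x - y) * w y) \<and>
     (conv G w x)\<^sup>2 \<le> ?n * (LINT y|lborel. f (x, y))"
  proof eventually_elim
    case (elim x)
    have i1: "integrable lborel (\<lambda>y. (sqrt \<bar>G (x - y)\<bar>)\<^sup>2)"
      using integrable_translate_reflect(1)[OF aG, of x] by simp
    have i2: "integrable lborel (\<lambda>y. (sqrt \<bar>G (x - y)\<bar> * \<bar>w y\<bar>)\<^sup>2)"
      using elim by (simp add: power_mult_distrib f_def)
    have eq: "sqrt \<bar>G (x - y)\<bar> * (sqrt \<bar>G (x - y)\<bar> * \<bar>w y\<bar>) = \<bar>G (x - y) * w y\<bar>" for y
      by (simp add: mult.assoc[symmetric] abs_mult)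
    have i3: "integrable lborel (\<lambda>y. G (x - y) * w y)"
      by (rule integrable_abs_cancel, subst eq[symmetric], rule integrable_mult_of_squares[OF _ _ i1 i2]) measurable
    have "\<bar>conv G w x\<bar> \<le> (LINT y|lborel. \<bar>G (x - y) * w y\<bar>)"
      unfolding conv_def by (rule integral_abs_bound)
    then have "(conv G w x)\<^sup>2 \<le> (LINT y|lborel. \<bar>G (x - y) * w y\<bar>)\<^sup>2"
      using abs_le_square_iff[of "conv G w x" "LINT y|lborel. \<bar>G (x - y) * w y\<bar>"] by simp
    also have "\<dots> \<le> ?n * (LINT y|lborel. f (x, y))"
      using Cauchy_Schwarz_integral[OF _ _ i1 i2] unfolding eq by (simp add: power_mult_distrib f_def nG)
    finally show ?case using i3 by simp
  qed
  then show "AE x in lborel. integrable lborel (\<lambda>y. G (x - y) * w y)" by eventually_elim simp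
  have iF: "integrable lborel (\<lambda>x. ?n * (LINT y|lborel. f (x, y)))"
    using lborel_pair.integrable_fst'[OF pf] by simp
  have ic: "integrable lborel (\<lambda>x. (conv G w x)\<^sup>2)"
  proof (rule Bochner_Integration.integrable_bound[OF iF])
    show "AE x in lborel. norm ((conv G w x)\<^sup>2) \<le> norm (?n * (LINT y|lborel. f (x, y)))"
      using main by eventually_elim auto
  qed measurable
  then show "sq_integrable (conv G w)" by (simp add: sq_integrable_def)
  have "(LINT x|lborel. (conv G w x)\<^sup>2) \<le> (LINT x|lborel. ?n * (LINT y|lborel. f (x, y)))"
    using main by (intro integral_mono_AE ic iF) auto
  also have "\<dots> = ?n * (LINT x|lborel. LINT y|lborel. f (x, y))" by simp
  also have "(LINT x|lborel. LINT y|lborel. f (x, y)) = (LINT y|lborel. LINT x|lborel. f (x, y))"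
    by (rule lborel_pair.Fubini_integral[symmetric]) (use pf in simp)
  also have "\<dots> = ?n * (LINT y|lborel. (w y)\<^sup>2)"
    using fx by (simp add: has_bochner_integral_iff)
  finally show "(LINT x|lborel. (conv G w x)\<^sup>2) \<le> ?n\<^sup>2 * (LINT x|lborel. (w x)\<^sup>2)"
    by (simp add: power2_eq_square mult.assoc)
qed

text \<open>Since \<open>|w| <= 1 + w^2\<close>, the weight splits into the constant 1 and an
  integrable part.\<close>

lemma ac_deriv_conv:
  assumes "ac_deriv E E'" "integrable lborel E" "integrable lborel E'" "sq_integrable w"
  shows "ac_deriv (conv E w) (conv E' w)"
  using ac_deriv_convolution[OF assms(1-3), of w "\<lambda>y. (w y)\<^sup>2" 1] assms(4)
  by (simp add: abs_le_one_plus_square sq_integrable_def conv_def[abs_def])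

text \<open>Existence for the linear problem: each derivative falls on the kernel, first turning
  \<open>E\<close> into \<open>E'\<close> and then \<open>E'\<close> into the combination prescribed
  by its equation. Continuity of \<open>conv E' w\<close> makes the first derivative
  classical.\<close>

lemma resolvent_kernel_solves:
  assumes E: "resolvent_kernel b a G E E'" and G: "integrable lborel G" and w: "sq_integrable w"
  obtains u' u'' where "H2_witness (conv E w) u' u''"
    "AE x in lborel. - u'' x - b * u' x - a * conv E w x = conv G w x"
proof
  have iE: "integrable lborel E" and iE': "integrable lborel E'" and dE: "ac_deriv E E'"
    and dE': "ac_deriv E' (\<lambda>x. - b * E' x - a * E x - G x)"
    using E by (auto simp: resolvent_kernel_def)
  note [measurable] = sq_integrable_measurable[OF w] borel_measurable_integrable[OF iE] borel_measurable_integrable[OF iE']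
     borel_measurable_integrable[OF G]
  have iE'': "integrable lborel (\<lambda>x. - b * E' x - a * E x - G x)"
    using iE iE' G by simp
  define u'' where "u'' = (\<lambda>x. - b * conv E' w x - a * conv E w x - conv G w x)"
  have d1: "ac_deriv (conv E w) (conv E' w)" by (rule ac_deriv_conv[OF dE iE iE' w])
  have d2: "ac_deriv (conv E' w) u''"
  proof (rule ac_deriv_cong_AE[OF ac_deriv_conv[OF dE' iE' iE'' w]])
    show "u'' \<in> borel_measurable lborel" unfolding u''_def by measurable
    \<comment> \<open>The convolution is distributed over the combination at those \<open>x\<close>
      where all three integrals converge.\<close>
    show "AE x in lborel. conv (\<lambda>x. - b * E' x - a * E x - G x) w x = u'' x"
      using conv_AE_integrable[OF iE w] conv_AE_integrable[OF iE' w] conv_AE_integrable[OF G w]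
    proof eventually_elim
      case (elim x)
      have "conv (\<lambda>x. - b * E' x - a * E x - G x) w x = 
         (LINT y|lborel. - b * (E' (x - y) * w y) - a * (E (x - y) * w y) - G (x - y) * w y)"
        unfolding conv_def by (intro Bochner_Integration.integral_cong) (auto simp: algebra_simps)
      also have "\<dots> = u'' x"
        unfolding u''_def conv_def using elim by simp
      finally show ?case .
    qed
  qed
  have c2: "isCont (conv E' w) x" for x by (rule ac_deriv_isCont[OF d2])
  have s: "sq_integrable (conv E w)" "sq_integrable (conv E' w)" "sq_integrable (conv G w)"
    by (auto intro!: sq_integrable_conv w iE iE' G)
  have "sq_integrable u''" unfolding u''_def
    by (intro sq_integrable_diff sq_integrable_scale s)
  then show "H2_witness (conv E w) (conv E' w) u''"
    unfolding H2_witness_def using s ac_deriv_has_vector_derivative[OF d1 c2] d2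
    by (auto simp: has_real_derivative_iff_has_vector_derivative ac_deriv_def)
  show "AE x in lborel. - u'' x - b * conv E' w x - a * conv E w x = conv G w x"
    by (simp add: u''_def)
qed

section \<open>Uniqueness for the linear problem\<close>

text \<open>A positive value \<open>e x\<close> would persist on \<open>{x..x + n}\<close> for every
  \<open>n\<close> and make the integral of \<open>e\<close> exceed every bound.\<close>

lemma monotone_integrable_eq_0:
  fixes e :: "real \<Rightarrow> real"
  assumes mono: "\<And>x y. x \<le> y \<Longrightarrow> e x \<le> e y" and e: "integrable lborel e" and nonneg: "\<And>x. e x \<ge> 0"
  shows "e x = 0"
proof (rule ccontr)
  assume "e x \<noteq> 0"
  then have c: "e x > 0" using nonneg[of x] by simp
  have "real n * e x \<le> (LINT y|lborel. e y)" for n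
  proof -
    have "(LINT y|lborel. indicator {x..x + real n} y * e x) \<le> (LINT y|lborel. e y)"
      by (intro integral_mono e integrable_mult_left integrable_real_indicator)
         (auto simp: indicator_def nonneg mono)
    then show ?thesis by simp
  qed
  moreover obtain n where "real n > (LINT y|lborel. e y) / e x" using reals_Archimedean2 by blast
  ultimately show False using c by (simp add: field_simps not_less[symmetric])
qed

lemma H2_witness_ac_deriv: "H2_witness z z' z'' \<Longrightarrow> ac_deriv z' z''"
  by (auto simp: H2_witness_def ac_deriv_def)

text \<open>Differentiating the energy \<open>e\<close> and inserting the equation leaves
  \<open>- 2 b z'^2\<close>, which has a fixed sign. So \<open>e\<close> is monotone, after
  reflection if \<open>b > 0\<close>, and being integrable it vanishes.\<close>

lemma homogeneous_H2_solution_eq_0: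
  assumes z: "H2_witness z z' z''" and a: "a \<ge> 0"
    and eq: "AE x in lborel. - z'' x - b * z' x - a * z x = 0"
  shows "z x = 0"
proof -
  have dz: "(z has_real_derivative z' x) (at x)" for x using z by (simp add: H2_witness_def)
  have sz: "sq_integrable z" "sq_integrable z'" using z by (simp_all add: H2_witness_def)
  define g where "g = (\<lambda>x. - b * z' x - a * z x)"
  have cz: "isCont z x" for x by (rule DERIV_isCont[OF dz])
  have cz': "isCont z' x" for x by (rule ac_deriv_isCont[OF H2_witness_ac_deriv[OF z]])
  have cg: "isCont g x" for x unfolding g_def by (intro continuous_intros cz cz')
  note [measurable] = sz[THEN sq_integrable_measurable]
  \<comment> \<open>The second derivative agrees almost everywhere with the continuous
    \<open>g\<close>, so \<open>z'\<close> becomes differentiable in the classical sense.\<close>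
  have "ac_deriv z' g"
  proof (rule ac_deriv_cong_AE[OF H2_witness_ac_deriv[OF z]])
    show "AE x in lborel. z'' x = g x" using eq by eventually_elim (simp add: g_def)
  qed (simp add: g_def)
  then have dz': "(z' has_real_derivative g x) (at x)" for x
    using ac_deriv_has_vector_derivative[OF _ cg] by (simp add: has_real_derivative_iff_has_vector_derivative)
  define e where "e = (\<lambda>x. (z' x)\<^sup>2 + a * (z x)\<^sup>2)"
  have de: "(e has_real_derivative - 2 * b * (z' x)\<^sup>2) (at x)" for x
    unfolding e_def by (rule derivative_eq_intros dz dz' refl | simp)+ (simp add: g_def power2_eq_square algebra_simps)
  have ie: "integrable lborel e" using sz unfolding e_def sq_integrable_def by simp
  have e0: "e x \<ge> 0" for x using a by (simp add: e_def)
  have "e x = 0" for x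
  proof (cases "b \<le> 0")
    case True
    then have le: "0 \<le> - 2 * b * (z' x)\<^sup>2" for x by (simp add: mult_nonpos_nonneg)
    have "e x \<le> e y" if "x \<le> y" for x y
      using that by (rule DERIV_nonneg_imp_nondecreasing) (metis de le)
    then show ?thesis using monotone_integrable_eq_0[OF _ ie e0] by blast
  next
    case False
    then have le: "- 2 * b * (z' x)\<^sup>2 \<le> 0" for x by simp
    have "e y \<le> e x" if "x \<le> y" for x y
      using that by (rule DERIV_nonpos_imp_nonincreasing) (metis de le)
    then have "e (- (- x)) = 0"
      by (intro monotone_integrable_eq_0[of "\<lambda>x. e (- x)"] integrable_translate_reflect(3) ie e0) auto
    then show ?thesis by simp
  qed
  then have "z' x = 0" for x 
    using a unfolding e_def by (simp add: add_nonneg_eq_0_iff)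
  then have "z x = z y" for x y using DERIV_isconst_all[of z x y] dz by simp
  \<comment> \<open>A constant is trivially monotone, so square integrability forces it to be 0.
    This matters for \<open>a = 0\<close>, where the energy sees only \<open>z'\<close>.\<close>
  then have "(z x)\<^sup>2 \<le> (z y)\<^sup>2" for x y by (metis order_refl)
  then have "(z x)\<^sup>2 = 0"
    using monotone_integrable_eq_0[of "\<lambda>x. (z x)\<^sup>2" x] sz by (auto simp: sq_integrable_def)
  then show ?thesis by simp
qed

lemma H2_witness_diff:
  assumes u: "H2_witness u u' u''" and v: "H2_witness v v' v''"
  shows "H2_witness (\<lambda>x. u x - v x) (\<lambda>x. u' x - v' x) (\<lambda>x. u'' x - v'' x)"
proof -
  have "ac_deriv (\<lambda>x. u' x + - v' x) (\<lambda>x. u'' x + - v'' x)"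
    by (intro ac_deriv_add H2_witness_ac_deriv[OF u]
        ac_deriv_bounded_linear[OF bounded_linear_minus[OF bounded_linear_ident] H2_witness_ac_deriv[OF v]])
  then show ?thesis
    using u v unfolding H2_witness_def ac_deriv_def
    by (auto intro!: sq_integrable_diff derivative_eq_intros)
qed

lemma H2_linear_solution_unique:
  assumes u: "H2_witness u u' u''" "AE x in lborel. - u'' x - b * u' x - a * u x = f x"
    and v: "H2_witness v v' v''" "AE x in lborel. - v'' x - b * v' x - a * v x = f x" and a: "a \<ge> 0"
  shows "u = v"
proof
  fix x
  have "AE x in lborel. - (u'' x - v'' x) - b * (u' x - v' x) - a * (u x - v x) = 0"
    using u(2) v(2) by eventually_elim (simp add: algebra_simps)
  from homogeneous_H2_solution_eq_0[OF H2_witness_diff[OF u(1) v(1)] a this]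
  show "u x = v x" by simp
qed

text \<open>With a square integrable kernel the convolution converges at every point. This estimate
  later turns mean square convergence of the iterates into pointwise convergence.\<close>

lemma conv_abs_le:
  assumes E: "sq_integrable E" and w: "sq_integrable w"
  shows "integrable lborel (\<lambda>y. E (x - y) * w y)"
    "(conv E w x)\<^sup>2 \<le> (LINT y|lborel. (E y)\<^sup>2) * (LINT y|lborel. (w y)\<^sup>2)"
proof -
  note [measurable] = sq_integrable_measurable[OF E] sq_integrable_measurable[OF w]
  have i: "integrable lborel (\<lambda>y. (E (x - y))\<^sup>2)" "integrable lborel (\<lambda>y. (w y)\<^sup>2)"
    using integrable_translate_reflect(1)[of "\<lambda>y. (E y)\<^sup>2" x] E w by (auto simp: sq_integrable_def)
  show "integrable lborel (\<lambda>y. E (x - y) * w y)"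
    by (rule integrable_mult_of_squares[OF _ _ i]) auto
  show "(conv E w x)\<^sup>2 \<le> (LINT y|lborel. (E y)\<^sup>2) * (LINT y|lborel. (w y)\<^sup>2)"
    using Cauchy_Schwarz_integral[OF _ _ i] integral_translate_reflect(1)[of "\<lambda>y. (E y)\<^sup>2" x]
    by (simp add: conv_def)
qed

section \<open>Fourier transform and autocorrelation\<close>

definition osc :: "real \<Rightarrow> real \<Rightarrow> complex" where
  "osc p x = exp (- \<i> * complex_of_real (p * x))"

lemma norm_osc [simp]: "cmod (osc p x) = 1"
  by (simp add: osc_def norm_exp_eq_Re)

lemma osc_measurable [measurable]: "(\<lambda>(p, x). osc p x) \<in> borel_measurable (borel \<Otimes>\<^sub>M borel)"
  unfolding osc_def by measurable

lemma osc_measurable_right [measurable]: "osc p \<in> borel_measurable borel"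
  unfolding osc_def by measurable

lemma osc_commute: "osc p x = osc x p"
  by (simp add: osc_def mult.commute)

lemma cnj_osc: "cnj (osc p x) = osc p (- x)"
  by (simp add: osc_def exp_cnj)

lemma integrable_osc:
  fixes f :: "real \<Rightarrow> real"
  assumes "integrable lborel f"
  shows "integrable lborel (\<lambda>x. complex_of_real (f x) * osc p x)"
  by (rule Bochner_Integration.integrable_bound[OF assms])
     (use borel_measurable_integrable[OF assms] in \<open>auto simp: norm_mult\<close>)

lemma fourier_osc:
  "fourier f p = complex_of_real (1 / sqrt (2 * pi)) * (LINT x|lborel. complex_of_real (f x) * osc p x)"
  by (simp add: fourier_def osc_def)

lemma fourier_measurable [measurable]:
  assumes [measurable]: "f \<in> borel_measurable borel"
  shows "fourier f \<in> borel_measurable borel"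
proof -
  have "(\<lambda>p. LINT x|lborel. complex_of_real (f x) * osc p x) \<in> borel_measurable lborel"
    by (rule lborel.borel_measurable_lebesgue_integral) measurable
  then show ?thesis unfolding fourier_osc[abs_def] by simp
qed

lemma fourier_norm_le:
  "cmod (fourier f p) \<le> 1 / sqrt (2 * pi) * (LINT x|lborel. \<bar>f x\<bar>)"
proof -
  have "cmod (LINT x|lborel. complex_of_real (f x) * osc p x) \<le> (LINT x|lborel. cmod (complex_of_real (f x) * osc p x))"
    by (rule integral_norm_bound)
  then show ?thesis
    by (simp add: fourier_osc norm_mult norm_divide divide_right_mono)
qed

text \<open>Convolving \<open>E\<close> with a character multiplies that character by the transform
  of \<open>E\<close>. Its derivative can be taken on the kernel or on the character; comparison at
  0 gives the formula without boundary terms.\<close>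

lemma fourier_ac_deriv:
  assumes E: "ac_deriv E E'" and iE: "integrable lborel E" and iE': "integrable lborel E'"
  shows "fourier E' p = \<i> * of_real p * fourier E p"
proof -
  define c where "c = (\<lambda>f. LINT y|lborel. complex_of_real (f y) * osc p y)"
  have eq: "(LINT y|lborel. f (x - y) *\<^sub>R osc p (- y)) = osc p (- x) * c f" for f x
  proof -
    have "(LINT y|lborel. f (x - y) *\<^sub>R osc p (- y)) = (LINT y|lborel. osc p (- x) * (complex_of_real (f (x - y)) * osc p (x - y)))"
      by (intro Bochner_Integration.integral_cong) (auto simp: osc_def scaleR_conv_of_real exp_add[symmetric] algebra_simps)
    also have "\<dots> = osc p (- x) * (LINT y|lborel. complex_of_real (f (x - y)) * osc p (x - y))"
      by simp
    finally show ?thesis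
      using integral_translate_reflect(1)[of "\<lambda>y. complex_of_real (f y) * osc p y" x] by (simp add: c_def)
  qed
  have "ac_deriv (\<lambda>x. LINT y|lborel. E (x - y) *\<^sub>R osc p (- y)) (\<lambda>x. LINT y|lborel. E' (x - y) *\<^sub>R osc p (- y))"
    by (rule ac_deriv_convolution[OF E iE iE', of _ "\<lambda>_. 0" 1]) auto
  then have d: "ac_deriv (\<lambda>x. osc p (- x) * c E) (\<lambda>x. osc p (- x) * c E')"
    unfolding eq .
  have "isCont (\<lambda>x. osc p (- x) * c E') x" for x
    unfolding osc_def by (intro continuous_intros)
  from ac_deriv_has_vector_derivative[OF d this, of 0]
  have d1: "((\<lambda>x. osc p (- x) * c E) has_vector_derivative c E') (at 0)" by (simp add: osc_def)
  have "((\<lambda>z. exp (\<i> * of_real p * z) * c E) has_field_derivative (\<i> * of_real p * c E)) (at (of_real 0))"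
    by (auto intro!: derivative_eq_intros)
  from has_vector_derivative_real_field[OF this]
  have d2: "((\<lambda>x. osc p (- x) * c E) has_vector_derivative (\<i> * of_real p * c E)) (at 0)"
    by (simp add: osc_def mult_ac)
  have "c E' = \<i> * of_real p * c E" using vector_derivative_unique_at[OF d1 d2] .
  then show ?thesis by (simp add: fourier_osc c_def)
qed

text \<open>Each derivative multiplies the transform by \<open>i p\<close>, so the kernel equation
  turns into division by the symbol.\<close>

lemma fourier_resolvent_kernel:
  assumes E: "resolvent_kernel b a G E E'" and G: "integrable lborel G"
  shows "fourier G p = ((of_real p)\<^sup>2 - of_real a - \<i> * of_real (b * p)) * fourier E p"
proof -
  have iE: "integrable lborel E" and iE': "integrable lborel E'" and dE: "ac_deriv E E'"
    and dE': "ac_deriv E' (\<lambda>x. - b * E' x - a * E x - G x)"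
    using E by (auto simp: resolvent_kernel_def)
  have iE'': "integrable lborel (\<lambda>x. - b * E' x - a * E x - G x)"
    using iE iE' G by simp
  have "fourier (\<lambda>x. - b * E' x - a * E x - G x) p = 
      - of_real b * fourier E' p - of_real a * fourier E p - fourier G p"
  proof -
    have "(LINT x|lborel. complex_of_real (- b * E' x - a * E x - G x) * osc p x) =
       (LINT x|lborel. - of_real b * (complex_of_real (E' x) * osc p x) - of_real a * (complex_of_real (E x) * osc p x)
           - complex_of_real (G x) * osc p x)"
      by (intro Bochner_Integration.integral_cong) (auto simp: algebra_simps)
    also have "\<dots> = - of_real b * (LINT x|lborel. complex_of_real (E' x) * osc p x) - of_real a * (LINT x|lborel. complex_of_real (E x) * osc p x)
       - (LINT x|lborel. complex_of_real (G x) * osc p x)"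
      using integrable_osc[OF iE, of p] integrable_osc[OF iE', of p] integrable_osc[OF G, of p] by simp
    finally have e: "(LINT x|lborel. complex_of_real (- b * E' x - a * E x - G x) * osc p x) = \<dots>" .
    show ?thesis unfolding fourier_osc e by (simp add: algebra_simps)
  qed
  then have "\<i> * of_real p * (\<i> * of_real p * fourier E p) = 
      - of_real b * (\<i> * of_real p * fourier E p) - of_real a * fourier E p - fourier G p"
    using fourier_ac_deriv[OF dE iE iE', of p] fourier_ac_deriv[OF dE' iE' iE'', of p] by simp
  then have "fourier G p = - of_real b * (\<i> * of_real p * fourier E p) - of_real a * fourier E p - \<i> * of_real p * (\<i> * of_real p * fourier E p)"
    by (simp add: algebra_simps)
  then show ?thesis by (simp add: algebra_simps power2_eq_square)
qed

text \<open>The convolution theorem; the factor \<open>sqrt (2 * pi)\<close> comes from the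
  symmetric normalization of \<open>fourier\<close> and is the source of \<open>2 * pi\<close> in
  the contraction constant.\<close>

lemma conv_L1:
  assumes G: "integrable lborel G" and w: "integrable lborel w"
  shows integrable_conv: "integrable lborel (conv G w)"
    and fourier_conv: "fourier (conv G w) p = of_real (sqrt (2 * pi)) * fourier G p * fourier w p"
proof -
  note [measurable] = borel_measurable_integrable[OF G] borel_measurable_integrable[OF w]
  let ?n = "LINT x|lborel. \<bar>G x\<bar>"
  have bound: "(\<integral>\<^sup>+x. ennreal \<bar>G (x - y) * w y\<bar> \<partial>lborel) \<le> ennreal (?n * \<bar>w y\<bar>)" for y
  proof -
    have aG: "integrable lborel (\<lambda>x. \<bar>G x\<bar>)" using G by simp
    have "(\<integral>\<^sup>+x. ennreal \<bar>G (x - y) * w y\<bar> \<partial>lborel) = ennreal (LINT x|lborel. \<bar>G (x - y)\<bar> * \<bar>w y\<bar>)"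
      unfolding abs_mult
      by (rule nn_integral_eq_integral) (auto intro!: integrable_mult_left integrable_translate_reflect(2)[OF aG])
    also have "(LINT x|lborel. \<bar>G (x - y)\<bar> * \<bar>w y\<bar>) = ?n * \<bar>w y\<bar>"
      using integral_translate_reflect(2)[of "\<lambda>x. \<bar>G x\<bar>" y] by simp
    finally show ?thesis by simp
  qed
  have iw: "integrable lborel (\<lambda>y. ?n * \<bar>w y\<bar>)" using w by simp
  have "integrable (lborel \<Otimes>\<^sub>M lborel) (\<lambda>(x, y). G (x - y) * w y)"
    by (rule integrable_pair_lborelI[OF _ _ iw]) (use bound in auto)
  from lborel_pair.integrable_fst'[OF this] show "integrable lborel (conv G w)"
    by (simp add: conv_def[abs_def])
  define f where "f = (\<lambda>(x, y). complex_of_real (G (x - y) * w y) * osc p x)"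
  have pf: "integrable (lborel \<Otimes>\<^sub>M lborel) f"
    by (rule integrable_pair_lborelI[OF _ _ iw]) (use bound in \<open>auto simp: f_def norm_mult abs_mult\<close>)
  have fy: "(LINT y|lborel. f (x, y)) = complex_of_real (conv G w x) * osc p x" for x
    unfolding f_def conv_def prod.case by (simp del: of_real_mult)
  have fx: "(LINT x|lborel. f (x, y)) = (LINT x|lborel. complex_of_real (G x) * osc p x) * (complex_of_real (w y) * osc p y)" for y
  proof -
    have "(LINT x|lborel. f (x, y)) = (LINT x|lborel. (complex_of_real (G (x - y)) * osc p (x - y)) * (complex_of_real (w y) * osc p y))"
      unfolding f_def
      by (intro Bochner_Integration.integral_cong) (auto simp: osc_def exp_add[symmetric] algebra_simps)
    also have "\<dots> = (LINT x|lborel. complex_of_real (G (x - y)) * osc p (x - y)) * (complex_of_real (w y) * osc p y)"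
      by (rule integral_mult_left_zero)
    finally show ?thesis
      using integral_translate_reflect(2)[of "\<lambda>x. complex_of_real (G x) * osc p x" y] by simp
  qed
  have "(LINT x|lborel. complex_of_real (conv G w x) * osc p x) = (LINT y|lborel. LINT x|lborel. f (x, y))"
    unfolding fy[symmetric] by (rule lborel_pair.Fubini_integral[symmetric]) (use pf in simp)
  also have "\<dots> = (LINT x|lborel. complex_of_real (G x) * osc p x) * (LINT y|lborel. complex_of_real (w y) * osc p y)"
    unfolding fx by (rule integral_mult_right_zero)
  finally show "fourier (conv G w) p = of_real (sqrt (2 * pi)) * fourier G p * fourier w p"
    by (simp add: fourier_osc field_simps)
qed

text \<open>Both sides are iterated integrals of \<open>W p\<close>, \<open>A s\<close> and a
  character that is symmetric in \<open>p\<close> and \<open>s\<close>.\<close>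

lemma fourier_multiplication:
  assumes A: "integrable lborel A" and W: "integrable lborel W"
  shows "(LINT p|lborel. fourier A p * of_real (W p)) = (LINT s|lborel. of_real (A s) * fourier W s)"
proof -
  note [measurable] = borel_measurable_integrable[OF A] borel_measurable_integrable[OF W]
  define f where "f = (\<lambda>(p, s). complex_of_real (W p) * (complex_of_real (A s) * osc p s))"
  have iw: "integrable lborel (\<lambda>s. (LINT p|lborel. \<bar>W p\<bar>) * \<bar>A s\<bar>)" using A by simp
  have pf: "integrable (lborel \<Otimes>\<^sub>M lborel) f"
  proof (rule integrable_pair_lborelI[OF _ _ iw])
    show "f \<in> borel_measurable (lborel \<Otimes>\<^sub>M lborel)" unfolding f_def by measurable
    fix s
    have "(\<integral>\<^sup>+p. ennreal (cmod (f (p, s))) \<partial>lborel) = (\<integral>\<^sup>+p. ennreal (\<bar>W p\<bar> * \<bar>A s\<bar>) \<partial>lborel)"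
      by (simp add: f_def norm_mult)
    also have "\<dots> = ennreal (LINT p|lborel. \<bar>W p\<bar> * \<bar>A s\<bar>)"
      by (rule nn_integral_eq_integral) (use W in auto)
    finally show "(\<integral>\<^sup>+p. ennreal (cmod (f (p, s))) \<partial>lborel) \<le> ennreal ((LINT p|lborel. \<bar>W p\<bar>) * \<bar>A s\<bar>)" by simp
  qed
  have "(LINT p|lborel. LINT s|lborel. f (p, s)) = (LINT s|lborel. LINT p|lborel. f (p, s))"
    by (rule lborel_pair.Fubini_integral[symmetric]) (use pf in simp)
  moreover have "(LINT s|lborel. f (p, s)) = of_real (sqrt (2 * pi)) * (fourier A p * of_real (W p))" for p
    unfolding f_def prod.case integral_mult_right_zero by (simp add: fourier_osc)
  moreover have "(LINT p|lborel. f (p, s)) = of_real (sqrt (2 * pi)) * (of_real (A s) * fourier W s)" for s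
  proof -
    have "(LINT p|lborel. f (p, s)) = (LINT p|lborel. complex_of_real (A s) * (complex_of_real (W p) * osc s p))"
      unfolding f_def by (simp add: osc_commute[of _ s] mult_ac)
    then show ?thesis unfolding integral_mult_right_zero by (simp add: fourier_osc)
  qed
  ultimately show ?thesis by simp
qed

section \<open>Gaussian regularization of Plancherel's identity\<close>

definition gauss :: "real \<Rightarrow> real \<Rightarrow> real" where
  "gauss d p = exp (- (d * p)\<^sup>2 / 2)"

lemma gauss_pos [simp]: "gauss d p > 0" "gauss d p \<ge> 0" "gauss d p \<noteq> 0" by (simp_all add: gauss_def)

lemma gauss_measurable [measurable]: "gauss d \<in> borel_measurable borel"
  unfolding gauss_def by measurable

lemma gauss_std_normal: "gauss 1 p = sqrt (2 * pi) * std_normal_density p"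
  by (simp add: gauss_def std_normal_density_def)

lemma integrable_std_normal: "integrable lborel std_normal_density"
  by (rule integrable_normal_density) simp

lemma integrable_gauss:
  assumes "d \<noteq> 0"
  shows "integrable lborel (gauss d)"
proof -
  have "integrable lborel (gauss 1)" unfolding gauss_std_normal[abs_def] using integrable_std_normal by simp
  from lborel_integrable_real_affine[OF this assms, of 0] show ?thesis by (simp add: gauss_def[abs_def])
qed

text \<open>For \<open>d = 1\<close> this is the characteristic function of the standard normal
  distribution; general \<open>d\<close> follows by scaling.\<close>

lemma fourier_gauss:
  assumes d: "d > 0"
  shows "fourier (gauss d) s = of_real (gauss (1 / d) s / d)"
proof -
  have one: "(LINT x|lborel. complex_of_real (gauss 1 x) * osc t x) = of_real (sqrt (2 * pi) * gauss 1 t)" for t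
  proof -
    have "(LINT x|lborel. std_normal_density x *\<^sub>R iexp (- t * x)) = char std_normal_distribution (- t)"
      unfolding char_def by (subst integral_density) auto
    also have "\<dots> = of_real (gauss 1 t)"
      by (simp add: char_std_normal_distribution gauss_def)
    finally have e1: "(LINT x|lborel. std_normal_density x *\<^sub>R iexp (- t * x)) = of_real (gauss 1 t)" .
    have e2: "(LINT x|lborel. complex_of_real (gauss 1 x) * osc t x) = 
       (LINT x|lborel. complex_of_real (sqrt (2 * pi)) * (std_normal_density x *\<^sub>R iexp (- t * x)))"
      by (intro Bochner_Integration.integral_cong) (auto simp: gauss_std_normal osc_def scaleR_conv_of_real)
    show ?thesis unfolding e2 integral_mult_right_zero e1 by simp
  qed
  have "(LINT x|lborel. complex_of_real (gauss d x) * osc s x) = 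
      (LINT x|lborel. complex_of_real (gauss 1 (0 + d * x)) * osc (s / d) (0 + d * x))"
    using d by (intro Bochner_Integration.integral_cong) (auto simp: gauss_def osc_def)
  also have "\<dots> = of_real (1 / d) * (LINT x|lborel. complex_of_real (gauss 1 x) * osc (s / d) x)"
    using lborel_integral_real_affine[of d "\<lambda>x. complex_of_real (gauss 1 x) * osc (s / d) x" 0] d
    by (simp add: scaleR_conv_of_real)
  finally have e: "(LINT x|lborel. complex_of_real (gauss d x) * osc s x) = \<dots>" .
  have "gauss (1 / d) s = gauss 1 (s / d)" by (simp add: gauss_def)
  then show ?thesis unfolding fourier_osc e one by simp
qed

definition autocorr :: "(real \<Rightarrow> real) \<Rightarrow> real \<Rightarrow> real" where
  "autocorr f s = (LINT x|lborel. f x * f (x + s))"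

lemma autocorr_conv: "autocorr f = conv f (\<lambda>y. f (- y))"
proof
  fix s
  show "autocorr f s = conv f (\<lambda>y. f (- y)) s"
    using integral_translate_reflect(4)[of "\<lambda>x. f x * f (x + s)"]
    by (simp add: autocorr_def conv_def mult.commute)
qed

lemma fourier_reflect: "fourier (\<lambda>y. f (- y)) p = cnj (fourier f p)"
proof -
  have "(LINT x|lborel. complex_of_real (f (- x)) * osc p x) = (LINT x|lborel. complex_of_real (f x) * osc p (- x))"
    using integral_translate_reflect(4)[of "\<lambda>x. complex_of_real (f x) * osc p (- x)"] by simp
  also have "\<dots> = cnj (LINT x|lborel. complex_of_real (f x) * osc p x)"
    unfolding Bochner_Integration.integral_cnj[symmetric] by (simp add: cnj_osc)
  finally show ?thesis by (simp add: fourier_osc)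
qed

lemma fourier_autocorr:
  assumes f: "integrable lborel f"
  shows "fourier (autocorr f) p = of_real (sqrt (2 * pi) * (cmod (fourier f p))\<^sup>2)"
  unfolding autocorr_conv fourier_conv[OF f integrable_translate_reflect(3)[OF f]] fourier_reflect
  by (simp only: of_real_mult complex_norm_square mult.assoc)

text \<open>Cauchy-Schwarz together with translation invariance; the bound is the value of
  \<open>autocorr f\<close> at 0.\<close>

lemma abs_autocorr_le:
  assumes "sq_integrable f"
  shows "\<bar>autocorr f s\<bar> \<le> (LINT x|lborel. (f x)\<^sup>2)"
proof -
  note [measurable] = sq_integrable_measurable[OF assms]
  have f2: "integrable lborel (\<lambda>x. (f x)\<^sup>2)" using assms by (simp add: sq_integrable_def)
  have i: "integrable lborel (\<lambda>x. (f (x + s))\<^sup>2)"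
    using integrable_translate_reflect(2)[OF f2, of "-s"] by simp
  have "(autocorr f s)\<^sup>2 \<le> (LINT x|lborel. (f x)\<^sup>2) * (LINT x|lborel. (f (x + s))\<^sup>2)"
    unfolding autocorr_def by (rule Cauchy_Schwarz_integral[OF _ _ f2 i]) auto
  also have "(LINT x|lborel. (f (x + s))\<^sup>2) = (LINT x|lborel. (f x)\<^sup>2)"
    using integral_translate_reflect(3)[of "\<lambda>x. (f x)\<^sup>2" s] .
  finally have "(autocorr f s)\<^sup>2 \<le> (LINT x|lborel. (f x)\<^sup>2)\<^sup>2" by (simp add: power2_eq_square)
  then show ?thesis using abs_le_square_iff[of "autocorr f s" "LINT x|lborel. (f x)\<^sup>2"] by simp
qed

text \<open>The transform of an integrable function is bounded, and the Gaussian weight makes its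
  square integrable. Letting \<open>d\<close> tend to 0 removes the weight.\<close>

definition energy :: "real \<Rightarrow> (real \<Rightarrow> real) \<Rightarrow> real" where
  "energy d f = (LINT p|lborel. (cmod (fourier f p))\<^sup>2 * gauss d p)"

lemma integrable_energy:
  assumes f: "integrable lborel f" and d: "d \<noteq> 0"
  shows "integrable lborel (\<lambda>p. (cmod (fourier f p))\<^sup>2 * gauss d p)"
proof (rule Bochner_Integration.integrable_bound)
  note [measurable] = borel_measurable_integrable[OF f]
  let ?B = "1 / sqrt (2 * pi) * (LINT x|lborel. \<bar>f x\<bar>)"
  show "integrable lborel (\<lambda>p. ?B\<^sup>2 * gauss d p)" using integrable_gauss[OF d] by simp
  have "(cmod (fourier f p))\<^sup>2 \<le> ?B\<^sup>2" for p by (intro power_mono fourier_norm_le) auto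
  then show "AE p in lborel. norm ((cmod (fourier f p))\<^sup>2 * gauss d p) \<le> norm (?B\<^sup>2 * gauss d p)"
    by (intro AE_I2) (simp add: abs_mult mult_right_mono del: power_mult_distrib)
qed (use borel_measurable_integrable[OF f] in measurable)

text \<open>The squared modulus is the transform of the autocorrelation. The multiplication formula
  moves the transform onto the Gaussian, and the substitution \<open>s = d * t\<close> normalizes
  it.\<close>

lemma energy_autocorr:
  assumes f: "integrable lborel f" and d: "d > 0"
  shows "energy d f = (LINT t|lborel. std_normal_density t * autocorr f (d * t))"
proof -
  have A: "integrable lborel (autocorr f)"
    unfolding autocorr_conv by (intro integrable_conv f integrable_translate_reflect)
  have "complex_of_real (sqrt (2 * pi) * energy d f) = 
      (LINT p|lborel. fourier (autocorr f) p * of_real (gauss d p))"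
    unfolding fourier_autocorr[OF f] energy_def
    by (simp add: mult.assoc flip: of_real_mult of_real_power)
  also have "\<dots> = (LINT s|lborel. of_real (autocorr f s) * fourier (gauss d) s)"
    using d by (intro fourier_multiplication A integrable_gauss) auto
  also have "\<dots> = complex_of_real (LINT s|lborel. autocorr f s * (gauss (1 / d) s / d))"
    unfolding fourier_gauss[OF d] of_real_mult[symmetric] by (rule integral_complex_of_real)
  finally have "sqrt (2 * pi) * energy d f = (LINT s|lborel. autocorr f s * (gauss (1 / d) s / d))"
    by (simp only: of_real_eq_iff)
  also have "\<dots> = (LINT t|lborel. d * (autocorr f (d * t) * (gauss 1 t / d)))"
    using lborel_integral_real_affine[of d "\<lambda>s. autocorr f s * (gauss (1 / d) s / d)" 0] d
    by (simp add: gauss_def)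
  also have "\<dots> = (LINT t|lborel. sqrt (2 * pi) * (std_normal_density t * autocorr f (d * t)))"
    using d by (intro Bochner_Integration.integral_cong) (auto simp: gauss_std_normal)
  finally show ?thesis by simp
qed

text \<open>The standard normal density has total mass 1, so averaging preserves the bound on the
  autocorrelation.\<close>

lemma energy_le:
  assumes f: "integrable lborel f" and f2: "sq_integrable f" and d: "d > 0"
  shows "energy d f \<le> (LINT x|lborel. (f x)\<^sup>2)"
proof -
  note [measurable] = borel_measurable_integrable[OF f]
  let ?S = "LINT x|lborel. (f x)\<^sup>2"
  have [measurable]: "autocorr f \<in> borel_measurable borel" unfolding autocorr_conv by measurable
  have i: "integrable lborel (\<lambda>t. std_normal_density t * ?S)" using integrable_std_normal by simp
  have le: "\<bar>std_normal_density t * autocorr f (d * t)\<bar> \<le> std_normal_density t * ?S" for t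
    using abs_autocorr_le[OF f2, of "d * t"] by (simp add: abs_mult mult_left_mono)
  have "energy d f \<le> (LINT t|lborel. std_normal_density t * ?S)"
    unfolding energy_autocorr[OF f d]
  proof (rule integral_mono[OF _ i])
    show "integrable lborel (\<lambda>t. std_normal_density t * autocorr f (d * t))"
      by (rule Bochner_Integration.integrable_bound[OF i]) (use le order_trans[OF le abs_ge_self] in auto)
    show "std_normal_density t * autocorr f (d * t) \<le> std_normal_density t * ?S" for t
      using le[of t] by simp
  qed
  also have "\<dots> = ?S" by simp
  finally show ?thesis .
qed

text \<open>Continuity and boundedness of \<open>f\<close> make the autocorrelation converge to its
  value at 0, by dominated convergence with majorant \<open>B * |f|\<close>; a second dominated
  convergence passes through the average.\<close>

lemma energy_tendsto:
  assumes f: "integrable lborel f" and c: "\<And>x. isCont f x" and B: "\<And>x. \<bar>f x\<bar> \<le> B"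
  shows "(\<lambda>n. energy (inverse (real (Suc n))) f) \<longlonglongrightarrow> (LINT x|lborel. (f x)\<^sup>2)"
proof -
  note [measurable] = borel_measurable_integrable[OF f]
  have f2: "sq_integrable f" by (rule sq_integrable_bounded[OF f B])
  let ?S = "LINT x|lborel. (f x)\<^sup>2"
  have [measurable]: "autocorr f \<in> borel_measurable borel" unfolding autocorr_conv by measurable
  have ac: "(\<lambda>n. autocorr f (inverse (real (Suc n)) * t)) \<longlonglongrightarrow> ?S" for t
  proof -
    have lim: "(\<lambda>n. x + inverse (real (Suc n)) * t) \<longlonglongrightarrow> x" for x
      using tendsto_add[OF tendsto_const[of x] tendsto_mult[OF LIMSEQ_inverse_real_of_nat tendsto_const[of t]]] by simp
    have "(\<lambda>n. LINT x|lborel. f x * f (x + inverse (real (Suc n)) * t)) \<longlonglongrightarrow> (LINT x|lborel. f x * f x)"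
    proof (rule integral_dominated_convergence)
      show "integrable lborel (\<lambda>x. \<bar>f x\<bar> * B)" using f by simp
      show "AE x in lborel. (\<lambda>n. f x * f (x + inverse (real (Suc n)) * t)) \<longlonglongrightarrow> f x * f x"
        by (intro AE_I2 tendsto_mult tendsto_const isCont_tendsto_compose[OF c lim])
      show "AE x in lborel. norm (f x * f (x + inverse (real (Suc n)) * t)) \<le> \<bar>f x\<bar> * B" for n
        using B by (auto simp: abs_mult mult_left_mono)
    qed measurable
    then show ?thesis by (simp add: autocorr_def power2_eq_square)
  qed
  have "(\<lambda>n. LINT t|lborel. std_normal_density t * autocorr f (inverse (real (Suc n)) * t)) \<longlonglongrightarrow> 
     (LINT t|lborel. std_normal_density t * ?S)"
  proof (rule integral_dominated_convergence)
    show "integrable lborel (\<lambda>t. std_normal_density t * ?S)" using integrable_std_normal by simp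
    show "AE t in lborel. (\<lambda>n. std_normal_density t * autocorr f (inverse (real (Suc n)) * t)) \<longlonglongrightarrow> std_normal_density t * ?S"
      by (intro AE_I2 tendsto_mult tendsto_const ac)
    show "AE t in lborel. norm (std_normal_density t * autocorr f (inverse (real (Suc n)) * t)) \<le> std_normal_density t * ?S" for n
      using abs_autocorr_le[OF f2] by (auto simp: abs_mult mult_left_mono)
  qed measurable
  then show ?thesis by (simp add: energy_autocorr[OF f])
qed

section \<open>The convolution bound in the mean square norm\<close>

text \<open>A bound valid from some index on suffices for the lower limit. This serves to remove
  truncations and to compare the limit of the Picard iterates with a fixed iterate.\<close>

lemma Fatou_square:
  fixes f :: "nat \<Rightarrow> real \<Rightarrow> real"
  assumes f: "\<And>n. sq_integrable (f n)" and lim: "\<And>x. (\<lambda>n. f n x) \<longlonglongrightarrow> g x"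
    and C: "\<And>n. n \<ge> m \<Longrightarrow> (LINT x|lborel. (f n x)\<^sup>2) \<le> C"
  shows "sq_integrable g" "(LINT x|lborel. (g x)\<^sup>2) \<le> C"
proof -
  note [measurable] = sq_integrable_measurable[OF f]
  have f2: "integrable lborel (\<lambda>x. (f n x)\<^sup>2)" for n using f[of n] by (simp add: sq_integrable_def)
  have C0: "C \<ge> 0" using C[OF order_refl] by (rule order_trans[rotated]) simp
  have [measurable]: "g \<in> borel_measurable lborel"
    by (rule borel_measurable_LIMSEQ_real[of lborel f]) (use lim in auto)
  have "(\<integral>\<^sup>+x. ennreal ((g x)\<^sup>2) \<partial>lborel) = (\<integral>\<^sup>+x. liminf (\<lambda>n. ennreal ((f n x)\<^sup>2)) \<partial>lborel)"
  proof (intro nn_integral_cong)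
    fix x
    have "(\<lambda>n. ennreal ((f n x)\<^sup>2)) \<longlonglongrightarrow> ennreal ((g x)\<^sup>2)"
      by (intro tendsto_ennrealI tendsto_power lim)
    then show "ennreal ((g x)\<^sup>2) = liminf (\<lambda>n. ennreal ((f n x)\<^sup>2))"
      by (rule lim_imp_Liminf[symmetric, rotated]) simp
  qed
  also have "\<dots> \<le> liminf (\<lambda>n. \<integral>\<^sup>+x. ennreal ((f n x)\<^sup>2) \<partial>lborel)"
    by (rule nn_integral_liminf) measurable
  also have "\<dots> \<le> liminf (\<lambda>n. ennreal C)"
  proof (rule Liminf_mono)
    have "(\<integral>\<^sup>+x. ennreal ((f n x)\<^sup>2) \<partial>lborel) \<le> ennreal C" if "n \<ge> m" for n
      using C[OF that] by (subst nn_integral_eq_integral[OF f2]) (auto intro: ennreal_leI)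
    then show "\<forall>\<^sub>F n in sequentially. (\<integral>\<^sup>+x. ennreal ((f n x)\<^sup>2) \<partial>lborel) \<le> ennreal C"
      by (auto simp: eventually_sequentially)
  qed
  also have "\<dots> = ennreal C" by (simp add: Liminf_const)
  finally have le: "(\<integral>\<^sup>+x. ennreal ((g x)\<^sup>2) \<partial>lborel) \<le> ennreal C" .
  have ig: "integrable lborel (\<lambda>x. (g x)\<^sup>2)"
    unfolding integrable_iff_bounded using le by (auto intro: le_less_trans)
  then show "sq_integrable g" by (simp add: sq_integrable_def)
  show "(LINT x|lborel. (g x)\<^sup>2) \<le> C"
    using le C0 by (simp add: nn_integral_eq_integral[OF ig])
qed

definition trunc :: "real \<Rightarrow> (real \<Rightarrow> real) \<Rightarrow> real \<Rightarrow> real" where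
  "trunc R w x = indicator {-R..R} x * w x"

lemma trunc:
  assumes w: "sq_integrable w"
  shows sq_integrable_trunc: "sq_integrable (trunc R w)"
    and integrable_trunc: "integrable lborel (trunc R w)"
    and integral_trunc_sq_le: "(LINT x|lborel. (trunc R w x)\<^sup>2) \<le> (LINT x|lborel. (w x)\<^sup>2)"
proof -
  note [measurable] = sq_integrable_measurable[OF w]
  show s: "sq_integrable (trunc R w)"
    by (rule sq_integrable_bound[OF w]) (auto simp: trunc_def[abs_def] indicator_def)
  have i: "integrable lborel (\<lambda>x. (indicator {-R..R} x :: real)\<^sup>2)"
    by (simp add: power2_eq_square flip: indicator_inter_arith) (cases "- R \<le> R"; simp)
  show "integrable lborel (trunc R w)"
    unfolding trunc_def[abs_def]
    by (rule integrable_mult_of_squares[OF _ _ i]) (use w in \<open>auto simp: sq_integrable_def\<close>)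
  show "(LINT x|lborel. (trunc R w x)\<^sup>2) \<le> (LINT x|lborel. (w x)\<^sup>2)"
    using s w unfolding sq_integrable_def by (intro integral_mono) (auto simp: trunc_def indicator_def)
qed

lemma trunc_tendsto: "(\<lambda>n. trunc (real n) w x) \<longlonglongrightarrow> w x"
proof (rule tendsto_eventually)
  obtain N where "real N \<ge> \<bar>x\<bar>" using real_arch_simple by blast
  then show "\<forall>\<^sub>F n in sequentially. trunc (real n) w x = w x"
    unfolding eventually_sequentially
    by (intro exI[of _ N]) (auto simp: trunc_def indicator_def)
qed

text \<open>The transform of \<open>conv E w\<close> has modulus at most
  \<open>sqrt (2 * pi) * q\<close> times that of \<open>w\<close>. For integrable \<open>w\<close>
  this compares the regularized energies: the limit recovers the norm on the left, while
  \<open>energy_le\<close> bounds the right.\<close>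

lemma conv_L2_bound:
  assumes dE: "ac_deriv E E'" and iE: "integrable lborel E" and iE': "integrable lborel E'"
    and q: "AE p in lborel. cmod (fourier E p) \<le> q" and w: "sq_integrable w"
  shows "(LINT x|lborel. (conv E w x)\<^sup>2) \<le> 2 * pi * q\<^sup>2 * (LINT x|lborel. (w x)\<^sup>2)"
proof -
  note [measurable] = borel_measurable_integrable[OF iE]
  obtain B where B: "B \<ge> 0" "\<And>x. norm (E x) \<le> B" using ac_deriv_bounded[OF dE iE'] by blast
  have E2: "sq_integrable E" by (rule sq_integrable_bounded[OF iE, of B]) (use B in auto)
  have L1: "(LINT x|lborel. (conv E w x)\<^sup>2) \<le> 2 * pi * q\<^sup>2 * (LINT x|lborel. (w x)\<^sup>2)"
    if w: "sq_integrable w" and iw: "integrable lborel w" for w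
  proof -
    note [measurable] = sq_integrable_measurable[OF w]
    have ic: "integrable lborel (conv E w)" by (rule integrable_conv[OF iE iw])
    have cont: "isCont (conv E w) x" for x by (rule ac_deriv_isCont[OF ac_deriv_conv[OF dE iE iE' w]])
    have bd: "\<bar>conv E w x\<bar> \<le> B * (LINT y|lborel. \<bar>w y\<bar>)" for x
    proof -
      have "\<bar>conv E w x\<bar> \<le> (LINT y|lborel. \<bar>E (x - y) * w y\<bar>)" unfolding conv_def by (rule integral_abs_bound)
      also have "\<dots> \<le> (LINT y|lborel. B * \<bar>w y\<bar>)"
        using conv_abs_le(1)[OF E2 w, of x] iw B
        by (intro integral_mono integrable_abs integrable_mult_right) (auto simp: abs_mult intro!: mult_right_mono)
      finally show ?thesis by simp
    qed
    have "energy d (conv E w) \<le> 2 * pi * q\<^sup>2 * (LINT x|lborel. (w x)\<^sup>2)" if d: "d > 0" for d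
    proof -
      have "energy d (conv E w) \<le> (LINT p|lborel. 2 * pi * q\<^sup>2 * ((cmod (fourier w p))\<^sup>2 * gauss d p))"
        unfolding energy_def
      proof (rule integral_mono_AE)
        show "AE p in lborel. (cmod (fourier (conv E w) p))\<^sup>2 * gauss d p \<le> 2 * pi * q\<^sup>2 * ((cmod (fourier w p))\<^sup>2 * gauss d p)"
          using q
        proof eventually_elim
          case (elim p)
          have "(cmod (fourier (conv E w) p))\<^sup>2 = 2 * pi * (cmod (fourier E p))\<^sup>2 * (cmod (fourier w p))\<^sup>2"
            by (simp add: fourier_conv[OF iE iw] norm_mult power_mult_distrib)
          also have "\<dots> \<le> 2 * pi * q\<^sup>2 * (cmod (fourier w p))\<^sup>2"
            using elim by (intro mult_right_mono mult_left_mono power_mono) auto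
          finally have "(cmod (fourier (conv E w) p))\<^sup>2 * gauss d p \<le> 2 * pi * q\<^sup>2 * (cmod (fourier w p))\<^sup>2 * gauss d p"
            by (rule mult_right_mono) simp
          then show ?case by (simp add: mult.assoc)
        qed
      qed (use d in \<open>auto intro!: integrable_energy ic iw integrable_mult_right\<close>)
      also have "\<dots> = 2 * pi * q\<^sup>2 * energy d w" by (simp add: energy_def)
      also have "\<dots> \<le> 2 * pi * q\<^sup>2 * (LINT x|lborel. (w x)\<^sup>2)"
        by (intro mult_left_mono energy_le iw w d) auto
      finally show ?thesis .
    qed
    then show ?thesis
      by (intro LIMSEQ_le_const2[OF energy_tendsto[OF ic cont bd]]) auto
  qed
  \<comment> \<open>General \<open>w\<close> is reached by truncation: the convolutions converge at
    every point because \<open>E\<close> is square integrable, and Fatou's lemma preserves the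
    bound.\<close>
  show ?thesis
  proof (rule Fatou_square(2)[of "\<lambda>n. conv E (trunc (real n) w)" _ 0])
    fix n
    show "sq_integrable (conv E (trunc (real n) w))"
      by (rule sq_integrable_conv[OF iE sq_integrable_trunc[OF w]])
    have "(LINT x|lborel. (conv E (trunc (real n) w) x)\<^sup>2) \<le> 2 * pi * q\<^sup>2 * (LINT x|lborel. (trunc (real n) w x)\<^sup>2)"
      by (rule L1[OF sq_integrable_trunc[OF w] integrable_trunc[OF w]])
    also have "\<dots> \<le> 2 * pi * q\<^sup>2 * (LINT x|lborel. (w x)\<^sup>2)"
      by (intro mult_left_mono integral_trunc_sq_le w) auto
    finally show "(LINT x|lborel. (conv E (trunc (real n) w) x)\<^sup>2) \<le> 2 * pi * q\<^sup>2 * (LINT x|lborel. (w x)\<^sup>2)" .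
  next
    fix x
    note [measurable] = sq_integrable_measurable[OF w] sq_integrable_measurable[OF sq_integrable_trunc[OF w]]
    show "(\<lambda>n. conv E (trunc (real n) w) x) \<longlonglongrightarrow> conv E w x"
      unfolding conv_def
    proof (rule integral_dominated_convergence)
      show "integrable lborel (\<lambda>y. \<bar>E (x - y) * w y\<bar>)" using conv_abs_le(1)[OF E2 w, of x] by simp
      show "AE y in lborel. (\<lambda>n. E (x - y) * trunc (real n) w y) \<longlonglongrightarrow> E (x - y) * w y"
        by (intro AE_I2 tendsto_mult tendsto_const trunc_tendsto)
      show "AE y in lborel. norm (E (x - y) * trunc (real n) w y) \<le> \<bar>E (x - y) * w y\<bar>" for n
        by (intro AE_I2) (auto simp: trunc_def indicator_def)
    qed measurable
  qed
qed

section \<open>Vanishing convolutions and the mean square transform\<close>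

lemma fourier_trunc_eq: "fourier_trunc w R p = fourier (trunc R w) p"
proof -
  have "(LINT x:{-R..R}|lborel. complex_of_real (w x) * exp (- \<i> * complex_of_real (p * x)))
      = (LINT x|lborel. complex_of_real (trunc R w x) * exp (- \<i> * complex_of_real (p * x)))"
    unfolding set_lebesgue_integral_def
    by (intro Bochner_Integration.integral_cong) (auto simp: trunc_def indicator_def)
  then show ?thesis by (simp add: fourier_trunc_def fourier_def)
qed

lemma trunc_L2_tendsto:
  assumes w: "sq_integrable w"
  shows "(\<lambda>n. LINT x|lborel. (w x - trunc (real n) w x)\<^sup>2) \<longlonglongrightarrow> 0"
proof -
  note [measurable] = sq_integrable_measurable[OF w] sq_integrable_measurable[OF sq_integrable_trunc[OF w]]
  have "(\<lambda>n. LINT x|lborel. (w x - trunc (real n) w x)\<^sup>2) \<longlonglongrightarrow> (LINT x|lborel. (w x - w x)\<^sup>2)"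
  proof (rule integral_dominated_convergence)
    show "integrable lborel (\<lambda>x. (w x)\<^sup>2)" using w by (simp add: sq_integrable_def)
    show "AE x in lborel. (\<lambda>n. (w x - trunc (real n) w x)\<^sup>2) \<longlonglongrightarrow> (w x - w x)\<^sup>2"
      by (intro AE_I2 tendsto_power tendsto_diff tendsto_const trunc_tendsto)
    show "AE x in lborel. norm ((w x - trunc (real n) w x)\<^sup>2) \<le> (w x)\<^sup>2" for n
      by (intro AE_I2) (auto simp: trunc_def indicator_def)
  qed measurable
  then show ?thesis by simp
qed

text \<open>Truncations \<open>wn\<close> connect the two notions of transform. As
  \<open>conv G w = 0\<close>, \<open>conv G (wn n)\<close> is minus the convolution of
  \<open>G\<close> with \<open>w - wn n\<close>, hence small; as \<open>fourier G\<close> is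
  bounded, its products with the transforms of \<open>wn n\<close> approximate
  \<open>fourier G p * \<phi> p\<close>.\<close>

lemma conv_eq_0_fourier:
  assumes G: "integrable lborel G" and w: "sq_integrable w" and phi: "is_L2_fourier w \<phi>"
    and zero: "AE x in lborel. conv G w x = 0"
  shows "emeasure lborel {p. \<phi> p \<noteq> 0 \<and> fourier G p \<noteq> 0} = 0"
proof -
  note [measurable] = borel_measurable_integrable[OF G] sq_integrable_measurable[OF w]
     sq_integrable_measurable[OF sq_integrable_trunc[OF w]]
  have [measurable]: "\<phi> \<in> borel_measurable borel" using phi by (simp add: is_L2_fourier_def)
  define B where "B = 1 / sqrt (2 * pi) * (LINT x|lborel. \<bar>G x\<bar>)"
  have B: "cmod (fourier G p) \<le> B" for p unfolding B_def by (rule fourier_norm_le)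
  define wn where "wn n = trunc (real n) w" for n
  have wn2: "sq_integrable (wn n)" and wn1: "integrable lborel (wn n)" for n
    unfolding wn_def by (rule sq_integrable_trunc[OF w], rule integrable_trunc[OF w])
  note [measurable] = sq_integrable_measurable[OF wn2]
  \<comment> \<open>Young's bound for the convolution of \<open>G\<close> with the truncation
    error.\<close>
  define e where "e n = (LINT x|lborel. \<bar>G x\<bar>)\<^sup>2 * (LINT x|lborel. (w x - wn n x)\<^sup>2)" for n
  have e_lim: "e \<longlonglongrightarrow> 0"
    using tendsto_mult[OF tendsto_const trunc_L2_tendsto[OF w], of "(LINT x|lborel. \<bar>G x\<bar>)\<^sup>2"]
    unfolding e_def[abs_def] wn_def by simp
  have e0: "e n \<ge> 0" for n unfolding e_def by simp
  have small: "energy 1 (conv G (wn n)) \<le> e n" for n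
  proof -
    have d: "sq_integrable (\<lambda>x. w x - wn n x)" by (intro sq_integrable_diff w wn2)
    note [measurable] = sq_integrable_measurable[OF d]
    have "energy 1 (conv G (wn n)) \<le> (LINT x|lborel. (conv G (wn n) x)\<^sup>2)"
      by (intro energy_le integrable_conv sq_integrable_conv G wn1 wn2) simp
    also have "\<dots> = (LINT x|lborel. (conv G (\<lambda>x. w x - wn n x) x)\<^sup>2)"
    proof (rule integral_cong_AE)
      show "AE x in lborel. (conv G (wn n) x)\<^sup>2 = (conv G (\<lambda>x. w x - wn n x) x)\<^sup>2"
        using zero conv_AE_integrable[OF G w] conv_AE_integrable[OF G wn2[of n]]
      proof eventually_elim
        case (elim x)
        have "conv G (\<lambda>x. w x - wn n x) x = conv G w x - conv G (wn n) x"
          unfolding conv_def using elim by (simp add: right_diff_distrib)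
        then show ?case using elim by simp
      qed
    qed measurable
    also have "\<dots> \<le> e n" unfolding e_def by (rule integral_conv_sq_le[OF G d])
    finally show ?thesis .
  qed
  \<comment> \<open>The weight stays at \<open>d = 1\<close>: it is positive everywhere, so
    \<open>X = 0\<close> already forces the product to vanish almost everywhere.\<close>
  define X where "X = (\<integral>\<^sup>+p. ennreal ((cmod (fourier G p * \<phi> p))\<^sup>2 * gauss 1 p) \<partial>lborel)"
  define D where "D n = (\<integral>\<^sup>+p. ennreal ((cmod (\<phi> p - fourier_trunc w (real n) p))\<^sup>2) \<partial>lborel)" for n
  have D_lim: "D \<longlonglongrightarrow> 0"
    using phi filterlim_compose[OF _ filterlim_real_sequentially]
    unfolding is_L2_fourier_def D_def by blast
  have X_le: "X \<le> ennreal (2 * B\<^sup>2) * D n + ennreal (e n)" for n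
  proof -
    have ie: "integrable lborel (\<lambda>p. (cmod (fourier (conv G (wn n)) p))\<^sup>2 * gauss 1 p)"
      by (intro integrable_energy integrable_conv G wn1) simp
    have "X \<le> (\<integral>\<^sup>+p. ennreal (2 * B\<^sup>2) * ennreal ((cmod (\<phi> p - fourier_trunc w (real n) p))\<^sup>2) + 
       ennreal ((cmod (fourier (conv G (wn n)) p))\<^sup>2 * gauss 1 p) \<partial>lborel)"
      unfolding X_def
    proof (intro nn_integral_mono)
      fix p
      let ?g = "fourier G p" and ?d = "\<phi> p - fourier (wn n) p"
      have g1: "gauss 1 p \<le> 1" by (simp add: gauss_def)
      have c: "(cmod (fourier (conv G (wn n)) p))\<^sup>2 = 2 * pi * (cmod (?g * fourier (wn n) p))\<^sup>2"
        by (simp add: fourier_conv[OF G wn1] norm_mult power_mult_distrib)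
      have "cmod (?g * \<phi> p) \<le> cmod (?g * ?d) + cmod (?g * fourier (wn n) p)"
        using norm_triangle_ineq[of "?g * ?d" "?g * fourier (wn n) p"] by (simp add: algebra_simps)
      then have "(cmod (?g * \<phi> p))\<^sup>2 \<le> (cmod (?g * ?d) + cmod (?g * fourier (wn n) p))\<^sup>2"
        by (intro power_mono) auto
      also have "\<dots> \<le> 2 * (cmod (?g * ?d))\<^sup>2 + 2 * (cmod (?g * fourier (wn n) p))\<^sup>2"
        using zero_le_power2[of "cmod (?g * ?d) - cmod (?g * fourier (wn n) p)"]
        unfolding power2_sum power2_diff by simp
      \<comment> \<open>Raising 2 to \<open>2 * pi\<close> produces the constant of the convolution
        theorem, so that the last term becomes the transform of
        \<open>conv G (wn n)\<close>.\<close>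
      also have "\<dots> \<le> 2 * (B\<^sup>2 * (cmod ?d)\<^sup>2) + 2 * pi * (cmod (?g * fourier (wn n) p))\<^sup>2"
      proof (intro add_mono)
        show "2 * (cmod (?g * ?d))\<^sup>2 \<le> 2 * (B\<^sup>2 * (cmod ?d)\<^sup>2)"
          using B[of p] by (simp add: norm_mult power_mult_distrib mult_right_mono power_mono)
        show "2 * (cmod (?g * fourier (wn n) p))\<^sup>2 \<le> 2 * pi * (cmod (?g * fourier (wn n) p))\<^sup>2"
          using pi_ge_two by (intro mult_right_mono) auto
      qed
      finally have "(cmod (?g * \<phi> p))\<^sup>2 * gauss 1 p \<le> (2 * (B\<^sup>2 * (cmod ?d)\<^sup>2) + (cmod (fourier (conv G (wn n)) p))\<^sup>2) * gauss 1 p"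
        unfolding c by (rule mult_right_mono) simp
      also have "\<dots> \<le> 2 * B\<^sup>2 * (cmod ?d)\<^sup>2 + (cmod (fourier (conv G (wn n)) p))\<^sup>2 * gauss 1 p"
        using mult_left_mono[OF g1, of "2 * (B\<^sup>2 * (cmod ?d)\<^sup>2)"] by (simp add: algebra_simps)
      finally have "ennreal ((cmod (?g * \<phi> p))\<^sup>2 * gauss 1 p) \<le> 
         ennreal (2 * B\<^sup>2 * (cmod ?d)\<^sup>2 + (cmod (fourier (conv G (wn n)) p))\<^sup>2 * gauss 1 p)"
        by (rule ennreal_leI)
      then show "ennreal ((cmod (?g * \<phi> p))\<^sup>2 * gauss 1 p) \<le> ennreal (2 * B\<^sup>2) * ennreal ((cmod (\<phi> p - fourier_trunc w (real n) p))\<^sup>2) + 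
          ennreal ((cmod (fourier (conv G (wn n)) p))\<^sup>2 * gauss 1 p)"
        by (simp add: fourier_trunc_eq wn_def ennreal_plus ennreal_mult del: ennreal_plus_if)
    qed
    also have "\<dots> = ennreal (2 * B\<^sup>2) * D n + ennreal (energy 1 (conv G (wn n)))"
      unfolding D_def fourier_trunc_eq energy_def
      by (subst nn_integral_add, measurable, subst nn_integral_cmult, measurable)
         (simp add: nn_integral_eq_integral[OF ie])
    also have "\<dots> \<le> ennreal (2 * B\<^sup>2) * D n + ennreal (e n)"
      by (intro add_left_mono ennreal_leI small)
    finally show ?thesis .
  qed
  have "(\<lambda>n. ennreal (2 * B\<^sup>2) * D n + ennreal (e n)) \<longlonglongrightarrow> ennreal (2 * B\<^sup>2) * 0 + ennreal 0"
    by (intro tendsto_add ennreal_tendsto_cmult D_lim tendsto_ennrealI e_lim) auto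
  then have "X \<le> 0"
    by (intro LIMSEQ_le_const[of _ 0 X]) (auto intro: X_le)
  then have "AE p in lborel. ennreal ((cmod (fourier G p * \<phi> p))\<^sup>2 * gauss 1 p) = 0"
    unfolding X_def by (subst (asm) le_zero_eq, subst (asm) nn_integral_0_iff_AE) auto
  then have "AE p in lborel. \<not> (\<phi> p \<noteq> 0 \<and> fourier G p \<noteq> 0)"
    by eventually_elim (auto simp: mult_eq_0_iff less_le dest!: ennreal_eq_0_iff[THEN iffD1])
  then show ?thesis
    by (subst (asm) AE_iff_measurable[OF _ refl]) auto
qed

section \<open>Contraction\<close>

text \<open>\<open>vnorm N\<close> ignores components outside \<open>{1..N}\<close>, so vectors
  agreeing there have distance 0 and continuity identifies their values.\<close>

lemma caratheodory_cong:
  assumes f: "caratheodory N f" and eq: "\<And>j. j \<in> {1..N} \<Longrightarrow> u j = u' j"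
  shows "f u x = f u' x"
proof (rule ccontr)
  assume ne: "f u x \<noteq> f u' x"
  then have "\<bar>f u' x - f u x\<bar> > 0" by simp
  have "vnorm N (\<lambda>j. u' j - u j) = 0" using eq by (simp add: vnorm_def)
  moreover obtain d where "d > 0" "\<And>v. vnorm N (\<lambda>j. v j - u j) < d \<Longrightarrow> \<bar>f v x - f u x\<bar> < \<bar>f u' x - f u x\<bar>"
    using f \<open>\<bar>f u' x - f u x\<bar> > 0\<close> unfolding caratheodory_def by blast
  ultimately show False by force
qed

text \<open>Constant components are replaced by measurable functions one at a time, with the
  remaining ones frozen at an arbitrary \<open>c\<close>. Each new component is approximated by
  countably valued functions, and continuity in \<open>u\<close> passes to the limit.\<close>

lemma caratheodory_measurable:
  assumes f: "caratheodory N f" and v: "\<And>j. j \<in> {1..N} \<Longrightarrow> v j \<in> borel_measurable lborel"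
  shows "(\<lambda>x. f (\<lambda>j. v j x) x) \<in> borel_measurable lborel"
proof -
  have "(\<lambda>x. f (\<lambda>j. if j \<in> {1..m} then v j x else c j) x) \<in> borel_measurable lborel" if "m \<le> N" for m c
    using that
  proof (induction m arbitrary: c)
    case 0
    then show ?case using f by (simp add: caratheodory_def)
  next
    case (Suc m)
    have [measurable]: "v (Suc m) \<in> borel_measurable lborel" using v Suc.prems by auto
    \<comment> \<open>Rounding down to multiples of \<open>1 / Suc n\<close>: the error is at most
      the mesh, and on each of the countably many levels the induction hypothesis applies with a
      constant in place \<open>Suc m\<close>.\<close>
    define t where "t n x = real_of_int \<lfloor>real (Suc n) * v (Suc m) x\<rfloor> / real (Suc n)" for n x
    define g where "g n x = f (\<lambda>j. if j \<in> {1..m} then v j x else (c(Suc m := t n x)) j) x" for n x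
    have "g n \<in> borel_measurable lborel" for n
      unfolding g_def t_def
    proof (rule measurable_compose_countable[where g = "\<lambda>x. \<lfloor>real (Suc n) * v (Suc m) x\<rfloor>"])
      show "(\<lambda>x. f (\<lambda>j. if j \<in> {1..m} then v j x else (c(Suc m := real_of_int i / real (Suc n))) j) x) \<in> borel_measurable lborel" for i
        using Suc.IH Suc.prems by simp
    qed measurable
    moreover have "(\<lambda>n. g n x) \<longlonglongrightarrow> f (\<lambda>j. if j \<in> {1..Suc m} then v j x else c j) x" for x
    proof (rule LIMSEQ_I)
      fix e :: real assume "e > 0"
      define u where "u = (\<lambda>j. if j \<in> {1..Suc m} then v j x else c j)"
      obtain d where d: "d > 0" "\<And>u'. vnorm N (\<lambda>j. u' j - u j) < d \<Longrightarrow> \<bar>f u' x - f u x\<bar> < e"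
        using f \<open>e > 0\<close> unfolding caratheodory_def by blast
      obtain n0 where n0: "inverse (real (Suc n0)) < d" using reals_Archimedean[OF d(1)] by blast
      have "norm (g n x - f u x) < e" if "n \<ge> n0" for n
      proof -
        let ?u' = "\<lambda>j. if j \<in> {1..m} then v j x else (c(Suc m := t n x)) j"
        have ab: "\<bar>t n x - v (Suc m) x\<bar> \<le> inverse (real (Suc n))"
        proof -
          have "\<bar>real_of_int \<lfloor>real (Suc n) * v (Suc m) x\<rfloor> - real (Suc n) * v (Suc m) x\<bar> \<le> 1" by linarith
          moreover have "t n x - v (Suc m) x = (real_of_int \<lfloor>real (Suc n) * v (Suc m) x\<rfloor> - real (Suc n) * v (Suc m) x) / real (Suc n)"
            unfolding t_def by (simp add: field_simps del: of_nat_Suc)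
          ultimately show ?thesis
            by (simp add: inverse_eq_divide divide_right_mono del: of_nat_Suc)
        qed
        have "vnorm N (\<lambda>j. ?u' j - u j) = sqrt (\<Sum>k=1..N. if k = Suc m then (t n x - v (Suc m) x)\<^sup>2 else 0)"
          unfolding vnorm_def u_def by (intro arg_cong[where f=sqrt] sum.cong) auto
        also have "\<dots> = \<bar>t n x - v (Suc m) x\<bar>" using Suc.prems by simp
        also have "\<dots> \<le> inverse (real (Suc n0))"
          using that by (intro order_trans[OF ab] le_imp_inverse_le) auto
        finally have "vnorm N (\<lambda>j. ?u' j - u j) < d" using n0 by simp
        then show ?thesis using d(2) by (simp add: g_def)
      qed
      then show "\<exists>no. \<forall>n\<ge>no. norm (g n x - f (\<lambda>j. if j \<in> {1..Suc m} then v j x else c j) x) < e"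
        unfolding u_def by blast
    qed
    ultimately show ?case by (rule borel_measurable_LIMSEQ_real[rotated]) 
  qed
  from this[OF order_refl, of "\<lambda>_. 0"] show ?thesis
    by (rule measurable_cong[THEN iffD1, rotated]) (rule caratheodory_cong[OF f], simp)
qed

definition l2 :: "(real \<Rightarrow> real) \<Rightarrow> real" where
  "l2 f = sqrt (LINT x|lborel. (f x)\<^sup>2)"

lemma l2_nonneg [simp]: "l2 f \<ge> 0" and l2_power2: "(l2 f)\<^sup>2 = (LINT x|lborel. (f x)\<^sup>2)"
  by (simp_all add: l2_def)

lemma l2_triangle:
  assumes f: "sq_integrable f" and g: "sq_integrable g"
  shows "l2 (\<lambda>x. f x + g x) \<le> l2 f + l2 g"
proof (rule power2_le_imp_le)
  note [measurable] = sq_integrable_measurable[OF f] sq_integrable_measurable[OF g]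
  have i: "integrable lborel (\<lambda>x. (f x)\<^sup>2)" "integrable lborel (\<lambda>x. (g x)\<^sup>2)"
    using f g by (simp_all add: sq_integrable_def)
  have fg: "integrable lborel (\<lambda>x. f x * g x)" by (rule integrable_mult_of_squares[OF _ _ i]) auto
  have "(LINT x|lborel. f x * g x)\<^sup>2 \<le> (l2 f * l2 g)\<^sup>2"
    unfolding power_mult_distrib l2_power2 by (rule Cauchy_Schwarz_integral[OF _ _ i]) auto
  then have cs: "(LINT x|lborel. f x * g x) \<le> l2 f * l2 g"
    by (rule power2_le_imp_le) simp
  have "(l2 (\<lambda>x. f x + g x))\<^sup>2 = (LINT x|lborel. (f x)\<^sup>2 + 2 * (f x * g x) + (g x)\<^sup>2)"
    unfolding l2_power2 by (intro Bochner_Integration.integral_cong) (auto simp: power2_eq_square algebra_simps)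
  also have "\<dots> = (l2 f)\<^sup>2 + 2 * (LINT x|lborel. f x * g x) + (l2 g)\<^sup>2"
    using i fg by (simp add: l2_power2)
  also have "\<dots> \<le> (l2 f + l2 g)\<^sup>2" using cs by (simp add: power2_sum)
  finally show "(l2 (\<lambda>x. f x + g x))\<^sup>2 \<le> (l2 f + l2 g)\<^sup>2" .
qed simp

section \<open>The contraction on square integrable vector functions\<close>

text \<open>The differential system enters only through its kernels \<open>E k\<close> and their
  common transform bound \<open>q\<close>. \<open>small\<close> concerns squared distances, which
  avoids square roots in the estimates.\<close>

locale convolution_contraction =
  fixes N :: nat and E E' :: "nat \<Rightarrow> real \<Rightarrow> real" and F :: "nat \<Rightarrow> (nat \<Rightarrow> real) \<Rightarrow> real \<Rightarrow> real"
    and h :: "real \<Rightarrow> real" and KK L q :: real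
  assumes dE: "k \<in> {1..N} \<Longrightarrow> ac_deriv (E k) (E' k)"
    and iE: "k \<in> {1..N} \<Longrightarrow> integrable lborel (E k)"
    and iE': "k \<in> {1..N} \<Longrightarrow> integrable lborel (E' k)"
    and q: "k \<in> {1..N} \<Longrightarrow> AE p in lborel. cmod (fourier (E k) p) \<le> q"
    and F_car: "k \<in> {1..N} \<Longrightarrow> caratheodory N (F k)"
    and h_L2: "sq_integrable h"
    and F_growth: "sqrt (\<Sum>k=1..N. (F k u x)\<^sup>2) \<le> KK * vnorm N u + h x"
    and F_lip: "sqrt (\<Sum>k=1..N. (F k u1 x - F k u2 x)\<^sup>2) \<le> L * vnorm N (\<lambda>j. u1 j - u2 j)"
    and small: "2 * pi * q\<^sup>2 * L\<^sup>2 < 1"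
begin

definition L2N :: "(nat \<Rightarrow> real \<Rightarrow> real) \<Rightarrow> bool" where
  "L2N v \<longleftrightarrow> (\<forall>k\<in>{1..N}. sq_integrable (v k))"

definition Fc :: "(nat \<Rightarrow> real \<Rightarrow> real) \<Rightarrow> nat \<Rightarrow> real \<Rightarrow> real" where
  "Fc v k y = F k (\<lambda>j. v j y) y"

definition S :: "(nat \<Rightarrow> real \<Rightarrow> real) \<Rightarrow> nat \<Rightarrow> real \<Rightarrow> real" where
  "S v k = (if k \<in> {1..N} then conv (E k) (Fc v k) else (\<lambda>x. 0))"

definition dist2 :: "(nat \<Rightarrow> real \<Rightarrow> real) \<Rightarrow> (nat \<Rightarrow> real \<Rightarrow> real) \<Rightarrow> real" where
  "dist2 v w = (\<Sum>k=1..N. LINT x|lborel. (v k x - w k x)\<^sup>2)"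

lemma dist2_nonneg: "dist2 v w \<ge> 0"
  unfolding dist2_def by (intro sum_nonneg) auto

lemma dist2_component: "k \<in> {1..N} \<Longrightarrow> (LINT x|lborel. (v k x - w k x)\<^sup>2) \<le> dist2 v w"
  unfolding dist2_def by (intro member_le_sum) auto

lemma vnorm_power2: "(vnorm N u)\<^sup>2 = (\<Sum>k=1..N. (u k)\<^sup>2)"
  unfolding vnorm_def by (simp add: sum_nonneg)

text \<open>The growth condition gives
  \<open>(KK * |v| + h)^2 <= 2 * KK^2 * |v|^2 + 2 * h^2\<close>, and the right-hand side is
  integrable.\<close>

lemma Fc_sq_integrable:
  assumes v: "L2N v" and k: "k \<in> {1..N}"
  shows "sq_integrable (Fc v k)"
  unfolding sq_integrable_def
proof
  show m: "Fc v k \<in> borel_measurable lborel"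
    unfolding Fc_def[abs_def] using v
    by (intro caratheodory_measurable[OF F_car[OF k], of v]) (auto simp: L2N_def sq_integrable_def)
  have iv: "integrable lborel (\<lambda>x. \<Sum>j=1..N. (v j x)\<^sup>2)"
    using v by (intro Bochner_Integration.integrable_sum) (auto simp: L2N_def sq_integrable_def)
  have ih: "integrable lborel (\<lambda>x. (h x)\<^sup>2)" using h_L2 by (simp add: sq_integrable_def)
  show "integrable lborel (\<lambda>x. (Fc v k x)\<^sup>2)"
  proof (rule Bochner_Integration.integrable_bound)
    show "integrable lborel (\<lambda>x. 2 * KK\<^sup>2 * (\<Sum>j=1..N. (v j x)\<^sup>2) + 2 * (h x)\<^sup>2)"
      using iv ih by simp
    have "(Fc v k x)\<^sup>2 \<le> 2 * KK\<^sup>2 * (\<Sum>j=1..N. (v j x)\<^sup>2) + 2 * (h x)\<^sup>2" for x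
    proof -
      let ?n = "vnorm N (\<lambda>j. v j x)"
      have "(Fc v k x)\<^sup>2 \<le> (\<Sum>k=1..N. (F k (\<lambda>j. v j x) x)\<^sup>2)"
        unfolding Fc_def using k member_le_sum[of k "{1..N}" "\<lambda>k. (F k (\<lambda>j. v j x) x)\<^sup>2"] by simp
      also have "\<dots> \<le> (KK * ?n + h x)\<^sup>2"
        using power_mono[OF F_growth[of "\<lambda>j. v j x" x], of 2] by (simp add: sum_nonneg)
      also have "\<dots> \<le> 2 * (KK * ?n)\<^sup>2 + 2 * (h x)\<^sup>2"
        using zero_le_power2[of "KK * ?n - h x"] unfolding power2_sum power2_diff by simp
      finally show ?thesis by (simp add: power_mult_distrib vnorm_power2)
    qed
    then show "AE x in lborel. norm ((Fc v k x)\<^sup>2) \<le> norm (2 * KK\<^sup>2 * (\<Sum>j=1..N. (v j x)\<^sup>2) + 2 * (h x)\<^sup>2)"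
      by (intro AE_I2) (metis abs_ge_self abs_power2 order_trans real_norm_def)
  qed (use m in measurable)
qed

lemma E_sq_integrable: "k \<in> {1..N} \<Longrightarrow> sq_integrable (E k)"
  using ac_deriv_bounded[OF dE iE', of k] sq_integrable_bounded[OF iE, of k] by (metis real_norm_def)

text \<open>The identity holds at every \<open>x\<close>, since both convolutions with the square
  integrable \<open>E k\<close> converge everywhere.\<close>

lemma S_diff:
  assumes "L2N v" "L2N w" "k \<in> {1..N}"
  shows "S v k x - S w k x = conv (E k) (\<lambda>y. Fc v k y - Fc w k y) x"
  using assms conv_abs_le(1)[OF E_sq_integrable Fc_sq_integrable, of k v k x]
    conv_abs_le(1)[OF E_sq_integrable Fc_sq_integrable, of k w k x]
  by (simp add: S_def conv_def right_diff_distrib)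

lemma Fc_dist:
  assumes v: "L2N v" and w: "L2N w"
  shows "(\<Sum>k=1..N. LINT x|lborel. (Fc v k x - Fc w k x)\<^sup>2) \<le> L\<^sup>2 * dist2 v w"
proof -
  have i1: "integrable lborel (\<lambda>x. (Fc v k x - Fc w k x)\<^sup>2)" if "k \<in> {1..N}" for k
    using sq_integrable_diff[OF Fc_sq_integrable[OF v that] Fc_sq_integrable[OF w that]] by (simp add: sq_integrable_def)
  have i2: "integrable lborel (\<lambda>x. (v k x - w k x)\<^sup>2)" if "k \<in> {1..N}" for k
    using sq_integrable_diff[of "v k" "w k"] v w that by (auto simp: L2N_def sq_integrable_def)
  have "(\<Sum>k=1..N. LINT x|lborel. (Fc v k x - Fc w k x)\<^sup>2) = (LINT x|lborel. (\<Sum>k=1..N. (Fc v k x - Fc w k x)\<^sup>2))"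
    using i1 by simp
  also have "\<dots> \<le> (LINT x|lborel. L\<^sup>2 * (\<Sum>k=1..N. (v k x - w k x)\<^sup>2))"
  proof (rule integral_mono)
    fix x
    show "(\<Sum>k=1..N. (Fc v k x - Fc w k x)\<^sup>2) \<le> L\<^sup>2 * (\<Sum>k=1..N. (v k x - w k x)\<^sup>2)"
      using power_mono[OF F_lip[of "\<lambda>j. v j x" x "\<lambda>j. w j x"], of 2]
      by (simp add: Fc_def sum_nonneg power_mult_distrib vnorm_power2)
  qed (use i1 i2 in auto)
  also have "\<dots> = L\<^sup>2 * dist2 v w" using i2 by (simp add: dist2_def)
  finally show ?thesis .
qed

lemma S_L2N: "L2N v \<Longrightarrow> L2N (S v)"
  unfolding L2N_def S_def using sq_integrable_conv[OF iE Fc_sq_integrable] by (auto simp: L2N_def)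

lemma S_contraction:
  assumes v: "L2N v" and w: "L2N w"
  shows "dist2 (S v) (S w) \<le> 2 * pi * q\<^sup>2 * L\<^sup>2 * dist2 v w"
proof -
  have "dist2 (S v) (S w) \<le> (\<Sum>k=1..N. 2 * pi * q\<^sup>2 * (LINT x|lborel. (Fc v k x - Fc w k x)\<^sup>2))"
    unfolding dist2_def
  proof (rule sum_mono)
    fix k assume k: "k \<in> {1..N}"
    show "(LINT x|lborel. (S v k x - S w k x)\<^sup>2) \<le> 2 * pi * q\<^sup>2 * (LINT x|lborel. (Fc v k x - Fc w k x)\<^sup>2)"
      unfolding S_diff[OF v w k]
      by (rule conv_L2_bound[OF dE[OF k] iE[OF k] iE'[OF k] q[OF k]])
         (intro sq_integrable_diff Fc_sq_integrable v w k)
  qed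
  also have "\<dots> = 2 * pi * q\<^sup>2 * (\<Sum>k=1..N. LINT x|lborel. (Fc v k x - Fc w k x)\<^sup>2)"
    by (simp add: sum_distrib_left)
  also have "\<dots> \<le> 2 * pi * q\<^sup>2 * (L\<^sup>2 * dist2 v w)"
    by (intro mult_left_mono Fc_dist v w) auto
  finally show ?thesis by (simp add: mult.assoc)
qed

text \<open>\<open>L2N\<close> speaks of functions, not of classes modulo null sets; this estimate
  gives equality and convergence at individual points.\<close>

lemma S_pointwise:
  assumes v: "L2N v" and w: "L2N w" and k: "k \<in> {1..N}"
  shows "(S v k x - S w k x)\<^sup>2 \<le> (LINT y|lborel. (E k y)\<^sup>2) * L\<^sup>2 * dist2 v w"
proof -
  have "(S v k x - S w k x)\<^sup>2 \<le> (LINT y|lborel. (E k y)\<^sup>2) * (LINT y|lborel. (Fc v k y - Fc w k y)\<^sup>2)"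
    unfolding S_diff[OF v w k]
    by (intro conv_abs_le(2) E_sq_integrable sq_integrable_diff Fc_sq_integrable v w k)
  also have "(LINT y|lborel. (Fc v k y - Fc w k y)\<^sup>2) \<le> (\<Sum>k=1..N. LINT x|lborel. (Fc v k x - Fc w k x)\<^sup>2)"
    using k by (intro member_le_sum[where f="\<lambda>k. LINT x|lborel. (Fc v k x - Fc w k x)\<^sup>2"]) auto
  also have "\<dots> \<le> L\<^sup>2 * dist2 v w" by (rule Fc_dist[OF v w])
  finally show ?thesis by (simp add: mult_left_mono mult.assoc)
qed

text \<open>Contraction gives distance 0, that is, equality up to null sets; the pointwise estimate
  for the images under \<open>S\<close> upgrades it to equality.\<close>

lemma S_fixed_point_unique:
  assumes v: "L2N v" "S v = v" and w: "L2N w" "S w = w"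
  shows "v = w"
proof (intro ext)
  fix k x
  have "dist2 v w \<le> 2 * pi * q\<^sup>2 * L\<^sup>2 * dist2 v w" using S_contraction[OF v(1) w(1)] v w by simp
  then have "(1 - 2 * pi * q\<^sup>2 * L\<^sup>2) * dist2 v w \<le> 0" by (simp add: algebra_simps)
  then have 0: "dist2 v w = 0" using small dist2_nonneg[of v w] by (simp add: mult_le_0_iff)
  show "v k x = w k x"
  proof (cases "k \<in> {1..N}")
    case True
    then show ?thesis using S_pointwise[OF v(1) w(1) True, of x] v w 0 by simp
  next
    case False
    then have "S v k x = S w k x" by (auto simp: S_def)
    then show ?thesis using v w by simp
  qed
qed

text \<open>Picard iteration from 0. The limit is formed pointwise and its membership in
  \<open>L2N\<close> comes from Fatou's lemma, so completeness of \<open>L^2\<close> is not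
  invoked.\<close>

lemma S_fixed_point_exists: "\<exists>v. L2N v \<and> S v = v"
proof -
  define V where "V n = (S ^^ n) (\<lambda>k x. 0)" for n
  have V_Suc: "V (Suc n) = S (V n)" for n by (simp add: V_def)
  have L: "L2N (V n)" for n
    by (induction n) (auto simp: V_Suc S_L2N, simp add: V_def L2N_def sq_integrable_def)
  have Vk: "sq_integrable (V n k)" if "k \<in> {1..N}" for n k using L[of n] that by (simp add: L2N_def)
  define rho where "rho = 2 * pi * q\<^sup>2 * L\<^sup>2"
  \<comment> \<open>\<open>rho\<close> contracts squared distances, so norms contract by its square
    root.\<close>
  define r where "r = sqrt rho"
  have rho: "0 \<le> rho" "rho < 1" using small by (auto simp: rho_def)
  then have r: "0 \<le> r" "r < 1" "r\<^sup>2 = rho" by (auto simp: r_def)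
  define D where "D = sqrt (dist2 (V 1) (V 0))"
  have D0: "D \<ge> 0" and D2: "D\<^sup>2 = dist2 (V 1) (V 0)" by (auto simp: D_def dist2_nonneg)
  have dist2_step: "dist2 (V (Suc n)) (V n) \<le> (r ^ n * D)\<^sup>2" for n
  proof (induction n)
    case (Suc n)
    have "dist2 (V (Suc (Suc n))) (V (Suc n)) \<le> rho * dist2 (V (Suc n)) (V n)"
      using S_contraction[OF L[of "Suc n"] L[of n]] by (simp add: V_Suc rho_def)
    also have "\<dots> \<le> rho * (r ^ n * D)\<^sup>2" using Suc rho by (intro mult_left_mono)
    also have "\<dots> = (r ^ Suc n * D)\<^sup>2" by (simp add: r(3)[symmetric] power_mult_distrib)
    finally show ?case .
  qed (simp add: D2)
  \<comment> \<open>The tail of the geometric series, bounded uniformly in \<open>n\<close>.\<close>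
  have gs: "(\<Sum>i=m..<n. r ^ i * D) \<le> r ^ m * D / (1 - r)" if "m \<le> n" for m n
  proof -
    have "(\<Sum>i=m..<n. r ^ i) * (1 - r) = r ^ m - r ^ n"
      using that
    proof (induction rule: dec_induct)
      case (step n)
      have "(\<Sum>i=m..<Suc n. r ^ i) * (1 - r) = (\<Sum>i=m..<n. r ^ i) * (1 - r) + r ^ n * (1 - r)"
        using step(1) by (simp add: distrib_right)
      also have "\<dots> = r ^ m - r ^ Suc n" unfolding step by (simp add: algebra_simps)
      finally show ?case .
    qed simp
    then have "(\<Sum>i=m..<n. r ^ i) \<le> r ^ m / (1 - r)" using r by (simp add: pos_le_divide_eq)
    from mult_right_mono[OF this D0] show ?thesis by (simp add: sum_distrib_right)
  qed
  have l2_step: "l2 (\<lambda>x. V n k x - V m k x) \<le> (\<Sum>i=m..<n. r ^ i * D)" if k: "k \<in> {1..N}" and "m \<le> n" for k m n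
    using that(2)
  proof (induction rule: dec_induct)
    case base
    then show ?case by (simp add: l2_def)
  next
    case (step n)
    have "l2 (\<lambda>x. V (Suc n) k x - V m k x) = l2 (\<lambda>x. (V (Suc n) k x - V n k x) + (V n k x - V m k x))" by simp
    also have "\<dots> \<le> l2 (\<lambda>x. V (Suc n) k x - V n k x) + l2 (\<lambda>x. V n k x - V m k x)"
      by (intro l2_triangle sq_integrable_diff Vk k)
    also have "l2 (\<lambda>x. V (Suc n) k x - V n k x) \<le> r ^ n * D"
    proof (rule power2_le_imp_le)
      show "(l2 (\<lambda>x. V (Suc n) k x - V n k x))\<^sup>2 \<le> (r ^ n * D)\<^sup>2"
        unfolding l2_power2 using dist2_component[OF k, of "V (Suc n)" "V n"] dist2_step[of n]
        by (rule order_trans)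
    qed (use r D0 in simp)
    finally show ?case using step by simp
  qed
  define eps where "eps m = r ^ m * D / (1 - r)" for m
  have eps0: "eps m \<ge> 0" for m using r D0 by (simp add: eps_def)
  have "(\<lambda>m. r ^ m * (D / (1 - r))) \<longlonglongrightarrow> 0 * (D / (1 - r))"
    by (intro tendsto_mult LIMSEQ_power_zero tendsto_const) (use r in auto)
  then have eps_lim: "eps \<longlonglongrightarrow> 0" unfolding eps_def[abs_def] by simp
  have comp: "(LINT x|lborel. (V n k x - V m k x)\<^sup>2) \<le> (eps m)\<^sup>2" if "k \<in> {1..N}" "m \<le> n" for k m n
    using power_mono[OF order_trans[OF l2_step[OF that] gs[OF that(2)]], of 2] by (simp add: l2_power2 eps_def)
  \<comment> \<open>The factor \<open>real N\<close> arises because \<open>dist2\<close> sums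
    \<open>N\<close> components, each at most \<open>e^2\<close>.\<close>
  define M where "M k = sqrt ((LINT y|lborel. (E k y)\<^sup>2) * L\<^sup>2 * real N)" for k
  have M0: "M k \<ge> 0" for k by (simp add: M_def)
  have near: "\<bar>S v k x - S w k x\<bar> \<le> M k * e"
    if "L2N v" "L2N w" "k \<in> {1..N}" "e \<ge> 0" "\<And>j. j \<in> {1..N} \<Longrightarrow> (LINT x|lborel. (v j x - w j x)\<^sup>2) \<le> e\<^sup>2"
    for v w k x e
  proof -
    have "dist2 v w \<le> (\<Sum>j=1..N. e\<^sup>2)" unfolding dist2_def using that(5) by (rule sum_mono)
    then have d: "dist2 v w \<le> real N * e\<^sup>2" by simp
    have "(S v k x - S w k x)\<^sup>2 \<le> (LINT y|lborel. (E k y)\<^sup>2) * L\<^sup>2 * dist2 v w"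
      by (rule S_pointwise[OF that(1-3)])
    also have "\<dots> \<le> (LINT y|lborel. (E k y)\<^sup>2) * L\<^sup>2 * (real N * e\<^sup>2)"
      by (intro mult_left_mono d) auto
    also have "\<dots> = (M k * e)\<^sup>2" by (simp add: M_def power_mult_distrib)
    finally show ?thesis
      using that(4) M0[of k] abs_le_square_iff[of "S v k x - S w k x" "M k * e"] by simp
  qed
  have "convergent (\<lambda>n. V n k x)" if k: "k \<in> {1..N}" for k x
  proof -
    \<comment> \<open>The index is shifted because pointwise control is available for images under
      \<open>S\<close>, and \<open>V (Suc n) = S (V n)\<close>.\<close>
    have "Cauchy (\<lambda>n. V (Suc n) k x)"
    proof (rule metric_CauchyI)
      fix e :: real assume e: "e > 0"
      have "(\<lambda>m. M k * eps m) \<longlonglongrightarrow> M k * 0" by (intro tendsto_mult tendsto_const eps_lim)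
      then have "\<forall>\<^sub>F m in sequentially. M k * eps m < e / 2" using e by (intro order_tendstoD) auto
      then obtain m where m: "M k * eps m < e / 2" by (auto simp: eventually_sequentially)
      have half: "\<bar>V (Suc n) k x - V (Suc m) k x\<bar> < e / 2" if "n \<ge> m" for n
        using near[OF L L k eps0 comp[OF _ that], of x] m by (simp add: V_Suc)
      have "dist (V (Suc n) k x) (V (Suc n') k x) < e" if "n \<ge> m" "n' \<ge> m" for n n'
        using half[OF that(1)] half[OF that(2)] unfolding dist_real_def by linarith
      then show "\<exists>m. \<forall>n\<ge>m. \<forall>n'\<ge>m. dist (V (Suc n) k x) (V (Suc n') k x) < e" by blast
    qed
    then show ?thesis
      using convergent_Suc_iff[of "\<lambda>n. V n k x"] by (simp add: Cauchy_convergent_iff)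
  qed
  then have lim: "(\<lambda>n. V n k x) \<longlonglongrightarrow> lim (\<lambda>n. V n k x)" if "k \<in> {1..N}" for k x
    using that by (simp add: convergent_LIMSEQ_iff)
  define v where "v k x = (if k \<in> {1..N} then lim (\<lambda>n. V n k x) else 0)" for k x
  have vlim: "(\<lambda>n. V n k x) \<longlonglongrightarrow> v k x" if "k \<in> {1..N}" for k x
    using lim[OF that] that unfolding v_def by simp
  \<comment> \<open>With \<open>m\<close> fixed and \<open>n\<close> tending to infinity, Fatou's
    lemma carries the Cauchy estimate over to the limit.\<close>
  have fat: "sq_integrable (\<lambda>x. v k x - V m k x)" "(LINT x|lborel. (v k x - V m k x)\<^sup>2) \<le> (eps m)\<^sup>2"
    if k: "k \<in> {1..N}" for k m
  proof -
    have "sq_integrable (\<lambda>x. V n k x - V m k x)" for n by (intro sq_integrable_diff Vk k)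
    moreover have "(\<lambda>n. V n k x - V m k x) \<longlonglongrightarrow> v k x - V m k x" for x
      by (intro tendsto_diff tendsto_const vlim k)
    ultimately show "sq_integrable (\<lambda>x. v k x - V m k x)" "(LINT x|lborel. (v k x - V m k x)\<^sup>2) \<le> (eps m)\<^sup>2"
      using Fatou_square[of "\<lambda>n x. V n k x - V m k x" "\<lambda>x. v k x - V m k x" m "(eps m)\<^sup>2"]
        comp[OF k] by auto
  qed
  have Lv: "L2N v"
    unfolding L2N_def
  proof
    fix k assume k: "k \<in> {1..N}"
    show "sq_integrable (v k)" using sq_integrable_add[OF fat(1)[OF k, of 0] Vk[OF k, of 0]] by simp
  qed
  have "S v k x = v k x" for k x
  proof (cases "k \<in> {1..N}")
    case True
    have le: "\<bar>S v k x - V (Suc m) k x\<bar> \<le> M k * eps m" for m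
      using near[OF Lv L[of m] True eps0[of m] fat(2)[of _ m], of x] by (simp add: V_Suc)
    have "(\<lambda>m. V (Suc m) k x - S v k x) \<longlonglongrightarrow> 0"
    proof (rule Lim_null_comparison)
      show "\<forall>\<^sub>F m in sequentially. norm (V (Suc m) k x - S v k x) \<le> M k * eps m"
        using le by (simp add: abs_minus_commute)
      show "(\<lambda>m. M k * eps m) \<longlonglongrightarrow> 0"
        using tendsto_mult[OF tendsto_const eps_lim] by simp
    qed
    then have "(\<lambda>m. V (Suc m) k x) \<longlonglongrightarrow> S v k x" by (rule LIM_zero_cancel)
    moreover have "(\<lambda>m. V (Suc m) k x) \<longlonglongrightarrow> v k x"
      by (rule LIMSEQ_Suc[OF vlim[OF True]])
    ultimately show ?thesis by (rule LIMSEQ_unique)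
  next
    case False
    then show ?thesis unfolding S_def v_def by (simp only: if_False)
  qed
  with Lv show ?thesis by (intro exI[of _ v]) auto
qed

end

section \<open>From the constant \<open>Q\<close> to the contraction\<close>

lemma Linf_norm_AE: "AE p in lborel. ereal (cmod (f p)) \<le> Linf_norm f"
  unfolding Linf_norm_def by (rule esssup_AE)

text \<open>The essential supremum is an extended real. Since \<open>lborel\<close> is not the zero
  measure, an almost everywhere valid statement without a variable is true.\<close>

lemma Linf_norm_nonneg: "0 \<le> Linf_norm f"
proof -
  have "AE p in (lborel :: real measure). 0 \<le> Linf_norm f"
    using Linf_norm_AE[of f] by eventually_elim (erule order_trans[rotated], simp)
  moreover have "ae_filter (lborel :: real measure) \<noteq> bot" by (simp add: ae_filter_eq_bot_iff)
  ultimately show ?thesis by (simp add: eventually_const_iff)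
qed

text \<open>The real part \<open>p^2 - a\<close> of the symbol vanishes at most at two points, a
  null set; elsewhere the quotient is the transform of \<open>E\<close>.\<close>

lemma resolvent_kernel_fourier_bound:
  assumes E: "resolvent_kernel b a G E E'" and G: "integrable lborel G"
    and le: "Linf_norm (\<lambda>p. fourier G p / ((of_real p)\<^sup>2 - of_real a - \<i> * of_real (b * p))) \<le> ereal q"
  shows "AE p in lborel. cmod (fourier E p) \<le> q"
  using Linf_norm_AE[of "\<lambda>p. fourier G p / ((of_real p)\<^sup>2 - of_real a - \<i> * of_real (b * p))"]
    AE_lborel_singleton[of "sqrt a"] AE_lborel_singleton[of "- sqrt a"]
proof eventually_elim
  case (elim p)
  let ?s = "(complex_of_real p)\<^sup>2 - of_real a - \<i> * of_real (b * p)"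
  have "?s \<noteq> 0"
  proof
    assume "?s = 0"
    then have "Re ?s = 0" by (simp only: zero_complex.sel)
    then have "p\<^sup>2 = a" by simp
    then have "\<bar>p\<bar> = sqrt a" by auto
    then show False using elim by (auto simp: abs_if split: if_splits)
  qed
  then have "fourier G p / ?s = fourier E p"
    using fourier_resolvent_kernel[OF E G, of p] by simp
  then have "ereal (cmod (fourier E p)) \<le> ereal q" using order_trans[OF elim(1) le] by simp
  then show ?case by simp
qed

text \<open>The first conjunct gives the description \<open>THE u\<close> inside \<open>Tab\<close>
  its meaning. The third identifies fixed points with solutions of the nonlinear system, so
  uniqueness in the second applies to both.\<close>

theorem theorem2p2:
  fixes N K l r :: nat
    and G :: "nat \<Rightarrow> real \<Rightarrow> real"
    and a b :: "nat \<Rightarrow> real"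
    and F :: "nat \<Rightarrow> (nat \<Rightarrow> real) \<Rightarrow> real \<Rightarrow> real"
    and h :: "real \<Rightarrow> real"
    and KK L :: real
  assumes N4: "N \<ge> 4" and K2: "K \<ge> 2"
    and l_rng: "1 \<le> l" "l \<le> K - 1"
    and r_rng: "K + 1 \<le> r" "r \<le> N - 1"
    and G_L1: "\<forall>k\<in>{1..N}. integrable lborel (G k)"
    and a_nonneg: "\<forall>k\<in>{1..N}. a k \<ge> 0"
    and b_nz: "\<forall>k\<in>{1..K}. b k \<noteq> 0"
    and F_car: "\<forall>k\<in>{1..N}. caratheodory N (F k)"
    and KK_pos: "KK > 0"
    and h_nonneg: "\<forall>x. h x \<ge> 0" and h_L2: "sq_integrable h"
    and F_growth: "\<forall>u x. sqrt (\<Sum>k=1..N. (F k u x)\<^sup>2) \<le> KK * vnorm N u + h x"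
    and L_pos: "L > 0"
    and F_lip: "\<forall>u1 u2 x. sqrt (\<Sum>k=1..N. (F k u1 x - F k u2 x)\<^sup>2)
                          \<le> L * vnorm N (\<lambda>j. u1 j - u2 j)"
    and cond_a: "\<forall>k\<in>{1..l}. a k > 0"
    and cond_b: "\<forall>k\<in>{l+1..K}. a k = 0 \<and> integrable lborel (\<lambda>x. x * G k x)
                     \<and> (LINT x|lborel. G k x) = 0"
    and cond_c: "\<forall>k\<in>{K+1..r}. a k > 0 \<and> integrable lborel (\<lambda>x. x * G k x)
           \<and> (LINT x|lborel. complex_of_real (G k x) * exp (- \<i> * complex_of_real (sqrt (a k) * x))) = 0
           \<and> (LINT x|lborel. complex_of_real (G k x) * exp (\<i> * complex_of_real (sqrt (a k) * x))) = 0"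
    and cond_d: "\<forall>k\<in>{r+1..N}. a k = 0 \<and> integrable lborel (\<lambda>x. x\<^sup>2 * G k x)
                     \<and> (LINT x|lborel. G k x) = 0 \<and> (LINT x|lborel. x * G k x) = 0"
    and Q_small: "ereal (2 * sqrt pi * L) * Qconst N K a b G < 1"
  shows "(\<forall>v. H2N N v \<longrightarrow> (\<exists>!u. H2N N u \<and> lin_sys N K a b G F v u))
       \<and> (\<exists>!v. H2N N v \<and> Tab N K a b G F v = v)
       \<and> (\<forall>v. H2N N v \<longrightarrow> (Tab N K a b G F v = v \<longleftrightarrow> nonlin_sys N K a b G F v))
       \<and> ((\<exists>k\<in>{1..N}. \<exists>\<phi>. is_L2_fourier (\<lambda>x. F k (\<lambda>j. 0) x) \<phi> \<and>
              emeasure lborel {p. \<phi> p \<noteq> 0 \<and> fourier (G k) p \<noteq> 0} \<noteq> 0)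
          \<longrightarrow> (\<forall>v. H2N N v \<and> Tab N K a b G F v = v \<longrightarrow> v \<noteq> (\<lambda>k x. 0)))"
proof -
  have KN: "K < N" using r_rng N4 by linarith
  \<comment> \<open>Extending \<open>b\<close> by 0 merges the two groups of equations into one
    family.\<close>
  define \<beta> where "\<beta> k = (if k \<le> K then b k else 0)" for k
  have "\<exists>E E'. resolvent_kernel (\<beta> k) (a k) (G k) E E'" if k: "k \<in> {1..N}" for k
  proof -
    have G: "integrable lborel (G k)" using G_L1 k by blast
    \<comment> \<open>The four index ranges match the positions of the characteristic roots: both
      off the imaginary axis, one at 0, a conjugate imaginary pair, a double root at 0.\<close>
    consider "k \<in> {1..l}" | "k \<in> {l+1..K}" | "k \<in> {K+1..r}" | "k \<in> {r+1..N}"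
      using k by force
    then show ?thesis
    proof cases
      case 1
      then have "\<beta> k \<noteq> 0" "a k > 0" using b_nz cond_a l_rng by (auto simp: \<beta>_def)
      then show ?thesis using resolvent_kernel_damped[OF G] by metis
    next
      case 2
      then have "\<beta> k \<noteq> 0" using b_nz by (auto simp: \<beta>_def)
      moreover have "a k = 0" "integrable lborel (\<lambda>x. x * G k x)" "(LINT x|lborel. G k x) = 0"
        using cond_b 2 by blast+
      ultimately show ?thesis using resolvent_kernel_damped_zero[OF G] by metis
    next
      case 3
      then have "\<beta> k = 0" by (auto simp: \<beta>_def)
      moreover have c: "a k > 0" "integrable lborel (\<lambda>x. x * G k x)"
        "(LINT x|lborel. complex_of_real (G k x) * exp (- \<i> * complex_of_real (sqrt (a k) * x))) = 0"
        "(LINT x|lborel. complex_of_real (G k x) * exp (\<i> * complex_of_real (sqrt (a k) * x))) = 0"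
        using cond_c 3 by blast+
      ultimately show ?thesis using resolvent_kernel_oscillating[OF G c] by metis
    next
      case 4
      then have "\<beta> k = 0" using r_rng by (auto simp: \<beta>_def)
      moreover have "a k = 0" and c: "integrable lborel (\<lambda>x. x\<^sup>2 * G k x)"
        "(LINT x|lborel. G k x) = 0" "(LINT x|lborel. x * G k x) = 0"
        using cond_d 4 by blast+
      ultimately show ?thesis using resolvent_kernel_free[OF G c] by metis
    qed
  qed
  then obtain E E' where RK: "\<And>k. k \<in> {1..N} \<Longrightarrow> resolvent_kernel (\<beta> k) (a k) (G k) (E k) (E' k)"
    by metis
  define Q where "Q = Qconst N K a b G"
  have sym_le: "Linf_norm (\<lambda>p. fourier (G k) p / ((of_real p)\<^sup>2 - of_real (a k) - \<i> * of_real (\<beta> k * p))) \<le> Q"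
    if k: "k \<in> {1..N}" for k
  proof (cases "k \<le> K")
    case True
    have "Linf_norm (\<lambda>p. fourier (G k) p / ((of_real p)\<^sup>2 - of_real (a k) - \<i> * of_real (\<beta> k * p))) \<le> Nabk a b G k"
      using True by (simp add: Nabk_def \<beta>_def)
    also have "\<dots> \<le> Q" unfolding Q_def Qconst_def using True k by (intro Max_ge) auto
    finally show ?thesis .
  next
    case False
    have "Linf_norm (\<lambda>p. fourier (G k) p / ((of_real p)\<^sup>2 - of_real (a k) - \<i> * of_real (\<beta> k * p))) \<le> Mak a G k"
      using False by (simp add: Mak_def \<beta>_def)
    also have "\<dots> \<le> Q" unfolding Q_def Qconst_def using False k by (intro Max_ge) auto
    finally show ?thesis .
  qed
  have c: "2 * sqrt pi * L > 0" using L_pos by simp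
  have Q0: "Q \<ge> 0" using order_trans[OF Linf_norm_nonneg sym_le[of 1]] N4 by simp
  have "ereal x * \<infinity> = \<infinity>" if "x > 0" for x using that by simp
  \<comment> \<open>The factor \<open>2 * sqrt pi * L\<close> is positive, so an infinite
    \<open>Q\<close> would make the product in \<open>Q_small\<close> infinite.\<close>
  from this[OF c] have Qfin: "Q \<noteq> \<infinity>" using Q_small unfolding Q_def[symmetric] by auto
  then obtain q where q: "Q = ereal q" "q \<ge> 0" using Q0 by (cases Q) auto
  have "2 * sqrt pi * L * q < 1" using Q_small unfolding Q_def[symmetric] q(1) by (simp add: one_ereal_def)
  moreover have "0 \<le> 2 * sqrt pi * L * q" using c q(2) by simp
  \<comment> \<open>The square is \<open>4 * pi * q^2 * L^2\<close>, twice the contraction factor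
    for squared distances.\<close>
  ultimately have "(2 * sqrt pi * L * q)\<^sup>2 < 1" by (simp add: power_less_one_iff)
  then have "2 * (2 * pi * q\<^sup>2 * L\<^sup>2) < 1" by (simp add: power_mult_distrib mult_ac)
  moreover have "0 \<le> 2 * pi * q\<^sup>2 * L\<^sup>2" by simp
  ultimately have small: "2 * pi * q\<^sup>2 * L\<^sup>2 < 1" by linarith
  interpret convolution_contraction N E E' F h KK L q
  proof
    fix k assume k: "k \<in> {1..N}"
    show "ac_deriv (E k) (E' k)" "integrable lborel (E k)" "integrable lborel (E' k)"
      using RK[OF k] by (auto simp: resolvent_kernel_def)
    show "AE p in lborel. cmod (fourier (E k) p) \<le> q"
      using resolvent_kernel_fourier_bound[OF RK[OF k]] G_L1 k sym_le[OF k] q(1) by simp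
    show "caratheodory N (F k)" using F_car k by blast
  next
    show "sqrt (\<Sum>k=1..N. (F k u x)\<^sup>2) \<le> KK * vnorm N u + h x" for u x using F_growth by blast
    show "sqrt (\<Sum>k=1..N. (F k u1 x - F k u2 x)\<^sup>2) \<le> L * vnorm N (\<lambda>j. u1 j - u2 j)" for u1 u2 x
      using F_lip by blast
  qed (fact h_L2 small)+
  have G: "integrable lborel (G k)" if "k \<in> {1..N}" for k using G_L1 that by blast
  have lin_iff: "lin_sys N K a b G F v u \<longleftrightarrow> (\<forall>k\<in>{1..N}. \<exists>u' u''. H2_witness (u k) u' u'' \<and>
      (AE x in lborel. - u'' x - \<beta> k * u' x - a k * u k x = conv (G k) (Fc v k) x))" for v u
  proof -
    have "{1..N} = {1..K} \<union> {K+1..N}" using KN by auto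
    then show ?thesis unfolding lin_sys_def by (simp add: ball_Un \<beta>_def Fc_def[abs_def])
  qed
  have nonlin_iff: "nonlin_sys N K a b G F v \<longleftrightarrow> lin_sys N K a b G F v v" for v
  proof -
    have "u'' + b' * u' + a' * u + w = 0 \<longleftrightarrow> - u'' - b' * u' - a' * u = w" "u'' + a' * u + w = 0 \<longleftrightarrow> - u'' - a' * u = w"
      for u u' u'' a' b' w :: real by linarith+
    then show ?thesis unfolding nonlin_sys_def lin_sys_def by simp
  qed
  have L2N: "L2N v" if "H2N N v" for v
    using that unfolding L2N_def H2N_def H2_def H2_witness_def by blast
  \<comment> \<open>Convolution with the kernels gains regularity: \<open>S\<close> maps square
    integrable data into the Sobolev space.\<close>
  have S_solves: "H2N N (S v)" "lin_sys N K a b G F v (S v)" if v: "L2N v" for v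
  proof -
    have *: "\<exists>u' u''. H2_witness (S v k) u' u'' \<and>
      (AE x in lborel. - u'' x - \<beta> k * u' x - a k * S v k x = conv (G k) (Fc v k) x)" if k: "k \<in> {1..N}" for k
    proof -
      have "S v k = conv (E k) (Fc v k)" using k by (simp add: S_def)
      then show ?thesis
        using resolvent_kernel_solves[OF RK[OF k] G[OF k] Fc_sq_integrable[OF v k]] by metis
    qed
    then show "lin_sys N K a b G F v (S v)" by (simp add: lin_iff)
    have "H2 (S v k)" if "k \<in> {1..N}" for k using *[OF that] unfolding H2_def by blast
    moreover have "S v k = (\<lambda>x. 0)" if "k \<notin> {1..N}" for k using that unfolding S_def by (simp only: if_False)
    ultimately show "H2N N (S v)" unfolding H2N_def by blast
  qed
  have S_unique: "u = S v" if v: "L2N v" and u: "H2N N u" "lin_sys N K a b G F v u" for u v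
  proof
    fix k
    show "u k = S v k"
    proof (cases "k \<in> {1..N}")
      case True
      obtain u' u'' where 1: "H2_witness (u k) u' u''"
        "AE x in lborel. - u'' x - \<beta> k * u' x - a k * u k x = conv (G k) (Fc v k) x"
        using u(2) True unfolding lin_iff by blast
      obtain s' s'' where 2: "H2_witness (S v k) s' s''"
        "AE x in lborel. - s'' x - \<beta> k * s' x - a k * S v k x = conv (G k) (Fc v k) x"
        using S_solves(2)[OF v] True unfolding lin_iff by blast
      show ?thesis using H2_linear_solution_unique[OF 1 2] a_nonneg True by blast
    next
      case False
      then have "u k = (\<lambda>x. 0)" using u(1) unfolding H2N_def by blast
      then show ?thesis using False unfolding S_def by (simp only: if_False)
    qed
  qed
  have Tab: "Tab N K a b G F v = S v" if "H2N N v" for v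
    unfolding Tab_def using S_solves[OF L2N[OF that]] S_unique[OF L2N[OF that]] by (intro the_equality; blast)
  \<comment> \<open>The fixed point is found among square integrable functions and lies in the
    Sobolev space because \<open>v0 = S v0\<close>.\<close>
  obtain v0 where v0: "L2N v0" "S v0 = v0" using S_fixed_point_exists by blast
  have H2_v0: "H2N N v0" using S_solves(1)[OF v0(1)] v0(2) by simp
  have "\<exists>!u. H2N N u \<and> lin_sys N K a b G F v u" if "H2N N v" for v
    using S_solves[OF L2N[OF that]] S_unique[OF L2N[OF that]] by (intro ex1I[of _ "S v"]; blast)
  moreover have "\<exists>!v. H2N N v \<and> Tab N K a b G F v = v"
  proof (intro ex1I[of _ v0] conjI)
    show "H2N N v0" by fact
    show "Tab N K a b G F v0 = v0" using Tab[OF H2_v0] v0 by simp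
    show "v = v0" if "H2N N v \<and> Tab N K a b G F v = v" for v
      using S_fixed_point_unique[of v v0] that v0 L2N[of v] Tab[of v] by simp
  qed
  moreover have "Tab N K a b G F v = v \<longleftrightarrow> nonlin_sys N K a b G F v" if v: "H2N N v" for v
    unfolding Tab[OF v] nonlin_iff
    using S_solves(2)[OF L2N[OF v]] S_unique[OF L2N[OF v] v] by metis
  moreover have "v \<noteq> (\<lambda>k x. 0)"
    if k: "k \<in> {1..N}" and phi: "is_L2_fourier (\<lambda>x. F k (\<lambda>j. 0) x) \<phi>"
      and pos: "emeasure lborel {p. \<phi> p \<noteq> 0 \<and> fourier (G k) p \<noteq> 0} \<noteq> 0"
      and v: "H2N N v" "Tab N K a b G F v = v" for k \<phi> v
  proof
    assume 0: "v = (\<lambda>k x. 0)"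
    have w: "sq_integrable (Fc v k)" by (rule Fc_sq_integrable[OF L2N[OF v(1)] k])
    have phi': "is_L2_fourier (Fc v k) \<phi>" using phi by (simp add: Fc_def[abs_def] 0)
    have "S v k = (\<lambda>x. 0)" using Tab[OF v(1)] v(2) 0 by simp
    then have z: "conv (E k) (Fc v k) x = 0" for x using k by (auto simp: S_def fun_eq_iff)
    have null: "emeasure lborel {p. \<phi> p \<noteq> 0 \<and> fourier (E k) p \<noteq> 0} = 0"
      by (rule conv_eq_0_fourier[OF iE[OF k] w phi']) (simp add: z)
    \<comment> \<open>\<open>fourier G\<close> is the symbol times \<open>fourier E\<close>, so it
      can be nonzero only where \<open>fourier E\<close> is. The null set obtained for
      \<open>E k\<close> therefore contains the set of positive measure in
      \<open>pos\<close>.\<close>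
    have sub: "{p. \<phi> p \<noteq> 0 \<and> fourier (G k) p \<noteq> 0} \<subseteq> {p. \<phi> p \<noteq> 0 \<and> fourier (E k) p \<noteq> 0}"
      using fourier_resolvent_kernel[OF RK[OF k] G[OF k]] by auto
    have sets: "{p. \<phi> p \<noteq> 0 \<and> fourier (E k) p \<noteq> 0} \<in> sets lborel"
    proof -
      note [measurable] = borel_measurable_integrable[OF iE[OF k]]
      have [measurable]: "\<phi> \<in> borel_measurable borel" using phi by (simp add: is_L2_fourier_def)
      show ?thesis by measurable
    qed
    show False using pos emeasure_mono[OF sub sets] unfolding null by simp
  qed
  ultimately show ?thesis by blast
qed

end
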